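(* Let $\mathfrak g=\mathfrak{sl}(2)$ and let $M(\lambda)$, $\lambda\in\mathbb F$, be the imaginary Verma module over $\mathcal L(\mathfrak g)=\mathfrak g\otimes\mathbb F[t,t^{-1}]$ with highest weight vector $v$. Let $x\in\mathbb F$ be such that there are constants $c_{k,y}\in\mathbb F$ ($k\in\mathbb Z_{\ge0}$, $y\in x+\mathbb Z$) with $$e_\alpha^k\cdot(f_\alpha^{y}\cdot v)=c_{k,y}\,f_\alpha^{y-k}\cdot v\quad\text{and}\quad c_{k,y}\ne0\qquad\text{for all }k\in\mathbb Z_{\ge0},\ y\in x+\mathbb Z.$$ Then the twisted localization $\mathcal D_x^{\alpha}M(\lambda)$ is a simple $\mathcal L(\mathfrak g)$-module.
   Context: $\mathbb F$ is an algebraically closed field of characteristic zero. Let $\{e,f,h\}$ be a standard basis of $\mathfrak{sl}(2)$ and put $e_\alpha=e\otimes t^0$, $f_\alpha=f\otimes t^0$. $\mathcal L(\mathfrak g)$ has bracket $[x\otimes t^m,y\otimes t^n]=[x,y]\otimes t^{m+n}$. Let $\mathcal N^+$, $\mathcal H$, $\mathcal N^-$ be the subalgebras spanned by $e\otimes t^n$, by $h\otimes t^n$, and by $f\otimes t^n$ ($n\in\mathbb Z$) respectively. The imaginary Verma module is $M(\lambda)=U(\mathcal L(\mathfrak g))\otimes_{U(\mathcal H\oplus\mathcal N^+)}\mathbb Fv$, where $\mathcal N^+\cdot v=0$, $(h\otimes t^n)\cdot v=0$ for $n\ne0$ and $(h\otimes t^0)\cdot v=\lambda v$. (By a result of Futorny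 it is simple if $\lambda\ne0$.) The element $f_\alpha$ acts injectively on $M(\lambda)$. Twisted localization: let $U=U(\mathcal L(\mathfrak g))$ and let $U_\alpha$ be its Ore localization with respect to $\{f_\alpha^n\mid n\in\mathbb Z_{\ge0}\}$; $\mathcal D_\alpha M=U_\alpha\otimes_UM$. For $z\in\mathbb F$, $u\in U_\alpha$, $\Theta_z(u)=\sum_{i\ge0}\binom zi\,\mathrm{ad}(f_\alpha)^i(u)f_\alpha^{-i}$ (a finite sum). For a $U_\alpha$-module $R$, $\Phi_\alpha^zR=\{w^z\mid w\in R\}$ is a copy of $R$ with action $u\cdot w^z=(\Theta_z(u)\cdot w)^z$. One writes $f_\alpha^z\cdot w:=w^{-z}\in\Phi_\alpha^{-z}R$, and for $l\in\mathbb Z$ one identifies $f_\alpha^{z+l}\cdot w=f_\alpha^z\cdot(f_\alpha^lw)$. Here $\mathcal D_x^{\alpha}M(\lambda)$ denotes the twisted localization of $M(\lambda)$ that contains the vectors $f_\alpha^{y}\cdot v$, $y\in x+\mathbb Z$, i.e. the module of all elements $f_\alpha^{x}\cdot w$ with $w\in\mathcal D_\alpha M(\lambda)$; in terms of $\Phi_\alpha$ it is $\Phi_\alpha^{-x}(\mathcal D_\alpha M(\lambda))$.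
   Formalization: The highest weight λ is assumed to be nonzero; for λ = 0 the claim is false, since the hypothesis on the constants holds for example for x = 1/2 while the twisted localization of M(0) is not simple. *)

theory Defs
  imports
    "HOL-Analysis.Determinants"
    "HOL-Library.Poly_Mapping"
    "HOL-Library.Groups_Big_Fun"
    "HOL-Computational_Algebra.Polynomial"
    "HOL-Algebra.Free_Abelian_Groups"
    "HOL-Algebra.Module"
begin

section \<open>The Lie algebra \<open>sl(2)\<close> and its loop algebra\<close>

typedef (overloaded) 'a sl2 = "{A :: 'a::field ^ 2 ^ 2. trace A = 0}"
  morphisms sl2_mat Abs_sl2
  by (rule exI[of _ 0]) (simp add: trace_def)

setup_lifting type_definition_sl2

instantiation sl2 :: (field) ab_group_add
begin
lift_definition zero_sl2 :: "'a sl2" is 0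
  by (simp add: trace_def)
lift_definition plus_sl2 :: "'a sl2 \<Rightarrow> 'a sl2 \<Rightarrow> 'a sl2" is "(+)"
  by (simp add: trace_add)
lift_definition minus_sl2 :: "'a sl2 \<Rightarrow> 'a sl2 \<Rightarrow> 'a sl2" is "(-)"
  by (simp add: trace_sub)
lift_definition uminus_sl2 :: "'a sl2 \<Rightarrow> 'a sl2" is uminus
  by (simp add: trace_def sum_negf)
instance
  by standard (transfer; simp add: algebra_simps)+
end

lift_definition sl2_scale :: "'a::field \<Rightarrow> 'a sl2 \<Rightarrow> 'a sl2" is
  "\<lambda>c A. \<chi> i j. c * A $ i $ j"
  by (simp add: trace_def flip: sum_distrib_left)

lift_definition sl2_bracket :: "'a::field sl2 \<Rightarrow> 'a sl2 \<Rightarrow> 'a sl2" is "\<lambda>A B. A ** B - B ** A"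
  by (metis (no_types) diff_self trace_mul_sym trace_sub)

lift_definition sl2_e :: "'a::field sl2" is "vector [vector [0, 1], vector [0, 0]]"
  by (simp add: trace_def sum_2)
lift_definition sl2_f :: "'a::field sl2" is "vector [vector [0, 0], vector [1, 0]]"
  by (simp add: trace_def sum_2)
lift_definition sl2_h :: "'a::field sl2" is "vector [vector [1, 0], vector [0, - 1]]"
  by (simp add: trace_def sum_2)

lemma sl2_standard_basis:
  "sl2_bracket sl2_e sl2_f = (sl2_h :: 'a::field sl2)"
  "sl2_bracket sl2_h sl2_e = sl2_scale 2 (sl2_e :: 'a::field sl2)"
  "sl2_bracket sl2_h sl2_f = sl2_scale (- 2) (sl2_f :: 'a::field sl2)"
  by (transfer; simp add: vec_eq_iff forall_2 matrix_matrix_mult_def sum_2)+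

text \<open>Since \<open>\<gg> \<otimes> F[t, t\<^sup>-\<^sup>1]\<close> is the direct sum of the spaces \<open>\<gg> \<otimes> t\<^sup>n\<close>, its elements are the
  finitely supported families of elements of \<open>\<gg>\<close> indexed by the integers.\<close>

type_synonym 'a loop = "int \<Rightarrow>\<^sub>0 'a sl2"

abbreviation loop_elt :: "'a::field sl2 \<Rightarrow> int \<Rightarrow> 'a loop"
  where "loop_elt x n \<equiv> Poly_Mapping.single n x" \<comment> \<open>\<open>x \<otimes> t\<^sup>n\<close>\<close>

lemma sl2_scale_zero: "sl2_scale c 0 = 0"
  by transfer (simp add: vec_eq_iff)

lift_definition loop_scale :: "'a::field \<Rightarrow> 'a loop \<Rightarrow> 'a loop" is
  "\<lambda>c p n. sl2_scale c (p n)"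
proof -
  fix c :: 'a and p :: "int \<Rightarrow> 'a sl2"
  assume "finite {n. p n \<noteq> 0}"
  moreover have "{n. sl2_scale c (p n) \<noteq> 0} \<subseteq> {n. p n \<noteq> 0}"
    by (auto simp: sl2_scale_zero)
  ultimately show "finite {n. sl2_scale c (p n) \<noteq> 0}"
    by (rule rev_finite_subset)
qed

definition loop_bracket :: "'a::field loop \<Rightarrow> 'a loop \<Rightarrow> 'a loop" where
  "loop_bracket p q = (\<Sum>m\<in>Poly_Mapping.keys p. \<Sum>n\<in>Poly_Mapping.keys q.
     loop_elt (sl2_bracket (Poly_Mapping.lookup p m) (Poly_Mapping.lookup q n)) (m + n))"

global_interpretation loop: vector_space loop_scale
  defines loop_span = loop.span
proof -
  have sl2: "sl2_scale a (x + y) = sl2_scale a x + sl2_scale a y"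
    "sl2_scale (a + b) x = sl2_scale a x + sl2_scale b x"
    "sl2_scale a (sl2_scale b x) = sl2_scale (a * b) x" "sl2_scale 1 x = x"
    for a b :: 'a and x y
    by (transfer; simp add: vec_eq_iff algebra_simps)+
  show "vector_space (loop_scale :: 'a \<Rightarrow> _)"
    by standard (auto intro!: poly_mapping_eqI simp: loop_scale.rep_eq lookup_add sl2)
qed

definition loop_N_plus :: "'a::field loop set" where
  "loop_N_plus = loop_span (range (\<lambda>n. loop_elt sl2_e n))"

definition loop_H :: "'a::field loop set" where
  "loop_H = loop_span (range (\<lambda>n. loop_elt sl2_h n))"


section \<open>The universal enveloping algebra of the loop algebra\<close>

datatype 'b fword = Fword "'b list"

instantiation fword :: (type) monoid_add
begin
definition "0 = Fword []"
fun plus_fword :: "'a fword \<Rightarrow> 'a fword \<Rightarrow> 'a fword" where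
  "Fword u + Fword w = Fword (u @ w)"
instance
proof
  fix a b c :: "'a fword"
  show "a + b + c = a + (b + c)" by (cases a; cases b; cases c) simp
  show "0 + a = a" "a + 0 = a" by (cases a; simp add: zero_fword_def)+
qed
end

text \<open>The free associative algebra on the set of all elements of the loop algebra: the monoid
  algebra of the words in these elements, with the convolution product of
  \<^typ>\<open>'b fword \<Rightarrow>\<^sub>0 'a::field\<close>. Dividing by the relations below (the first two make the
  inclusion of generators linear) gives the enveloping algebra.\<close>

type_synonym 'a free_alg = "'a loop fword \<Rightarrow>\<^sub>0 'a"

definition free_gen :: "'a::field loop \<Rightarrow> 'a free_alg" where
  "free_gen x = Poly_Mapping.single (Fword [x]) 1"

definition free_scalar :: "'a::field \<Rightarrow> 'a free_alg" where
  "free_scalar c = Poly_Mapping.single 0 c"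

inductive_set uea_ideal :: "'a::field free_alg set" where
  zero: "0 \<in> uea_ideal"
| add: "p \<in> uea_ideal \<Longrightarrow> q \<in> uea_ideal \<Longrightarrow> p + q \<in> uea_ideal"
| mult_left: "p \<in> uea_ideal \<Longrightarrow> q * p \<in> uea_ideal"
| mult_right: "p \<in> uea_ideal \<Longrightarrow> p * q \<in> uea_ideal"
| rel_add: "free_gen (x + y) - free_gen x - free_gen y \<in> uea_ideal"
| rel_scale: "free_gen (loop_scale c x) - free_scalar c * free_gen x \<in> uea_ideal"
| rel_bracket:
    "free_gen x * free_gen y - free_gen y * free_gen x - free_gen (loop_bracket x y) \<in> uea_ideal"

lemma uea_ideal_uminus: "p \<in> uea_ideal \<Longrightarrow> - p \<in> uea_ideal"
  using uea_ideal.mult_left[of p "- 1"] by simp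

lemma uea_ideal_diff: "p \<in> uea_ideal \<Longrightarrow> q \<in> uea_ideal \<Longrightarrow> p - q \<in> uea_ideal"
  using uea_ideal.add[OF _ uea_ideal_uminus, of p q] by simp

definition uea_rel :: "'a::field free_alg \<Rightarrow> 'a free_alg \<Rightarrow> bool" where
  "uea_rel p q \<longleftrightarrow> p - q \<in> uea_ideal"

lemma uea_rel_refl: "p = q \<Longrightarrow> uea_rel p q"
  by (simp add: uea_rel_def uea_ideal.zero)

lemma uea_rel_equivp: "equivp (uea_rel :: 'a::field free_alg \<Rightarrow> _)"
proof (rule equivpI)
  show "reflp (uea_rel :: 'a free_alg \<Rightarrow> _)"
    by (rule reflpI) (rule uea_rel_refl, rule refl)
  show "symp (uea_rel :: 'a free_alg \<Rightarrow> _)"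
  proof (rule sympI)
    fix p q :: "'a free_alg"
    assume "uea_rel p q"
    then have "- (p - q) \<in> uea_ideal"
      unfolding uea_rel_def by (rule uea_ideal_uminus)
    then show "uea_rel q p"
      by (simp add: uea_rel_def)
  qed
  show "transp (uea_rel :: 'a free_alg \<Rightarrow> _)"
  proof (rule transpI)
    fix p q r :: "'a free_alg"
    assume "uea_rel p q" "uea_rel q r"
    then have "(p - q) + (q - r) \<in> uea_ideal"
      unfolding uea_rel_def by (rule uea_ideal.add)
    then show "uea_rel p r"
      by (simp add: uea_rel_def)
  qed
qed

quotient_type (overloaded) 'a uea = "'a::field free_alg" / uea_rel
  by (rule uea_rel_equivp)

instantiation uea :: (field) "{ring, monoid_mult}"
begin
lift_definition zero_uea :: "'a uea" is 0 .
lift_definition one_uea :: "'a uea" is 1 .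
lift_definition plus_uea :: "'a uea \<Rightarrow> 'a uea \<Rightarrow> 'a uea" is "(+)"
proof -
  fix p p' q q' :: "'a free_alg"
  assume "uea_rel p p'" "uea_rel q q'"
  then have "(p - p') + (q - q') \<in> uea_ideal"
    unfolding uea_rel_def by (rule uea_ideal.add)
  then show "uea_rel (p + q) (p' + q')"
    by (simp add: uea_rel_def add_diff_add)
qed
lift_definition minus_uea :: "'a uea \<Rightarrow> 'a uea \<Rightarrow> 'a uea" is "(-)"
proof -
  fix p p' q q' :: "'a free_alg"
  assume "uea_rel p p'" "uea_rel q q'"
  then have "(p - p') - (q - q') \<in> uea_ideal"
    unfolding uea_rel_def by (rule uea_ideal_diff)
  moreover have "(p - p') - (q - q') = (p - q) - (p' - q')"
    by simp
  ultimately show "uea_rel (p - q) (p' - q')"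
    by (simp only: uea_rel_def)
qed
lift_definition uminus_uea :: "'a uea \<Rightarrow> 'a uea" is uminus
proof -
  fix p p' :: "'a free_alg"
  assume "uea_rel p p'"
  then have "- (p - p') \<in> uea_ideal"
    unfolding uea_rel_def by (rule uea_ideal_uminus)
  then show "uea_rel (- p) (- p')"
    by (simp add: uea_rel_def)
qed
lift_definition times_uea :: "'a uea \<Rightarrow> 'a uea \<Rightarrow> 'a uea" is "(*)"
proof -
  fix p p' q q' :: "'a free_alg"
  assume "uea_rel p p'" "uea_rel q q'"
  then have "(p - p') * q + p' * (q - q') \<in> uea_ideal"
    unfolding uea_rel_def by (intro uea_ideal.add uea_ideal.mult_left uea_ideal.mult_right)
  then show "uea_rel (p * q) (p' * q')"
    by (simp add: uea_rel_def left_diff_distrib right_diff_distrib)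
qed
instance
  by standard (transfer, rule uea_rel_refl, simp add: algebra_simps)+
end


lift_definition uea_scalar :: "'a::field \<Rightarrow> 'a uea" is free_scalar .

lift_definition uea_inc :: "'a::field loop \<Rightarrow> 'a uea" is free_gen .

lemma uea_inc_add: "uea_inc (x + y) = uea_inc x + uea_inc y"
proof (transfer)
  fix x y :: "'a loop"
  show "uea_rel (free_gen (x + y)) (free_gen x + free_gen y)"
    unfolding uea_rel_def using uea_ideal.rel_add[of x y] by (simp add: diff_diff_eq)
qed

lemma uea_inc_zero: "uea_inc 0 = 0"
  using uea_inc_add[of 0 0] by simp

lemma uea_inc_bracket: "uea_inc (loop_bracket x y) = uea_inc x * uea_inc y - uea_inc y * uea_inc x"
proof (rule sym, transfer)
  fix x y :: "'a loop"
  show "uea_rel (free_gen x * free_gen y - free_gen y * free_gen x) (free_gen (loop_bracket x y))"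
    unfolding uea_rel_def by (rule uea_ideal.rel_bracket)
qed

lemma uea_scalar_commute: "uea_scalar c * u = u * uea_scalar c"
proof (transfer)
  fix c :: 'a and p :: "'a free_alg"
  have "free_scalar c * p = p * free_scalar c"
  proof (induction p rule: update_induct)
    case const
    show ?case by simp
  next
    case (update f k v)
    have "Poly_Mapping.update k v f = f + Poly_Mapping.single k v"
      using update.hyps
      by (intro poly_mapping_eqI)
        (auto simp: lookup_update lookup_add lookup_single when_def in_keys_iff)
    moreover have "free_scalar c * Poly_Mapping.single k v = Poly_Mapping.single k v * free_scalar c"
      by (simp add: free_scalar_def mult_single mult.commute)
    ultimately show ?case
      using update.IH by (simp add: algebra_simps)
  qed
  then show "uea_rel (free_scalar c * p) (p * free_scalar c)"
    by (simp add: uea_rel_def uea_ideal.zero)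
qed

lemma uea_induct [case_names scalar inc add mult]:
  fixes u :: "'a::field uea"
  assumes scalar: "\<And>c. P (uea_scalar c)"
    and inc: "\<And>x. P (uea_inc x)"
    and add: "\<And>u w. P u \<Longrightarrow> P w \<Longrightarrow> P (u + w)"
    and mult: "\<And>u w. P u \<Longrightarrow> P w \<Longrightarrow> P (u * w)"
  shows "P u"
proof -
  have word: "P (abs_uea (Poly_Mapping.single (Fword xs) c))" for xs :: "'a loop list" and c
  proof (induction xs)
    case Nil
    show ?case
      using scalar[of c] by (simp add: uea_scalar.abs_eq free_scalar_def zero_fword_def)
  next
    case (Cons x xs)
    have "Poly_Mapping.single (Fword (x # xs)) c = free_gen x * Poly_Mapping.single (Fword xs) c"
      by (simp add: free_gen_def mult_single)
    then have "abs_uea (Poly_Mapping.single (Fword (x # xs)) c)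
        = uea_inc x * abs_uea (Poly_Mapping.single (Fword xs) c)"
      by (simp add: times_uea.abs_eq uea_inc.abs_eq)
    then show ?case
      using mult[OF inc Cons] by simp
  qed
  have "P (abs_uea p)" for p
  proof (induction p rule: update_induct)
    case const
    show ?case
      using word[of "[]" 0] by simp
  next
    case (update f k v)
    have "Poly_Mapping.update k v f = f + Poly_Mapping.single k v"
      using update.hyps
      by (intro poly_mapping_eqI)
        (auto simp: lookup_update lookup_add lookup_single when_def in_keys_iff)
    then have "abs_uea (Poly_Mapping.update k v f) = abs_uea f + abs_uea (Poly_Mapping.single k v)"
      by (simp add: plus_uea.abs_eq)
    then show ?case
      using add[OF update.IH] word by (metis fword.exhaust)
  qed
  then show ?thesis
    by (rule uea.abs_induct[of P u])
qed


section \<open>Ore localization at the powers of \<open>f\<^sub>\<alpha>\<close>\<close>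

definition f_alpha :: "'a::field uea" where
  "f_alpha = uea_inc (loop_elt sl2_f 0)"

definition e_alpha :: "'a::field uea" where
  "e_alpha = uea_inc (loop_elt sl2_e 0)"

definition ad :: "'r::ring \<Rightarrow> 'r \<Rightarrow> 'r" where
  "ad a u = a * u - u * a"

lemma ad_funpow_add: "(ad a ^^ n) (u + w) = (ad a ^^ n) u + (ad a ^^ n) w"
  by (induction n) (simp_all add: ad_def algebra_simps)

lemma ad_funpow_zero: "(ad a ^^ n) 0 = 0"
  by (induction n) (simp_all add: ad_def)

lemma ad_funpow_mono: "(ad a ^^ n) u = 0 \<Longrightarrow> n \<le> m \<Longrightarrow> (ad a ^^ m) u = 0"
  using funpow_add[of "m - n" n "ad a"] by (simp add: ad_funpow_zero)

lemma ad_funpow_mult: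
  "(ad a ^^ n) u = 0 \<Longrightarrow> (ad a ^^ m) w = 0 \<Longrightarrow> (ad a ^^ (n + m)) (u * w) = 0"
proof (induction "n + m" arbitrary: n m u w)
  case 0
  then show ?case by simp
next
  case (Suc k)
  have leibniz: "ad a (u * w) = ad a u * w + u * ad a w"
    by (simp add: ad_def algebra_simps)
  have "(ad a ^^ k) (ad a u * w) = 0"
  proof (cases n)
    case 0
    then show ?thesis
      using Suc.prems by (simp add: ad_def ad_funpow_zero)
  next
    case (Suc n')
    then show ?thesis
      using Suc.prems Suc.hyps(1)[of n' m "ad a u" w] Suc.hyps(2) by (simp add: funpow_swap1)
  qed
  moreover have "(ad a ^^ k) (u * ad a w) = 0"
  proof (cases m)
    case 0
    then show ?thesis
      using Suc.prems by (simp add: ad_def ad_funpow_zero)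
  next
    case (Suc m')
    then show ?thesis
      using Suc.prems Suc.hyps(1)[of n m' u "ad a w"] Suc.hyps(2) by (simp add: funpow_swap1)
  qed
  ultimately have "(ad a ^^ k) (ad a (u * w)) = 0"
    by (simp only: leibniz ad_funpow_add) simp
  then show ?case
    by (simp only: Suc.hyps(2)[symmetric] funpow_Suc_right o_apply)
qed

lemma sl2_bracket_f_nilpotent:
  "sl2_bracket sl2_f (sl2_bracket sl2_f (sl2_bracket sl2_f x)) = (0 :: 'a::field sl2)"
  by transfer (simp add: sum_2 vec_eq_iff forall_2 matrix_matrix_mult_def)

lemma loop_bracket_f: 
  "Poly_Mapping.lookup (loop_bracket (loop_elt sl2_f 0) p) n
    = sl2_bracket (sl2_f :: 'a::field sl2) (Poly_Mapping.lookup p n)"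
proof -
  have zero: "sl2_bracket x 0 = 0" for x :: "'a sl2"
    by transfer (simp add: vec_eq_iff matrix_matrix_mult_def)
  have f: "(sl2_f :: 'a sl2) \<noteq> 0"
    by transfer (simp add: vec_eq_iff forall_2)
  have "Poly_Mapping.lookup (loop_bracket (loop_elt sl2_f 0) p) n
    = (\<Sum>m\<in>Poly_Mapping.keys p. if m = n then sl2_bracket sl2_f (Poly_Mapping.lookup p m) else 0)"
    using f by (simp add: loop_bracket_def lookup_sum lookup_single when_def)
  then show ?thesis
    by (simp add: zero in_keys_iff)
qed

lemma ad_f_alpha_nilpotent: "\<exists>n. (ad f_alpha ^^ n) (u :: 'a::field uea) = 0"
proof (induction u rule: uea_induct)
  case (scalar c)
  have "(ad f_alpha ^^ 1) (uea_scalar c) = 0"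
    using uea_scalar_commute[of c f_alpha] by (simp add: ad_def)
  then show ?case ..
next
  case (inc x)
  let ?b = "loop_bracket (loop_elt sl2_f 0)"
  have "ad f_alpha (uea_inc x) = uea_inc (?b x)" for x :: "'a loop"
    by (simp add: ad_def f_alpha_def uea_inc_bracket)
  moreover have "?b (?b (?b x)) = 0"
    by (intro poly_mapping_eqI) (simp add: loop_bracket_f sl2_bracket_f_nilpotent)
  ultimately have "(ad f_alpha ^^ 3) (uea_inc x) = 0"
    by (simp add: numeral_3_eq_3 uea_inc_zero)
  then show ?case ..
next
  case (add u w)
  then obtain n m where "(ad f_alpha ^^ n) u = 0" "(ad f_alpha ^^ m) w = 0"
    by blast
  then have "(ad f_alpha ^^ max n m) u = 0" "(ad f_alpha ^^ max n m) w = 0"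
    using ad_funpow_mono by (metis max.cobounded1, metis max.cobounded2)
  then have "(ad f_alpha ^^ max n m) (u + w) = 0"
    by (simp only: ad_funpow_add add_0)
  then show ?case ..
next
  case (mult u w)
  then obtain n m where "(ad f_alpha ^^ n) u = 0" "(ad f_alpha ^^ m) w = 0"
    by blast
  then have "(ad f_alpha ^^ (n + m)) (u * w) = 0"
    by (rule ad_funpow_mult)
  then show ?case ..
qed

lemma f_alpha_reversible:
  fixes u :: "'a::field uea"
  assumes "u * f_alpha ^ m = 0"
  shows "\<exists>n. f_alpha ^ n * u = 0"
  using assms
proof (induction m arbitrary: u)
  case 0
  then show ?case by simp
next
  case (Suc m)
  let ?w = "u * f_alpha ^ m"
  have w: "?w * f_alpha = 0"
    using Suc.prems by (simp only: power_Suc2 mult.assoc)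
  have "(ad f_alpha ^^ n) ?w = f_alpha ^ n * ?w" for n
  proof (induction n)
    case (Suc n)
    have "(f_alpha ^ n * ?w) * f_alpha = f_alpha ^ n * (?w * f_alpha)"
      by (rule mult.assoc)
    then have "(f_alpha ^ n * ?w) * f_alpha = 0"
      by (simp only: w mult_zero_right)
    then have "ad f_alpha (f_alpha ^ n * ?w) = f_alpha * (f_alpha ^ n * ?w)"
      by (simp only: ad_def diff_zero)
    then show ?case
      by (simp only: Suc.IH funpow.simps o_apply power_Suc mult.assoc)
  qed simp
  moreover obtain n where "(ad f_alpha ^^ n) ?w = 0"
    using ad_f_alpha_nilpotent by blast
  ultimately have "(f_alpha ^ n * u) * f_alpha ^ m = 0"
    by (simp only: mult.assoc)
  then obtain k where "f_alpha ^ k * (f_alpha ^ n * u) = 0"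
    using Suc.IH by blast
  then have "f_alpha ^ (k + n) * u = 0"
    by (simp only: power_add mult.assoc)
  then show ?case ..
qed

lemma f_alpha_ore: "\<exists>k w. f_alpha ^ k * u = w * (f_alpha :: 'a::field uea) ^ m"
proof (induction m arbitrary: u)
  case 0
  have "f_alpha ^ 0 * u = u * f_alpha ^ 0"
    by simp
  then show ?case by blast
next
  case (Suc m)
  have step: "\<exists>k w. f_alpha ^ k * u = w * f_alpha" if "(ad f_alpha ^^ n) u = 0" for n and u :: "'a uea"
    using that
  proof (induction n arbitrary: u)
    case 0
    then have "f_alpha ^ 0 * u = 0 * f_alpha"
      by simp
    then show ?case by blast
  next
    case (Suc n)
    then have "(ad f_alpha ^^ n) (ad f_alpha u) = 0"
      by (simp add: funpow_swap1)
    then obtain k w where kw: "f_alpha ^ k * ad f_alpha u = w * f_alpha"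
      using Suc.IH by blast
    have "f_alpha ^ Suc k * u = f_alpha ^ k * (ad f_alpha u + u * f_alpha)"
      by (simp only: ad_def power_Suc2 mult.assoc diff_add_cancel)
    also have "\<dots> = (w + f_alpha ^ k * u) * f_alpha"
      by (simp only: distrib_left distrib_right kw mult.assoc)
    finally show ?case by blast
  qed
  obtain k w where kw: "f_alpha ^ k * u = w * f_alpha ^ m"
    using Suc.IH by blast
  obtain n where "(ad f_alpha ^^ n) w = 0"
    using ad_f_alpha_nilpotent by blast
  then obtain l w' where lw: "f_alpha ^ l * w = w' * f_alpha"
    using step by blast
  have "f_alpha ^ (l + k) * u = f_alpha ^ l * (w * f_alpha ^ m)"
    by (simp only: power_add mult.assoc kw)
  also have "\<dots> = (f_alpha ^ l * w) * f_alpha ^ m"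
    by (simp only: mult.assoc)
  also have "\<dots> = w' * f_alpha ^ Suc m"
    by (simp only: lw mult.assoc power_Suc)
  finally show ?case by blast
qed

text \<open>The pair \<open>(u, n)\<close> stands for the left fraction \<open>f\<^sub>\<alpha>\<^sup>-\<^sup>n u\<close>.\<close>

definition ore_rel :: "'a::field uea \<times> nat \<Rightarrow> 'a uea \<times> nat \<Rightarrow> bool" where
  "ore_rel = (\<lambda>(u, n) (w, m). \<exists>k l. f_alpha ^ k * u = f_alpha ^ l * w \<and> k + n = l + m)"

lemma ore_relI: "f_alpha ^ k * u = f_alpha ^ l * w \<Longrightarrow> k + n = l + m \<Longrightarrow> ore_rel (u, n) (w, m)"
  unfolding ore_rel_def by blast

lemma ore_relE:
  assumes "ore_rel (u, n) (w, m)"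
  obtains k l where "f_alpha ^ k * u = f_alpha ^ l * w" "k + n = l + m"
  using assms unfolding ore_rel_def by blast

lemma ore_rel_refl: "a = b \<Longrightarrow> ore_rel a b"
  by (cases a; cases b) (auto intro: ore_relI[of 0 _ 0])

lemma ore_rel_sym: "ore_rel a b \<Longrightarrow> ore_rel b a"
  unfolding ore_rel_def by (cases a; cases b) (auto, metis)

lemma ore_rel_trans:
  assumes "ore_rel a b" "ore_rel b c"
  shows "ore_rel a c"
proof -
  obtain u n w m v r where abc: "a = (u, n)" "b = (w, m)" "c = (v, r)"
    by (cases a; cases b; cases c)
  obtain k l where kl: "f_alpha ^ k * u = f_alpha ^ l * w" "k + n = l + m"
    using assms(1) unfolding abc by (rule ore_relE)
  obtain k' l' where kl': "f_alpha ^ k' * w = f_alpha ^ l' * v" "k' + m = l' + r"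
    using assms(2) unfolding abc by (rule ore_relE)
  have "f_alpha ^ (k' + k) * u = f_alpha ^ (k' + l) * w"
    by (simp only: power_add mult.assoc kl)
  also have "\<dots> = f_alpha ^ (l + k') * w"
    by (simp only: add.commute)
  also have "\<dots> = f_alpha ^ (l + l') * v"
    by (simp only: power_add mult.assoc kl')
  finally show ?thesis
    unfolding abc by (rule ore_relI) (use kl kl' in simp)
qed

quotient_type (overloaded) 'a uea_loc = "'a::field uea \<times> nat" / ore_rel
  by (intro equivpI reflpI sympI transpI)
    (auto intro: ore_rel_refl ore_rel_sym ore_rel_trans)

text \<open>Multiplication of fractions: if \<open>f\<^sub>\<alpha>\<^sup>k u = p f\<^sub>\<alpha>\<^sup>m\<close> then
  \<open>(f\<^sub>\<alpha>\<^sup>-\<^sup>n u) (f\<^sub>\<alpha>\<^sup>-\<^sup>m w) = f\<^sub>\<alpha>\<^sup>-\<^sup>(\<^sup>k\<^sup>+\<^sup>n\<^sup>) p w\<close>.\<close>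

definition ore_mult :: "'a::field uea \<times> nat \<Rightarrow> 'a uea \<times> nat \<Rightarrow> 'a uea \<times> nat" where
  "ore_mult = (\<lambda>(u, n) (w, m).
     let (k, p) = SOME (k, p). f_alpha ^ k * u = p * f_alpha ^ m in (p * w, k + n))"

lemma ore_mult_rel:
  assumes "f_alpha ^ k * u = p * f_alpha ^ m"
  shows "ore_rel (ore_mult (u, n) (w, m)) (p * w, k + n)"
proof -
  define lq where "lq = (SOME (k, p). f_alpha ^ k * u = p * f_alpha ^ m)"
  obtain l q where lq': "lq = (l, q)"
    by (cases lq)
  have "case lq of (k, p) \<Rightarrow> f_alpha ^ k * u = p * f_alpha ^ m"
    unfolding lq_def by (rule someI[of _ "(k, p)"]) (simp add: assms)
  then have q: "f_alpha ^ l * u = q * f_alpha ^ m"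
    by (simp add: lq')
  have "f_alpha ^ k * q * f_alpha ^ m = f_alpha ^ (k + l) * u"
    by (simp only: power_add mult.assoc q)
  moreover have "f_alpha ^ l * p * f_alpha ^ m = f_alpha ^ (l + k) * u"
    by (simp only: power_add mult.assoc assms)
  ultimately have "(f_alpha ^ k * q - f_alpha ^ l * p) * f_alpha ^ m = 0"
    by (simp add: left_diff_distrib add.commute)
  then obtain j where "f_alpha ^ j * (f_alpha ^ k * q - f_alpha ^ l * p) = 0"
    using f_alpha_reversible by blast
  then have "f_alpha ^ (j + k) * q = f_alpha ^ (j + l) * p"
    by (simp add: right_diff_distrib power_add mult.assoc)
  then have "f_alpha ^ (j + k) * (q * w) = f_alpha ^ (j + l) * (p * w)"
    by (simp only: mult.assoc[symmetric])
  then have "ore_rel (q * w, l + n) (p * w, k + n)"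
    by (rule ore_relI) simp
  moreover have "ore_mult (u, n) (w, m) = (q * w, l + n)"
    by (simp add: ore_mult_def lq' flip: lq_def)
  ultimately show ?thesis
    by simp
qed

lemma ore_mult_cong_left:
  assumes "ore_rel (u, n) (u', n')"
  shows "ore_rel (ore_mult (u, n) (w, m)) (ore_mult (u', n') (w, m))"
proof -
  obtain a b where ab: "f_alpha ^ a * u = f_alpha ^ b * u'" "a + n = b + n'"
    using assms by (rule ore_relE)
  obtain k p where kp: "f_alpha ^ k * (f_alpha ^ a * u) = p * f_alpha ^ m"
    using f_alpha_ore by blast
  have "f_alpha ^ (k + a) * u = p * f_alpha ^ m"
    using kp by (simp only: power_add mult.assoc)
  then have "ore_rel (ore_mult (u, n) (w, m)) (p * w, (k + a) + n)"
    by (rule ore_mult_rel)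
  moreover have "f_alpha ^ (k + b) * u' = p * f_alpha ^ m"
    using kp by (simp only: power_add mult.assoc ab)
  then have "ore_rel (ore_mult (u', n') (w, m)) (p * w, (k + b) + n')"
    by (rule ore_mult_rel)
  moreover have "(k + a) + n = (k + b) + n'"
    using ab(2) by simp
  ultimately show ?thesis
    by (metis ore_rel_sym ore_rel_trans)
qed

lemma ore_mult_cong_right:
  assumes "ore_rel (w, m) (w', m')"
  shows "ore_rel (ore_mult (u, n) (w, m)) (ore_mult (u, n) (w', m'))"
proof -
  obtain a b where ab: "f_alpha ^ a * w = f_alpha ^ b * w'" "a + m = b + m'"
    using assms by (rule ore_relE)
  obtain k p where kp: "f_alpha ^ k * u = p * f_alpha ^ (a + m)"
    using f_alpha_ore by blast
  have "f_alpha ^ k * u = (p * f_alpha ^ a) * f_alpha ^ m"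
    using kp by (simp only: power_add mult.assoc)
  then have "ore_rel (ore_mult (u, n) (w, m)) ((p * f_alpha ^ a) * w, k + n)"
    by (rule ore_mult_rel)
  moreover have "f_alpha ^ k * u = (p * f_alpha ^ b) * f_alpha ^ m'"
    using kp by (simp only: ab(2) power_add mult.assoc)
  then have "ore_rel (ore_mult (u, n) (w', m')) ((p * f_alpha ^ b) * w', k + n)"
    by (rule ore_mult_rel)
  moreover have "(p * f_alpha ^ a) * w = (p * f_alpha ^ b) * w'"
    by (simp only: mult.assoc ab(1))
  ultimately show ?thesis
    by (metis ore_rel_sym ore_rel_trans)
qed

lemma ore_add_cong:
  assumes "ore_rel (u, n) (u', n')"
  shows "ore_rel (f_alpha ^ m * u + f_alpha ^ n * w, n + m) (f_alpha ^ m * u' + f_alpha ^ n' * w, n' + m)"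
proof -
  obtain a b where ab: "f_alpha ^ a * u = f_alpha ^ b * u'" "a + n = b + n'"
    using assms by (rule ore_relE)
  have "f_alpha ^ a * (f_alpha ^ m * u + f_alpha ^ n * w)
      = f_alpha ^ (a + m) * u + f_alpha ^ (a + n) * w"
    by (simp only: distrib_left power_add mult.assoc)
  also have "\<dots> = f_alpha ^ m * (f_alpha ^ a * u) + f_alpha ^ (a + n) * w"
    by (simp only: add.commute[of a m] power_add mult.assoc)
  also have "\<dots> = f_alpha ^ m * (f_alpha ^ b * u') + f_alpha ^ (b + n') * w"
    by (simp only: ab)
  also have "\<dots> = f_alpha ^ (b + m) * u' + f_alpha ^ (b + n') * w"
    by (simp only: add.commute[of b m] power_add mult.assoc)
  also have "\<dots> = f_alpha ^ b * (f_alpha ^ m * u' + f_alpha ^ n' * w)"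
    by (simp only: distrib_left power_add mult.assoc)
  finally show ?thesis
    by (rule ore_relI) (use ab(2) in simp)
qed

instantiation uea_loc :: (field) "{ring, monoid_mult}"
begin
lift_definition zero_uea_loc :: "'a uea_loc" is "(0, 0)" .
lift_definition one_uea_loc :: "'a uea_loc" is "(1, 0)" .
lift_definition plus_uea_loc :: "'a uea_loc \<Rightarrow> 'a uea_loc \<Rightarrow> 'a uea_loc" is
  "\<lambda>(u, n) (w, m). (f_alpha ^ m * u + f_alpha ^ n * w, n + m)"
proof -
  fix a a' b b' :: "'a uea \<times> nat"
  assume ab: "ore_rel a a'" "ore_rel b b'"
  obtain u n u' n' w m w' m' where eqs: "a = (u, n)" "a' = (u', n')" "b = (w, m)" "b' = (w', m')"
    by (cases a; cases a'; cases b; cases b')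
  have "ore_rel (f_alpha ^ m * u + f_alpha ^ n * w, n + m)
      (f_alpha ^ m * u' + f_alpha ^ n' * w, n' + m)"
    using ore_add_cong ab(1) unfolding eqs .
  moreover {
    have "ore_rel (f_alpha ^ n' * w + f_alpha ^ m * u', m + n')
      (f_alpha ^ n' * w' + f_alpha ^ m' * u', m' + n')"
      using ore_add_cong ab(2) unfolding eqs .
  then have "ore_rel (f_alpha ^ m * u' + f_alpha ^ n' * w, n' + m)
      (f_alpha ^ m' * u' + f_alpha ^ n' * w', n' + m')"
      by (simp only: add.commute)
  }
  ultimately show "ore_rel ((\<lambda>(u, n) (w, m). (f_alpha ^ m * u + f_alpha ^ n * w, n + m)) a b)
      ((\<lambda>(u, n) (w, m). (f_alpha ^ m * u + f_alpha ^ n * w, n + m)) a' b')"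
    unfolding eqs prod.case by (rule ore_rel_trans)
qed
lift_definition uminus_uea_loc :: "'a uea_loc \<Rightarrow> 'a uea_loc" is "\<lambda>(u, n). (- u, n)"
proof -
  fix a a' :: "'a uea \<times> nat"
  assume a: "ore_rel a a'"
  obtain u n u' n' where eqs: "a = (u, n)" "a' = (u', n')"
    by (cases a; cases a')
  obtain k l where kl: "f_alpha ^ k * u = f_alpha ^ l * u'" "k + n = l + n'"
    using a unfolding eqs by (rule ore_relE)
  have "f_alpha ^ k * (- u) = f_alpha ^ l * (- u')"
    by (simp only: mult_minus_right kl)
  then show "ore_rel ((\<lambda>(u, n). (- u, n)) a) ((\<lambda>(u, n). (- u, n)) a')"
    unfolding eqs prod.case by (rule ore_relI) (rule kl)
qed
definition minus_uea_loc :: "'a uea_loc \<Rightarrow> 'a uea_loc \<Rightarrow> 'a uea_loc" where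
  "minus_uea_loc a b = a + - b"
lift_definition times_uea_loc :: "'a uea_loc \<Rightarrow> 'a uea_loc \<Rightarrow> 'a uea_loc" is ore_mult
proof -
  fix a a' b b' :: "'a uea \<times> nat"
  assume ab: "ore_rel a a'" "ore_rel b b'"
  obtain u n u' n' w m w' m' where eqs: "a = (u, n)" "a' = (u', n')" "b = (w, m)" "b' = (w', m')"
    by (cases a; cases a'; cases b; cases b')
  have "ore_rel (ore_mult (u, n) (w, m)) (ore_mult (u', n') (w, m))"
    using ab(1) unfolding eqs by (rule ore_mult_cong_left)
  moreover have "ore_rel (ore_mult (u', n') (w, m)) (ore_mult (u', n') (w', m'))"
    using ab(2) unfolding eqs by (rule ore_mult_cong_right)
  ultimately show "ore_rel (ore_mult a b) (ore_mult a' b')"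
    unfolding eqs by (rule ore_rel_trans)
qed

definition ore_frac :: "'a uea \<Rightarrow> nat \<Rightarrow> 'a uea_loc" where
  "ore_frac u n = abs_uea_loc (u, n)"

lemma ore_frac_cases: "\<exists>u n. a = ore_frac u n"
proof -
  have "\<exists>u n. abs_uea_loc x = ore_frac u n" for x :: "'a uea \<times> nat"
  proof -
    obtain u n where "x = (u, n)"
      by (rule prod.exhaust)
    then have "abs_uea_loc x = ore_frac u n"
      by (simp only: ore_frac_def)
    then show ?thesis
      by blast
  qed
  then show ?thesis
    by (rule uea_loc.abs_induct)
qed

lemma ore_frac_eq_iff:
  "ore_frac u n = ore_frac w m \<longleftrightarrow> (\<exists>k l. f_alpha ^ k * u = f_alpha ^ l * w \<and> k + n = l + m)"
  by (simp add: ore_frac_def uea_loc.abs_eq_iff ore_rel_def)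

lemma ore_frac_eqI: "f_alpha ^ k * u = f_alpha ^ l * w \<Longrightarrow> k + n = l + m \<Longrightarrow> ore_frac u n = ore_frac w m"
  unfolding ore_frac_def uea_loc.abs_eq_iff by (rule ore_relI)

lemma ore_frac_expand: "ore_frac u n = ore_frac (f_alpha ^ k * u) (k + n)"
  by (rule ore_frac_eqI[of k _ 0]) (simp_all only: power_0 mult_1_left add_0)

lemma ore_frac_add_same: "ore_frac u n + ore_frac w n = ore_frac (u + w) n"
proof -
  have "ore_frac u n + ore_frac w n = ore_frac (f_alpha ^ n * u + f_alpha ^ n * w) (n + n)"
    unfolding ore_frac_def plus_uea_loc.abs_eq prod.case by (rule refl)
  also have "\<dots> = ore_frac (f_alpha ^ n * (u + w)) (n + n)"
    by (simp only: distrib_left)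
  also have "\<dots> = ore_frac (u + w) n"
    by (rule ore_frac_expand[symmetric])
  finally show ?thesis .
qed

lemma ore_frac_mult:
  "f_alpha ^ k * u = p * f_alpha ^ m \<Longrightarrow> ore_frac u n * ore_frac w m = ore_frac (p * w) (k + n)"
  unfolding ore_frac_def times_uea_loc.abs_eq uea_loc.abs_eq_iff by (rule ore_mult_rel)

lemma ore_frac_mult_aligned: "ore_frac (p * f_alpha ^ m) n * ore_frac w m = ore_frac (p * w) n"
  using ore_frac_mult[of 0 "p * f_alpha ^ m" p m n w] by simp

lemma ore_frac_common: "\<exists>u w n. a = ore_frac u n \<and> b = ore_frac w n"
proof -
  obtain u n w m where ab: "a = ore_frac u n" "b = ore_frac w m"
    using ore_frac_cases by metis
  have "a = ore_frac (f_alpha ^ m * u) (n + m)" "b = ore_frac (f_alpha ^ n * w) (n + m)"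
    using ab ore_frac_expand[of u n m] ore_frac_expand[of w m n] by (simp_all add: add.commute)
  then show ?thesis
    by blast
qed

lemma ore_frac_align: "\<exists>p n. a = ore_frac (p * f_alpha ^ m) n"
proof -
  obtain u n where a: "a = ore_frac u n"
    using ore_frac_cases by blast
  obtain k p where "f_alpha ^ k * u = p * f_alpha ^ m"
    using f_alpha_ore by blast
  then have "a = ore_frac (p * f_alpha ^ m) (k + n)"
    using a ore_frac_expand[of u n k] by simp
  then show ?thesis
    by blast
qed

lemma ore_frac_one: "1 = ore_frac 1 0"
  by (simp add: ore_frac_def one_uea_loc.abs_eq)

lemma ore_frac_zero: "0 = ore_frac 0 n"
proof -
  have "0 = ore_frac 0 0"
    by (simp add: ore_frac_def zero_uea_loc.abs_eq)
  then show ?thesis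
    using ore_frac_expand[of 0 0 n] by simp
qed

instance
proof
  fix a b c :: "'a uea_loc"
  show "a + b + c = a + (b + c)"
  proof -
    obtain u n where a: "a = ore_frac u n"
      using ore_frac_cases by blast
    obtain w v m where bc: "b = ore_frac w m" "c = ore_frac v m"
      using ore_frac_common by blast
    have "a = ore_frac (f_alpha ^ m * u) (m + n)"
      "b = ore_frac (f_alpha ^ n * w) (m + n)"
      "c = ore_frac (f_alpha ^ n * v) (m + n)"
      using a bc ore_frac_expand[of u n m] ore_frac_expand[of w m n] ore_frac_expand[of v m n]
      by (simp_all only: add.commute[of m n])
    then show ?thesis
      by (simp only: ore_frac_add_same add.assoc)
  qed
  show "a + b = b + a"
  proof -
    obtain u w n where "a = ore_frac u n" "b = ore_frac w n"
      using ore_frac_common by blast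
    then show ?thesis
      by (simp only: ore_frac_add_same add.commute)
  qed
  obtain u n where u: "a = ore_frac u n"
    using ore_frac_cases by blast
  show "0 + a = a"
    by (simp add: u ore_frac_zero[of n] ore_frac_add_same)
  show "- a + a = 0"
  proof -
    have "- ore_frac u n = ore_frac (- u) n"
      unfolding ore_frac_def uminus_uea_loc.abs_eq prod.case by (rule refl)
    then show ?thesis
      by (simp add: u ore_frac_add_same flip: ore_frac_zero[of n])
  qed
  show "a - b = a + - b"
    by (simp add: minus_uea_loc_def)
  show "1 * a = a"
    using ore_frac_mult[of n 1 1 n 0 u] by (simp add: u ore_frac_one)
  show "a * 1 = a"
    using ore_frac_mult_aligned[of u 0 n 1] by (simp add: u ore_frac_one)
  show "a * b * c = a * (b * c)"
  proof -
    obtain v r where c: "c = ore_frac v r"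
      using ore_frac_cases by blast
    obtain q m where b: "b = ore_frac (q * f_alpha ^ r) m"
      using ore_frac_align by blast
    obtain p n where a: "a = ore_frac (p * f_alpha ^ m) n"
      using ore_frac_align by blast
    have "a * b * c = ore_frac ((p * q) * f_alpha ^ r) n * c"
      unfolding a b by (simp only: ore_frac_mult_aligned mult.assoc)
    also have "\<dots> = ore_frac (p * (q * v)) n"
      unfolding c by (simp only: ore_frac_mult_aligned) (simp only: mult.assoc)
    also have "\<dots> = a * (b * c)"
      unfolding a b c by (simp only: ore_frac_mult_aligned)
    finally show ?thesis .
  qed
  show "(a + b) * c = a * c + b * c"
  proof -
    obtain v r where c: "c = ore_frac v r"
      using ore_frac_cases by blast
    obtain p n where a: "a = ore_frac (p * f_alpha ^ r) n"
      using ore_frac_align by blast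
    obtain q m where b: "b = ore_frac (q * f_alpha ^ r) m"
      using ore_frac_align by blast
    have a': "a = ore_frac ((f_alpha ^ m * p) * f_alpha ^ r) (m + n)"
      unfolding a by (simp only: mult.assoc) (rule ore_frac_expand)
    have b': "b = ore_frac ((f_alpha ^ n * q) * f_alpha ^ r) (m + n)"
      unfolding b by (simp only: mult.assoc add.commute[of m n]) (rule ore_frac_expand)
    show ?thesis
      unfolding a' b' c
      by (simp only: ore_frac_add_same ore_frac_mult_aligned flip: distrib_right)
  qed
  show "a * (b + c) = a * b + a * c"
  proof -
    obtain w v m where bc: "b = ore_frac w m" "c = ore_frac v m"
      using ore_frac_common by blast
    obtain p n where a: "a = ore_frac (p * f_alpha ^ m) n"
      using ore_frac_align by blast
    show ?thesis
      unfolding a bc by (simp only: ore_frac_add_same ore_frac_mult_aligned distrib_left)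
  qed
qed

end

definition loc :: "'a::field uea \<Rightarrow> 'a uea_loc" where
  "loc u = ore_frac u 0"

definition f_alpha_inv :: "'a::field uea_loc" where
  "f_alpha_inv = ore_frac 1 1"

lemma loc_hom: "loc 1 = 1" "loc (u + w) = loc u + loc w" "loc (u * w) = loc u * loc w"
  using ore_frac_mult_aligned[of u 0 0 w]
  by (simp_all add: loc_def ore_frac_one ore_frac_add_same)

lemma f_alpha_inv: "loc f_alpha * f_alpha_inv = (1 :: 'a::field uea_loc)"
  "f_alpha_inv * loc f_alpha = (1 :: 'a::field uea_loc)"
proof -
  have "loc f_alpha * f_alpha_inv = ore_frac (1 * 1 :: 'a uea) 0"
    unfolding loc_def f_alpha_inv_def using ore_frac_mult_aligned[of "1 :: 'a uea" 1 0 1] by simp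
  then show "loc f_alpha * f_alpha_inv = (1 :: 'a uea_loc)"
    by (simp add: ore_frac_one)
  have "f_alpha_inv * loc f_alpha = ore_frac (f_alpha :: 'a uea) 1"
    unfolding loc_def f_alpha_inv_def using ore_frac_mult_aligned[of "1 :: 'a uea" 0 1 f_alpha] by simp
  also have "\<dots> = ore_frac 1 0"
    using ore_frac_expand[of "1 :: 'a uea" 0 1] by simp
  finally show "f_alpha_inv * loc f_alpha = (1 :: 'a uea_loc)"
    by (simp add: ore_frac_one)
qed

lemma ore_frac_eq: "ore_frac u n = f_alpha_inv ^ n * loc u"
proof (induction n)
  case 0
  show ?case by (simp add: loc_def)
next
  case (Suc n)
  have "ore_frac (1 * 1) 1 * ore_frac u n = ore_frac (1 * u) (n + 1)"
    by (rule ore_frac_mult) simp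
  then show ?case
    by (simp add: Suc.IH f_alpha_inv_def mult.assoc)
qed

lemma uea_loc_fraction: "\<exists>u n. a = f_alpha_inv ^ n * loc u"
  using ore_frac_cases[of a] by (simp add: ore_frac_eq)

lemma loc_eq_0_iff: "loc u = 0 \<longleftrightarrow> (\<exists>n. f_alpha ^ n * u = 0)"
  by (simp add: loc_def ore_frac_zero[of 0] ore_frac_eq_iff)


section \<open>Tensor products and twisted localization\<close>

text \<open>Left modules are stored in the record \<^typ>\<open>('r, 'm) module\<close> of the library; its fields for
  a multiplication on \<^typ>\<open>'m\<close> are not used. Let \<open>R\<close> be a subset of a ring acting on the right of
  the ring \<^typ>\<open>'u\<close> through \<open>ra\<close> and on the left of \<open>M\<close>. The balanced tensor product of
  \<^typ>\<open>'u\<close> and \<open>M\<close> over \<open>R\<close> is the free abelian group on the pairs modulo biadditivity and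
  \<open>a r \<otimes> m = a \<otimes> r m\<close>; \<^typ>\<open>'u\<close> acts on it from the left.\<close>

definition tensor_free :: "('r, 'm) module \<Rightarrow> ('u \<times> 'm \<Rightarrow>\<^sub>0 int) monoid" where
  "tensor_free M = free_Abelian_group (UNIV \<times> carrier M)"

definition tensor_relators ::
  "'r set \<Rightarrow> ('u \<Rightarrow> 'r \<Rightarrow> 'u) \<Rightarrow> ('r, 'm) module \<Rightarrow> ('u::ring \<times> 'm \<Rightarrow>\<^sub>0 int) set" where
  "tensor_relators R ra M =
     {frag_of (a + b, m) - frag_of (a, m) - frag_of (b, m) | a b m. m \<in> carrier M}
   \<union> {frag_of (a, m \<oplus>\<^bsub>M\<^esub> m') - frag_of (a, m) - frag_of (a, m') | a m m'.
        m \<in> carrier M \<and> m' \<in> carrier M}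
   \<union> {frag_of (ra a r, m) - frag_of (a, r \<odot>\<^bsub>M\<^esub> m) | a r m. r \<in> R \<and> m \<in> carrier M}"

definition tensor_kernel ::
  "'r set \<Rightarrow> ('u \<Rightarrow> 'r \<Rightarrow> 'u) \<Rightarrow> ('r, 'm) module \<Rightarrow> ('u::ring \<times> 'm \<Rightarrow>\<^sub>0 int) set" where
  "tensor_kernel R ra M = generate (tensor_free M) (tensor_relators R ra M)"

definition tensor_lmult :: "'u::ring \<Rightarrow> ('u \<times> 'm \<Rightarrow>\<^sub>0 int) \<Rightarrow> ('u \<times> 'm \<Rightarrow>\<^sub>0 int)" where
  "tensor_lmult u = frag_extend (\<lambda>(a, m). frag_of (u * a, m))"

definition tensor ::
  "'r set \<Rightarrow> ('u \<Rightarrow> 'r \<Rightarrow> 'u) \<Rightarrow> ('r, 'm) module \<Rightarrow> ('u::ring, ('u \<times> 'm \<Rightarrow>\<^sub>0 int) set) module" where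
  "tensor R ra M = (let Q = tensor_free M Mod tensor_kernel R ra M in
     \<lparr>carrier = carrier Q, mult = undefined, one = undefined, zero = \<one>\<^bsub>Q\<^esub>, add = (\<otimes>\<^bsub>Q\<^esub>),
      smult = (\<lambda>u C. \<Union>g\<in>C. tensor_kernel R ra M #>\<^bsub>tensor_free M\<^esub> tensor_lmult u g)\<rparr>)"

definition pure_tensor ::
  "'r set \<Rightarrow> ('u \<Rightarrow> 'r \<Rightarrow> 'u) \<Rightarrow> ('r, 'm) module \<Rightarrow> 'u \<Rightarrow> 'm \<Rightarrow> ('u::ring \<times> 'm \<Rightarrow>\<^sub>0 int) set" where
  "pure_tensor R ra M a m = tensor_kernel R ra M #>\<^bsub>tensor_free M\<^esub> frag_of (a, m)"

inductive_set uea_subalgebra :: "'a::field uea set \<Rightarrow> 'a uea set" for X where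
  gen: "u \<in> X \<Longrightarrow> u \<in> uea_subalgebra X"
| scalar: "uea_scalar c \<in> uea_subalgebra X"
| add: "u \<in> uea_subalgebra X \<Longrightarrow> w \<in> uea_subalgebra X \<Longrightarrow> u + w \<in> uea_subalgebra X"
| mult: "u \<in> uea_subalgebra X \<Longrightarrow> w \<in> uea_subalgebra X \<Longrightarrow> u * w \<in> uea_subalgebra X"

definition uea_HN :: "'a::field uea set" where
  "uea_HN = uea_subalgebra (uea_inc ` (loop_H \<union> loop_N_plus))"

text \<open>\<open>hw_char \<lambda> u c\<close> is the graph of the action \<open>u \<cdot> v = c v\<close> of \<open>U(\<H> \<oplus> \<N>\<^sup>+)\<close> on the
  one-dimensional module \<open>F v\<close>. It is a function on \<^const>\<open>uea_HN\<close>: the prescribed values are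
  a character of \<open>\<H> \<oplus> \<N>\<^sup>+\<close>, because the derived algebra lies in \<open>\<N>\<^sup>+\<close>, and \<open>U(\<H> \<oplus> \<N>\<^sup>+)\<close>
  embeds into \<^typ>\<open>'a::field uea\<close> by the theorem of Poincare, Birkhoff and Witt.\<close>

inductive hw_char :: "'a::field \<Rightarrow> 'a uea \<Rightarrow> 'a \<Rightarrow> bool" for lam where
  N_plus: "x \<in> loop_N_plus \<Longrightarrow> hw_char lam (uea_inc x) 0"
| H: "n \<noteq> 0 \<Longrightarrow> hw_char lam (uea_inc (loop_elt sl2_h n)) 0"
| H_zero: "hw_char lam (uea_inc (loop_elt sl2_h 0)) lam"
| scalar: "hw_char lam (uea_scalar c) c"
| add: "hw_char lam u c \<Longrightarrow> hw_char lam w d \<Longrightarrow> hw_char lam (u + w) (c + d)"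
| mult: "hw_char lam u c \<Longrightarrow> hw_char lam w d \<Longrightarrow> hw_char lam (u * w) (c * d)"

definition hw_line :: "'a::field \<Rightarrow> ('a uea, 'a) module" where
  "hw_line lam = \<lparr>carrier = UNIV, mult = undefined, one = undefined, zero = 0, add = (+),
     smult = (\<lambda>u b. (THE c. hw_char lam u c) * b)\<rparr>"

type_synonym 'a verma_carrier = "('a uea \<times> 'a \<Rightarrow>\<^sub>0 int) set"

definition imaginary_verma :: "'a::field \<Rightarrow> ('a uea, 'a verma_carrier) module" where
  "imaginary_verma lam = tensor uea_HN (*) (hw_line lam)"

definition verma_vec :: "'a::field \<Rightarrow> 'a verma_carrier" where
  "verma_vec lam = pure_tensor uea_HN (*) (hw_line lam) 1 1"

definition loc_module ::
  "('a::field uea, 'm) module \<Rightarrow> ('a uea_loc, ('a uea_loc \<times> 'm \<Rightarrow>\<^sub>0 int) set) module" where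
  "loc_module M = tensor UNIV (\<lambda>a u. a * loc u) M"

definition loc_vec ::
  "('a::field uea, 'm) module \<Rightarrow> 'a uea_loc \<Rightarrow> 'm \<Rightarrow> ('a uea_loc \<times> 'm \<Rightarrow>\<^sub>0 int) set" where
  "loc_vec M a m = pure_tensor UNIV (\<lambda>a u. a * loc u) M a m"

definition Theta :: "'a::field_char_0 \<Rightarrow> 'a uea_loc \<Rightarrow> 'a uea_loc" where
  "Theta z u = Sum_any (\<lambda>i. loc (uea_scalar (z gchoose i)) * (ad (loc f_alpha) ^^ i) u * f_alpha_inv ^ i)"

lemma Theta_finite: "finite {i. loc (uea_scalar (z gchoose i)) * (ad (loc f_alpha) ^^ i) u * f_alpha_inv ^ i \<noteq> 0}"
  for z :: "'a::field_char_0"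
proof -
  obtain w n where u: "u = f_alpha_inv ^ n * loc w"
    using uea_loc_fraction by blast
  have comm: "loc f_alpha * f_alpha_inv ^ n = f_alpha_inv ^ n * (loc f_alpha :: 'a uea_loc)" for n
    by (rule power_commuting_commutes[symmetric]) (simp add: f_alpha_inv)
  have minus: "loc (p - q) = loc p - loc q" for p q :: "'a uea"
    using loc_hom(2)[of "p - q" q] by simp
  have "(ad (loc f_alpha) ^^ i) u = f_alpha_inv ^ n * loc ((ad f_alpha ^^ i) w)" for i
  proof (induction i)
    case 0
    show ?case by (simp add: u)
  next
    case (Suc i)
    have "ad (loc f_alpha) (f_alpha_inv ^ n * a) = f_alpha_inv ^ n * ad (loc f_alpha) (a :: 'a uea_loc)" for a
      by (simp only: ad_def right_diff_distrib mult.assoc[symmetric] comm)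
    then show ?case
      by (simp add: Suc.IH) (simp add: ad_def minus loc_hom)
  qed
  moreover obtain m where "(ad f_alpha ^^ m) w = 0"
    using ad_f_alpha_nilpotent by blast
  moreover have "loc 0 = (0 :: 'a uea_loc)"
    using minus[of 0 0] by simp
  ultimately have "(ad (loc f_alpha) ^^ i) u = 0" if "i \<ge> m" for i
    using ad_funpow_mono[OF _ that, of f_alpha w] by simp
  then have "loc (uea_scalar (z gchoose i)) * (ad (loc f_alpha) ^^ i) u * f_alpha_inv ^ i = 0" if "i \<ge> m" for i
    using that by simp
  then show ?thesis
    by (intro finite_subset[OF _ finite_lessThan[of m]]) (metis (mono_tags, lifting) lessThan_iff mem_Collect_eq not_less subsetI)
qed

text \<open>The copy \<open>w\<^sup>z\<close> of \<open>w\<close> is \<open>w\<close> itself, regarded as an element of \<open>\<Phi>\<^sup>z R\<close>.\<close>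

definition Phi :: "'a::field_char_0 \<Rightarrow> ('a uea_loc, 'm) module \<Rightarrow> ('a uea_loc, 'm) module" where
  "Phi z R = R\<lparr>smult := (\<lambda>u w. Theta z u \<odot>\<^bsub>R\<^esub> w)\<rparr>"

type_synonym 'a twisted_carrier = "('a uea_loc \<times> 'a verma_carrier \<Rightarrow>\<^sub>0 int) set"

definition twisted_loc ::
  "'a::field_char_0 \<Rightarrow> 'a \<Rightarrow> ('a uea_loc, 'a twisted_carrier) module" where
  "twisted_loc x lam = Phi (- x) (loc_module (imaginary_verma lam))"

definition f_alpha_powi :: "int \<Rightarrow> 'a::field uea_loc" where
  "f_alpha_powi l = (if l \<ge> 0 then loc f_alpha ^ nat l else f_alpha_inv ^ nat (- l))"

text \<open>\<open>f\<^sub>\<alpha>\<^sup>x\<^sup>+\<^sup>l \<cdot> v = f\<^sub>\<alpha>\<^sup>x \<cdot> (f\<^sub>\<alpha>\<^sup>l v)\<close> in \<^term>\<open>twisted_loc x lam\<close> for integers \<open>l\<close>; the underlying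
  element \<open>f\<^sub>\<alpha>\<^sup>l v\<close> of the untwisted localization does not depend on \<open>x\<close>.\<close>

definition twisted_vec :: "'a::field_char_0 \<Rightarrow> int \<Rightarrow> 'a twisted_carrier" where
  "twisted_vec lam l = f_alpha_powi l \<odot>\<^bsub>loc_module (imaginary_verma lam)\<^esub>
     loc_vec (imaginary_verma lam) 1 (verma_vec lam)"


section \<open>Modules over the loop algebra\<close>

locale loop_module = abelian_group V for V (structure) +
  fixes scl :: "'a::field \<Rightarrow> 'm \<Rightarrow> 'm" and act :: "'a loop \<Rightarrow> 'm \<Rightarrow> 'm"
  assumes scl_closed: "w \<in> carrier V \<Longrightarrow> scl c w \<in> carrier V"
    and scl_one: "w \<in> carrier V \<Longrightarrow> scl 1 w = w"
    and scl_mult: "w \<in> carrier V \<Longrightarrow> scl (c * d) w = scl c (scl d w)"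
    and scl_add_left: "w \<in> carrier V \<Longrightarrow> scl (c + d) w = scl c w \<oplus> scl d w"
    and scl_add_right:
      "w \<in> carrier V \<Longrightarrow> w' \<in> carrier V \<Longrightarrow> scl c (w \<oplus> w') = scl c w \<oplus> scl c w'"
    and act_closed: "w \<in> carrier V \<Longrightarrow> act x w \<in> carrier V"
    and act_add_left: "w \<in> carrier V \<Longrightarrow> act (x + y) w = act x w \<oplus> act y w"
    and act_scale_left: "w \<in> carrier V \<Longrightarrow> act (loop_scale c x) w = scl c (act x w)"
    and act_add_right:
      "w \<in> carrier V \<Longrightarrow> w' \<in> carrier V \<Longrightarrow> act x (w \<oplus> w') = act x w \<oplus> act x w'"
    and act_scale_right: "w \<in> carrier V \<Longrightarrow> act x (scl c w) = scl c (act x w)"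
    and act_bracket:
      "w \<in> carrier V \<Longrightarrow> act (loop_bracket x y) w = act x (act y w) \<ominus> act y (act x w)"

definition loop_submodule ::
  "('m, 'b) ring_scheme \<Rightarrow> ('a::field \<Rightarrow> 'm \<Rightarrow> 'm) \<Rightarrow> ('a loop \<Rightarrow> 'm \<Rightarrow> 'm) \<Rightarrow> 'm set \<Rightarrow> bool" where
  "loop_submodule V scl act N \<longleftrightarrow> subgroup N (add_monoid V) \<and>
     (\<forall>c. \<forall>w\<in>N. scl c w \<in> N) \<and> (\<forall>x. \<forall>w\<in>N. act x w \<in> N)"

definition simple_loop_module ::
  "('m, 'b) ring_scheme \<Rightarrow> ('a::field \<Rightarrow> 'm \<Rightarrow> 'm) \<Rightarrow> ('a loop \<Rightarrow> 'm \<Rightarrow> 'm) \<Rightarrow> bool" where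
  "simple_loop_module V scl act \<longleftrightarrow> loop_module V scl act \<and> carrier V \<noteq> {\<zero>\<^bsub>V\<^esub>} \<and>
     (\<forall>N. loop_submodule V scl act N \<longrightarrow> N = {\<zero>\<^bsub>V\<^esub>} \<or> N = carrier V)"

definition restrict_scl :: "('a::field uea_loc, 'm) module \<Rightarrow> 'a \<Rightarrow> 'm \<Rightarrow> 'm" where
  "restrict_scl V c w = loc (uea_scalar c) \<odot>\<^bsub>V\<^esub> w"

definition restrict_act :: "('a::field uea_loc, 'm) module \<Rightarrow> 'a loop \<Rightarrow> 'm \<Rightarrow> 'm" where
  "restrict_act V x w = loc (uea_inc x) \<odot>\<^bsub>V\<^esub> w"

end

theory Submission
  imports Defs "HOL-Computational_Algebra.Formal_Power_Series"
begin

text \<open>Let \<open>P\<close> be the polynomial ring in variables \<open>X\<^sub>n\<close>, one for each integer \<open>n\<close>. As the \<open>f \<otimes> t\<^sup>n\<close>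
  commute, \<open>M(\<lambda>)\<close> looks like \<open>P\<close>, with \<open>f \<otimes> t\<^sup>n\<close> acting as multiplication by \<open>X\<^sub>n\<close>; moving
  \<open>h \<otimes> t\<^sup>m\<close> and \<open>e \<otimes> t\<^sup>m\<close> past the \<open>X\<^sub>n\<close> shows that they have to act as differential operators of
  order one and two. These operators do represent the loop algebra on \<open>P\<close>
  (\<open>sl2_op_bracket\<close>, \<open>loop_op_bracket\<close>). This one fact replaces the theorem of Poincare, Birkhoff and
  Witt twice: it shows that the action of \<open>U(\<H> \<oplus> \<N>\<^sup>+)\<close> on the line \<open>F v\<close> is well defined
  (\<open>hw_char_unique\<close>), and it gives an equivariant map \<open>M(\<lambda>) \<rightarrow> P\<close> that detects \<open>v\<close>
  (\<open>verma_to_mpoly\<close>). In the other direction \<open>p \<mapsto> p(f) v\<close> is an equivariant surjection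
  \<open>P \<rightarrow> M(\<lambda>)\<close> (\<open>uea_poly_vec\<close>, \<open>poly_vec_surj\<close>).

  If \<open>\<lambda> \<noteq> 0\<close>, every nonconstant polynomial is mapped to a nonzero one of lower degree by some
  \<open>e \<otimes> t\<^sup>m\<close> (\<open>eop_kernel\<close>), so the operators \<open>e \<otimes> t\<^sup>m\<close> lead from every nonzero polynomial to a nonzero
  constant. Hence every nonzero \<open>m\<close> in \<open>M(\<lambda>)\<close> satisfies \<open>u m = v\<close> for some \<open>u\<close> in \<open>U\<close>
  (\<open>verma_simple\<close>, Futorny's theorem).

  The maps \<open>\<Theta>\<^sub>z\<close> are ring endomorphisms of \<open>U\<^sub>\<alpha>\<close> with \<open>\<Theta>\<^sub>z \<circ> \<Theta>\<^sub>w = \<Theta>\<^sub>z\<^sub>+\<^sub>w\<close>: they are the powers, with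
  exponents in the field, of the conjugation by \<open>f\<^sub>\<alpha>\<close>, a locally unipotent operator
  (\<open>conj_power_mult\<close>, \<open>conj_power_conj_power\<close>). Therefore the twisted localization is a
  \<open>U\<^sub>\<alpha>\<close>-module, and an element of it that is reached from \<open>w\<close> by \<open>U\<^sub>\<alpha>\<close> in the untwisted action is
  also reached by \<open>U\<^sub>\<alpha>\<close> in the twisted action.

  Now let \<open>N\<close> be a nonzero submodule over the loop algebra. Clearing denominators in some
  \<open>w \<noteq> 0\<close> of \<open>N\<close> and using the simplicity of \<open>M(\<lambda>)\<close>, there is \<open>b\<close> in \<open>U\<^sub>\<alpha>\<close> with
  \<open>b w = f\<^sub>\<alpha>\<^sup>x v\<close>. Write \<open>b = f\<^sub>\<alpha>\<^sup>-\<^sup>j u\<close> with \<open>u\<close> in \<open>U\<close>; then \<open>f\<^sub>\<alpha>\<^sup>x\<^sup>+\<^sup>j v = u w\<close> belongs to \<open>N\<close>. Because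
  the constants \<open>c\<^sub>k\<^sub>,\<^sub>y\<close> do not vanish, \<open>N\<close> contains \<open>f\<^sub>\<alpha>\<^sup>x\<^sup>+\<^sup>l v\<close> for all integers \<open>l \<le> j\<close>. Finally, every
  element of the twisted localization is \<open>a (f\<^sub>\<alpha>\<^sup>x v)\<close> with \<open>a\<close> in \<open>U\<^sub>\<alpha>\<close>; as a right fraction
  \<open>a = u f\<^sub>\<alpha>\<^sup>-\<^sup>n\<close>, so it is \<open>u (f\<^sub>\<alpha>\<^sup>x\<^sup>-\<^sup>n v)\<close> with \<open>x - n \<le> x + j\<close>, hence in \<open>N\<close>.\<close>

section \<open>Fractional powers of a locally unipotent conjugation\<close>

lemma sum_square_eq_sum_triangle:
  fixes g :: "nat \<Rightarrow> nat \<Rightarrow> 'b::comm_monoid_add"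
  assumes "\<And>i j. n \<le> i + j \<Longrightarrow> g i j = 0"
  shows "(\<Sum>i<n. \<Sum>j<n. g i j) = (\<Sum>k<n. \<Sum>i\<le>k. g i (k - i))"
proof -
  have "(\<Sum>i<n. \<Sum>j<n. g i j) = (\<Sum>(i, j)\<in>{..<n} \<times> {..<n}. g i j)"
    by (rule sum.cartesian_product)
  also have "\<dots> = (\<Sum>(i, j)\<in>{(i, j). i + j < n}. g i j)"
  proof (rule sum.mono_neutral_right)
    show "\<forall>p\<in>{..<n} \<times> {..<n} - {(i, j). i + j < n}. (case p of (i, j) \<Rightarrow> g i j) = 0"
      using assms not_less by auto
  qed auto
  also have "\<dots> = (\<Sum>k<n. \<Sum>i\<le>k. g i (k - i))"
    by (rule sum.triangle_reindex)
  finally show ?thesis .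
qed

text \<open>The situation of a localization at the powers of one element \<open>F\<close>, stated for an abstract ring:
  \<open>s\<close> maps the scalars into the centre, and \<open>ad F\<close> is locally nilpotent. Then the conjugation
  \<open>a \<mapsto> F a F\<^sup>-\<^sup>1\<close> is locally unipotent, since its difference to the identity is
  \<open>a \<mapsto> ad F (a) F\<^sup>-\<^sup>1\<close>; so its powers with arbitrary exponents are defined by the binomial series.\<close>

locale unipotent_conjugation =
  fixes F finv :: "'r::{ring, monoid_mult}"
    and s :: "'a::field_char_0 \<Rightarrow> 'r"
  assumes F_finv: "F * finv = 1" and finv_F: "finv * F = 1"
    and s_add: "s (c + d) = s c + s d"
    and s_mult: "s (c * d) = s c * s d"
    and s_one: "s 1 = 1"
    and s_central: "s c * a = a * s c"
    and ad_nilpotent: "\<exists>n. (ad F ^^ n) a = 0"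
begin

lemma s_zero: "s 0 = 0"
  using s_add[of 0 0] by simp

lemma finv_power_mult_F_power: "finv ^ n * F ^ n = 1"
proof (induction n)
  case (Suc n)
  have "finv ^ Suc n * F ^ Suc n = finv * (finv ^ n * F ^ n) * F"
    by (simp add: mult.assoc power_commutes)
  then show ?case
    using Suc by (simp add: finv_F)
qed simp

lemma F_power_mult_finv_power: "F ^ n * finv ^ n = 1"
proof (induction n)
  case (Suc n)
  have "F ^ Suc n * finv ^ Suc n = F * (F ^ n * finv ^ n) * finv"
    by (simp add: mult.assoc power_commutes)
  then show ?case
    using Suc by (simp add: F_finv)
qed simp

definition diff_conj :: "'r \<Rightarrow> 'r" where
  "diff_conj a = F * a * finv - a"

lemma diff_conj_funpow: "(diff_conj ^^ n) a = (ad F ^^ n) a * finv ^ n"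
proof (induction n)
  case (Suc n)
  have "F * (a * finv ^ n) * finv - a * finv ^ n = ad F a * finv ^ Suc n" for a
  proof -
    have "a * F * (finv * finv ^ n) = a * (F * finv) * finv ^ n"
      by (simp only: mult.assoc)
    then show ?thesis
      by (simp add: ad_def F_finv left_diff_distrib mult.assoc power_commutes)
  qed
  then show ?case
    by (simp only: funpow.simps o_apply Suc.IH) (simp add: diff_conj_def)
qed simp

lemma diff_conj_funpow_linear:
  "(diff_conj ^^ n) (a + b) = (diff_conj ^^ n) a + (diff_conj ^^ n) b"
  "(diff_conj ^^ n) (s c * a) = s c * (diff_conj ^^ n) a"
  "(diff_conj ^^ n) 0 = 0"
proof -
  show "(diff_conj ^^ n) (a + b) = (diff_conj ^^ n) a + (diff_conj ^^ n) b"
    by (simp add: diff_conj_funpow ad_funpow_add distrib_right)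
  have "ad F (s c * a) = s c * ad F a" for a
    by (simp add: ad_def right_diff_distrib mult.assoc[symmetric] s_central[of c F])
  then have "(ad F ^^ n) (s c * a) = s c * (ad F ^^ n) a"
    by (induction n) simp_all
  then show "(diff_conj ^^ n) (s c * a) = s c * (diff_conj ^^ n) a"
    by (simp add: diff_conj_funpow mult.assoc)
  show "(diff_conj ^^ n) 0 = 0"
    by (simp add: diff_conj_funpow ad_funpow_zero)
qed

lemma diff_conj_funpow_sum: "(diff_conj ^^ n) (sum g A) = (\<Sum>i\<in>A. (diff_conj ^^ n) (g i))"
  by (induction A rule: infinite_finite_induct) (simp_all add: diff_conj_funpow_linear)

lemma obtain_diff_conj_nilpotent:
  obtains n where "\<And>i. n \<le> i \<Longrightarrow> (diff_conj ^^ i) a = 0"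
proof -
  obtain n where "(ad F ^^ n) a = 0"
    using ad_nilpotent by blast
  then have "(diff_conj ^^ i) a = 0" if "n \<le> i" for i
    using that by (simp add: diff_conj_funpow ad_funpow_mono)
  then show ?thesis
    using that by blast
qed

definition conj_power :: "'a \<Rightarrow> 'r \<Rightarrow> 'r" where
  "conj_power z a = Sum_any (\<lambda>i. s (z gchoose i) * (diff_conj ^^ i) a)"

lemma conj_power_eq_sum:
  assumes "\<And>i. n \<le> i \<Longrightarrow> (diff_conj ^^ i) a = 0"
  shows "conj_power z a = (\<Sum>i<n. s (z gchoose i) * (diff_conj ^^ i) a)"
  unfolding conj_power_def
proof (rule Sum_any.expand_superset)
  show "{i. s (z gchoose i) * (diff_conj ^^ i) a \<noteq> 0} \<subseteq> {..<n}"
    using assms by (auto intro: ccontr simp: not_less)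
qed simp

lemma conj_power_add: "conj_power z (a + b) = conj_power z a + conj_power z b"
proof -
  obtain n m where n: "\<And>i. n \<le> i \<Longrightarrow> (diff_conj ^^ i) a = 0"
    and m: "\<And>i. m \<le> i \<Longrightarrow> (diff_conj ^^ i) b = 0"
    using obtain_diff_conj_nilpotent by metis
  have a: "conj_power z a = (\<Sum>i<max n m. s (z gchoose i) * (diff_conj ^^ i) a)"
    by (rule conj_power_eq_sum) (simp add: n)
  have b: "conj_power z b = (\<Sum>i<max n m. s (z gchoose i) * (diff_conj ^^ i) b)"
    by (rule conj_power_eq_sum) (simp add: m)
  have "conj_power z (a + b) = (\<Sum>i<max n m. s (z gchoose i) * (diff_conj ^^ i) (a + b))"
    by (rule conj_power_eq_sum) (simp add: n m diff_conj_funpow_linear)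
  then show ?thesis
    by (simp add: a b diff_conj_funpow_linear distrib_left sum.distrib)
qed

lemma conj_power_fixed:
  assumes "F * a = a * F"
  shows "conj_power z a = a"
proof -
  have "(diff_conj ^^ i) a = 0" if "1 \<le> i" for i
  proof -
    have "ad F a = 0"
      by (simp add: ad_def assms)
    then have "(ad F ^^ 1) a = 0"
      by simp
    then show ?thesis
      using that by (simp only: diff_conj_funpow ad_funpow_mono mult_zero_left)
  qed
  then have "conj_power z a = (\<Sum>i<1. s (z gchoose i) * (diff_conj ^^ i) a)"
    by (rule conj_power_eq_sum)
  then show ?thesis
    by (simp add: s_one)
qed

lemma s_sum: "s (sum g A) = (\<Sum>i\<in>A. s (g i))"
  by (induction A rule: infinite_finite_induct) (simp_all add: s_zero s_add)

text \<open>\<open>(1 + T)\<^sup>z (1 + T)\<^sup>w = (1 + T)\<^sup>z\<^sup>+\<^sup>w\<close> for the locally nilpotent operator \<open>T\<close> = \<^const>\<open>diff_conj\<close>: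
  comparing the coefficients of \<open>T\<^sup>k\<close> gives the Vandermonde convolution.\<close>

lemma conj_power_conj_power: "conj_power z (conj_power w a) = conj_power (z + w) a"
proof -
  let ?T = "\<lambda>i. (diff_conj ^^ i) a"
  obtain n where n: "\<And>i. n \<le> i \<Longrightarrow> ?T i = 0"
    using obtain_diff_conj_nilpotent by blast
  have w: "conj_power w a = (\<Sum>j<n. s (w gchoose j) * ?T j)"
    using n by (rule conj_power_eq_sum)
  have T: "(diff_conj ^^ i) (conj_power w a) = (\<Sum>j<n. s (w gchoose j) * ?T (i + j))" for i
    by (simp add: w diff_conj_funpow_sum diff_conj_funpow_linear funpow_add)
  have "conj_power z (conj_power w a) = (\<Sum>i<n. s (z gchoose i) * (diff_conj ^^ i) (conj_power w a))"
    by (rule conj_power_eq_sum) (simp add: T n)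
  also have "\<dots> = (\<Sum>i<n. \<Sum>j<n. s (z gchoose i) * (s (w gchoose j) * ?T (i + j)))"
    by (simp only: T sum_distrib_left)
  also have "\<dots> = (\<Sum>k<n. \<Sum>i\<le>k. s (z gchoose i) * (s (w gchoose (k - i)) * ?T (i + (k - i))))"
    by (rule sum_square_eq_sum_triangle) (simp add: n)
  also have "\<dots> = (\<Sum>k<n. s (\<Sum>i\<le>k. (z gchoose i) * (w gchoose (k - i))) * ?T k)"
    by (simp add: s_sum s_mult sum_distrib_right mult.assoc)
  also have "\<dots> = (\<Sum>k<n. s ((z + w) gchoose k) * ?T k)"
    by (simp add: gbinomial_Vandermonde[symmetric] atLeast0AtMost)
  also have "\<dots> = conj_power (z + w) a"
    using n by (rule conj_power_eq_sum[symmetric])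
  finally show ?thesis .
qed

lemma conj_power_0: "conj_power 0 a = a"
proof -
  have "conj_power 0 a = (\<Sum>i\<in>{0}. s (0 gchoose i) * (diff_conj ^^ i) a)"
    unfolding conj_power_def
    by (rule Sum_any.expand_superset) (auto simp: gbinomial_0_left s_zero split: if_splits)
  then show ?thesis
    by (simp add: s_one)
qed

lemma conj_power_1: "conj_power 1 a = F * a * finv"
proof -
  obtain n where n: "\<And>i. n \<le> i \<Longrightarrow> (diff_conj ^^ i) a = 0"
    using obtain_diff_conj_nilpotent by blast
  have "conj_power 1 a = (\<Sum>i<max n 2. s (1 gchoose i) * (diff_conj ^^ i) a)"
    by (rule conj_power_eq_sum) (simp add: n)
  also have "\<dots> = (\<Sum>i<2. s (1 gchoose i) * (diff_conj ^^ i) a)"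
  proof (rule sum.mono_neutral_right)
    have "(1::'a) gchoose i = 0" if "2 \<le> i" for i
      using that binomial_gbinomial[of 1 i, where ?'a = 'a] by (simp add: binomial_eq_0)
    then show "\<forall>i\<in>{..<max n 2} - {..<2}. s (1 gchoose i) * (diff_conj ^^ i) a = 0"
      by (simp add: s_zero not_less)
  qed auto
  also have "\<dots> = F * a * finv"
    by (simp add: numeral_2_eq_2 s_one diff_conj_def)
  finally show ?thesis .
qed

text \<open>The group law leaves no choice here, because the power with exponent \<open>- 1\<close> inverts the conjugation.\<close>

lemma conj_power_minus_of_nat: "conj_power (- of_nat j) a = finv ^ j * a * F ^ j"
proof (induction j)
  case 0
  show ?case
    by (simp add: conj_power_0)
next
  case (Suc j)
  let ?b = "finv * (finv ^ j * a * F ^ j) * F"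
  have "F * ?b * finv = (F * finv) * (finv ^ j * a * F ^ j) * (F * finv)"
    by (simp only: mult.assoc)
  then have "conj_power 1 ?b = conj_power (- of_nat j) a"
    by (simp add: conj_power_1 F_finv Suc.IH)
  then have "conj_power (- 1) (conj_power 1 ?b) = conj_power (- 1 + - of_nat j) a"
    by (simp only: conj_power_conj_power)
  then have "conj_power (- of_nat (Suc j)) a = ?b"
    by (simp add: conj_power_conj_power conj_power_0)
  then show ?case
    by (simp add: mult.assoc power_commutes)
qed

lemma ad_funpow_mult_Leibniz:
  "(ad F ^^ n) (a * b) = (\<Sum>i\<le>n. s (of_nat (n choose i)) * ((ad F ^^ i) a * (ad F ^^ (n - i)) b))"
proof (induction n)
  case 0
  show ?case
    by (simp add: s_one)
next
  case (Suc n)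
  let ?c = "\<lambda>i j. (ad F ^^ i) a * (ad F ^^ j) b"
  let ?s = "\<lambda>n i. s (of_nat (n choose i))"
  have ad_sum: "ad F (sum g A) = (\<Sum>i\<in>A. ad F (g i))" for g :: "nat \<Rightarrow> 'r" and A
    by (simp add: ad_def sum_distrib_left sum_distrib_right sum_subtractf)
  have step: "ad F (s c * ?c i j) = s c * ?c (Suc i) j + s c * ?c i (Suc j)" for c i j
  proof -
    have "ad F (s c * x) = s c * ad F x" for x
      by (simp add: ad_def right_diff_distrib mult.assoc[symmetric] s_central[of c F])
    moreover have "ad F (?c i j) = ?c (Suc i) j + ?c i (Suc j)"
      by (simp add: ad_def algebra_simps)
    ultimately show ?thesis
      by (simp add: distrib_left)
  qed
  have "(ad F ^^ Suc n) (a * b)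
      = (\<Sum>i\<le>n. ?s n i * ?c (Suc i) (n - i)) + (\<Sum>i\<le>n. ?s n i * ?c i (Suc (n - i)))"
    by (simp only: funpow.simps o_apply Suc.IH ad_sum step sum.distrib)
  also have "(\<Sum>i\<le>n. ?s n i * ?c i (Suc (n - i))) = (\<Sum>i\<le>Suc n. ?s n i * ?c i (Suc n - i))"
  proof -
    have "?s n (Suc n) = 0"
      by (simp add: s_zero binomial_eq_0)
    then show ?thesis
      by (simp add: Suc_diff_le)
  qed
  also have "\<dots> = ?c 0 (Suc n) + (\<Sum>i\<le>n. ?s n (Suc i) * ?c (Suc i) (n - i))"
    unfolding sum.atMost_Suc_shift by (simp add: s_one)
  also have "(\<Sum>i\<le>n. ?s n i * ?c (Suc i) (n - i)) + (?c 0 (Suc n) + (\<Sum>i\<le>n. ?s n (Suc i) * ?c (Suc i) (n - i)))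
      = ?c 0 (Suc n) + (\<Sum>i\<le>n. ?s (Suc n) (Suc i) * ?c (Suc i) (n - i))"
    by (simp add: s_add distrib_right sum.distrib add_ac)
  also have "\<dots> = (\<Sum>i\<le>Suc n. ?s (Suc n) i * ?c i (Suc n - i))"
    unfolding sum.atMost_Suc_shift by (simp add: s_one)
  finally show ?case .
qed

text \<open>An automorphism has multiplicative powers. To see this for the binomial series, expand the
  left factor as \<open>\<Sum>\<^sub>j (z choose j) ad\<^sup>j(a) F\<^sup>-\<^sup>j\<close> and move \<open>F\<^sup>-\<^sup>j\<close> past the right factor, which turns its
  exponent \<open>z\<close> into \<open>z - j\<close>. The trinomial revision
  \<open>(z choose j) (z - j choose q) = (z choose j + q) (j + q choose j)\<close> then leaves the Leibniz rule.\<close>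

lemma conj_power_mult: "conj_power z (a * b) = conj_power z a * conj_power z b"
proof -
  let ?A = "\<lambda>i. (ad F ^^ i) a" and ?B = "\<lambda>i. (ad F ^^ i) b"
  obtain n0 m0 where nm: "?A n0 = 0" "?B m0 = 0"
    using ad_nilpotent by metis
  define n where "n = n0 + m0"
  have A: "?A i = 0" if "n0 \<le> i" for i
    using ad_funpow_mono[OF nm(1) that] .
  have B: "?B i = 0" if "m0 \<le> i" for i
    using ad_funpow_mono[OF nm(2) that] .
  have AB: "(ad F ^^ i) (a * b) = 0" if "n \<le> i" for i
    using ad_funpow_mono[OF ad_funpow_mult[OF nm] that[unfolded n_def]] .
  let ?g = "\<lambda>j q. s (z gchoose j) * s ((z - of_nat j) gchoose q) * (?A j * ?B q * finv ^ (j + q))"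
  have b: "conj_power w b = (\<Sum>q<n. s (w gchoose q) * (?B q * finv ^ q))" for w
    unfolding diff_conj_funpow[symmetric]
    by (rule conj_power_eq_sum) (simp add: diff_conj_funpow B n_def)
  have "conj_power z a * conj_power z b
      = (\<Sum>j<n. s (z gchoose j) * (?A j * finv ^ j)) * conj_power z b"
    unfolding diff_conj_funpow[symmetric]
    by (subst conj_power_eq_sum[of n]) (simp_all add: diff_conj_funpow A n_def)
  also have "\<dots> = (\<Sum>j<n. \<Sum>q<n. ?g j q)"
    unfolding sum_distrib_right
  proof (rule sum.cong[OF refl])
    fix j
    \<comment> \<open>Moving a negative power of F to the right lowers the exponent of the conjugation power.\<close>
    have "finv ^ j * conj_power z b = finv ^ j * conj_power z b * (F ^ j * finv ^ j)"
      by (simp add: F_power_mult_finv_power)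
    also have "\<dots> = conj_power (- of_nat j) (conj_power z b) * finv ^ j"
      by (simp only: conj_power_minus_of_nat mult.assoc)
    also have "\<dots> = conj_power (z - of_nat j) b * finv ^ j"
      by (simp add: conj_power_conj_power)
    finally have "s (z gchoose j) * (?A j * finv ^ j) * conj_power z b
        = s (z gchoose j) * (?A j * (conj_power (z - of_nat j) b * finv ^ j))"
      by (simp add: mult.assoc)
    also have "\<dots> = (\<Sum>q<n. ?g j q)"
      unfolding b sum_distrib_left sum_distrib_right
    proof (rule sum.cong[OF refl])
      fix q
      have "?A j * (s ((z - of_nat j) gchoose q) * (?B q * finv ^ q) * finv ^ j)
          = s ((z - of_nat j) gchoose q) * (?A j * ?B q * (finv ^ q * finv ^ j))"
        by (simp only: mult.assoc[symmetric] s_central[symmetric])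
      then show "s (z gchoose j) * (?A j * (s ((z - of_nat j) gchoose q) * (?B q * finv ^ q) * finv ^ j)) = ?g j q"
        by (simp add: mult.assoc power_add[symmetric] add.commute)
    qed
    finally show "s (z gchoose j) * (?A j * finv ^ j) * conj_power z b = (\<Sum>q<n. ?g j q)" .
  qed
  also have "\<dots> = (\<Sum>k<n. \<Sum>i\<le>k. ?g i (k - i))"
  proof (rule sum_square_eq_sum_triangle)
    fix j q
    assume "n \<le> j + q"
    then have "n0 \<le> j \<or> m0 \<le> q"
      by (auto simp: n_def)
    then show "?g j q = 0"
      using A[of j] B[of q] by (elim disjE) simp_all
  qed
  also have "\<dots> = (\<Sum>k<n. s (z gchoose k) * ((ad F ^^ k) (a * b) * finv ^ k))"
  proof (rule sum.cong[OF refl])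
    fix k
    have "?g i (k - i) = s (z gchoose k) * (s (of_nat (k choose i)) * (?A i * ?B (k - i)) * finv ^ k)"
      if "i \<le> k" for i
    proof -
      have "(z gchoose i) * ((z - of_nat i) gchoose (k - i)) = (z gchoose k) * of_nat (k choose i)"
        using gbinomial_trinomial_revision[OF that, of z] by (simp add: binomial_gbinomial)
      then have "s (z gchoose i) * s ((z - of_nat i) gchoose (k - i))
          = s (z gchoose k) * s (of_nat (k choose i))"
        by (simp only: s_mult[symmetric])
      then show ?thesis
        using that by (simp add: mult.assoc)
    qed
    then show "(\<Sum>i\<le>k. ?g i (k - i)) = s (z gchoose k) * ((ad F ^^ k) (a * b) * finv ^ k)"
      by (simp add: ad_funpow_mult_Leibniz sum_distrib_left sum_distrib_right)
  qed
  also have "\<dots> = conj_power z (a * b)"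
    unfolding diff_conj_funpow[symmetric]
    by (rule conj_power_eq_sum[symmetric]) (simp add: diff_conj_funpow AB)
  finally show ?thesis
    by (rule sym)
qed

end

section \<open>Left modules and tensor products\<close>

lemma poly_mapping_single_induct [case_names single add]:
  fixes p :: "'k \<Rightarrow>\<^sub>0 'b::monoid_add"
  assumes single: "\<And>k c. P (Poly_Mapping.single k c)"
    and add: "\<And>p q. P p \<Longrightarrow> P q \<Longrightarrow> P (p + q)"
  shows "P p"
proof (induction p rule: update_induct)
  case const
  show ?case
    using single[of undefined 0] by simp
next
  case (update f k v)
  have "Poly_Mapping.update k v f = f + Poly_Mapping.single k v"
    using update.hyps
    by (intro poly_mapping_eqI)
      (auto simp: lookup_update lookup_add lookup_single when_def in_keys_iff)
  then show ?case
    using add[OF update.IH single] by simp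
qed

text \<open>The additive extension of a family of additive maps to finitely supported families. It serves for
  free abelian groups, loops, polynomials and the free associative algebra.\<close>

definition lin_ext :: "('k \<Rightarrow> 'c::zero \<Rightarrow> 'b) \<Rightarrow> ('k \<Rightarrow>\<^sub>0 'c) \<Rightarrow> 'b::comm_monoid_add" where
  "lin_ext g p = (\<Sum>k\<in>Poly_Mapping.keys p. g k (Poly_Mapping.lookup p k))"

locale additive_on_coefficients =
  fixes g :: "'k \<Rightarrow> 'c::ab_group_add \<Rightarrow> 'b::ab_group_add"
  assumes g_add: "g k (c + d) = g k c + g k d"
begin

lemma g_zero: "g k 0 = 0"
  using g_add[of k 0 0] by simp

lemma lin_ext_superset:
  "finite A \<Longrightarrow> Poly_Mapping.keys p \<subseteq> A \<Longrightarrow> lin_ext g p = (\<Sum>k\<in>A. g k (Poly_Mapping.lookup p k))"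
  unfolding lin_ext_def by (rule sum.mono_neutral_left) (auto simp: in_keys_iff g_zero)

lemma lin_ext_add: "lin_ext g (p + q) = lin_ext g p + lin_ext g q"
proof -
  let ?A = "Poly_Mapping.keys p \<union> Poly_Mapping.keys q"
  have "Poly_Mapping.keys (p + q) \<subseteq> ?A"
    by (rule Poly_Mapping.keys_add)
  then show ?thesis
    using lin_ext_superset[of ?A p] lin_ext_superset[of ?A q] lin_ext_superset[of ?A "p + q"]
    by (simp add: lookup_add g_add sum.distrib)
qed

lemma lin_ext_zero: "lin_ext g 0 = 0"
  by (simp add: lin_ext_def)

lemma lin_ext_minus: "lin_ext g (- p) = - lin_ext g p"
  using lin_ext_add[of "- p" p] by (simp add: lin_ext_zero eq_neg_iff_add_eq_0)

lemma lin_ext_diff: "lin_ext g (p - q) = lin_ext g p - lin_ext g q"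
  using lin_ext_add[of p "- q"] by (simp add: lin_ext_minus)

lemma lin_ext_single: "lin_ext g (Poly_Mapping.single k c) = g k c"
  by (simp add: lin_ext_def g_zero)

end

locale left_module = abelian_group V for V :: "('u::{ring, monoid_mult}, 'm) module" (structure) +
  assumes smult_closed: "w \<in> carrier V \<Longrightarrow> a \<odot> w \<in> carrier V"
    and smult_add_left: "w \<in> carrier V \<Longrightarrow> (a + b) \<odot> w = a \<odot> w \<oplus> b \<odot> w"
    and smult_add_right:
      "w \<in> carrier V \<Longrightarrow> w' \<in> carrier V \<Longrightarrow> a \<odot> (w \<oplus> w') = a \<odot> w \<oplus> a \<odot> w'"
    and smult_mult: "w \<in> carrier V \<Longrightarrow> (a * b) \<odot> w = a \<odot> (b \<odot> w)"
    and smult_one: "w \<in> carrier V \<Longrightarrow> 1 \<odot> w = w"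
begin

lemma zero_if_idem: "w \<in> carrier V \<Longrightarrow> w = w \<oplus> w \<Longrightarrow> w = \<zero>"
  by (metis add.l_cancel_one')

lemma smult_zero_left: "w \<in> carrier V \<Longrightarrow> 0 \<odot> w = \<zero>"
  using smult_add_left[of w 0 0] by (intro zero_if_idem smult_closed) simp_all

lemma smult_zero_right: "a \<odot> \<zero> = \<zero>"
  using smult_add_right[of \<zero> \<zero> a] by (intro zero_if_idem smult_closed) simp_all

lemma smult_minus_left: "w \<in> carrier V \<Longrightarrow> (- a) \<odot> w = \<ominus> (a \<odot> w)"
  by (rule minus_equality[symmetric]) (simp_all add: smult_closed smult_add_left[symmetric] smult_zero_left)

lemma smult_diff_left: "w \<in> carrier V \<Longrightarrow> (a - b) \<odot> w = a \<odot> w \<ominus> b \<odot> w"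
  using smult_add_left[of w a "- b"] by (simp add: smult_minus_left a_minus_def)

end

text \<open>What makes the balanced tensor product a left module: \<open>M\<close> is closed under its operations, and
  the right action of \<open>R\<close> on the ring commutes with left multiplication.\<close>

locale tensor_product =
  fixes R :: "'r set" and ra :: "'u::{ring, monoid_mult} \<Rightarrow> 'r \<Rightarrow> 'u" and M :: "('r, 'm) module"
  assumes add_closed: "m \<in> carrier M \<Longrightarrow> m' \<in> carrier M \<Longrightarrow> m \<oplus>\<^bsub>M\<^esub> m' \<in> carrier M"
    and scalar_closed: "r \<in> R \<Longrightarrow> m \<in> carrier M \<Longrightarrow> r \<odot>\<^bsub>M\<^esub> m \<in> carrier M"
    and ra_mult: "r \<in> R \<Longrightarrow> ra (u * a) r = u * ra a r"
begin

abbreviation "S \<equiv> (UNIV :: 'u set) \<times> carrier M"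
abbreviation "G \<equiv> tensor_free M :: ('u \<times> 'm \<Rightarrow>\<^sub>0 int) monoid"
abbreviation "K \<equiv> tensor_kernel R ra M"
abbreviation "T \<equiv> tensor R ra M"
abbreviation "cls \<equiv> (\<lambda>g. K #>\<^bsub>G\<^esub> g)"
abbreviation "pure \<equiv> pure_tensor R ra M"

lemma carrier_G: "carrier G = {c. Poly_Mapping.keys c \<subseteq> S}"
  by (simp add: tensor_free_def free_Abelian_group_def)

lemma mult_G: "g \<otimes>\<^bsub>G\<^esub> h = g + h" and one_G: "\<one>\<^bsub>G\<^esub> = 0"
  by (simp_all add: tensor_free_def)

lemma comm_group_G: "comm_group G"
  by (simp add: tensor_free_def abelian_free_Abelian_group)

lemma G_closed:
  "0 \<in> carrier G" "g \<in> carrier G \<Longrightarrow> h \<in> carrier G \<Longrightarrow> g + h \<in> carrier G"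
  "g \<in> carrier G \<Longrightarrow> - g \<in> carrier G" "g \<in> carrier G \<Longrightarrow> h \<in> carrier G \<Longrightarrow> g - h \<in> carrier G"
  using Poly_Mapping.keys_add[of g h] Poly_Mapping.keys_diff[of g h] by (auto simp: carrier_G)

lemma frag_of_closed: "m \<in> carrier M \<Longrightarrow> frag_of (a, m) \<in> carrier G"
  by (simp add: carrier_G)

lemma relators_closed: "tensor_relators R ra M \<subseteq> carrier G"
  unfolding tensor_relators_def
  by (auto intro!: G_closed frag_of_closed add_closed scalar_closed)

lemma subgroup_K: "subgroup K G"
  unfolding tensor_kernel_def
  by (rule group.generate_is_subgroup[OF comm_group.axioms(2)[OF comm_group_G] relators_closed])

lemma K_closed:
  "k \<in> K \<Longrightarrow> k \<in> carrier G" "0 \<in> K" "k \<in> K \<Longrightarrow> l \<in> K \<Longrightarrow> k + l \<in> K" "k \<in> K \<Longrightarrow> - k \<in> K"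
proof -
  show "k \<in> carrier G" if "k \<in> K" for k
    using subgroup.mem_carrier[OF subgroup_K that] .
  then show "- k \<in> K" if "k \<in> K" for k
    using subgroup.m_inv_closed[OF subgroup_K that] that
    by (simp add: tensor_free_def)
  show "0 \<in> K"
    using subgroup.one_closed[OF subgroup_K] by (simp add: one_G)
  show "k + l \<in> K" if "k \<in> K" "l \<in> K" for k l
    using subgroup.m_closed[OF subgroup_K that] by (simp add: mult_G)
qed

lemma K_induct [consumes 1, case_names zero relator add minus]:
  assumes "k \<in> K" "P 0" "\<And>g. g \<in> tensor_relators R ra M \<Longrightarrow> P g"
    and "\<And>g h. P g \<Longrightarrow> P h \<Longrightarrow> P (g + h)" "\<And>g. P g \<Longrightarrow> P (- g)"
  shows "P k"
  using assms(1) unfolding tensor_kernel_def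
proof (induction rule: generate.induct)
  case (inv h)
  then have "Poly_Mapping.keys h \<subseteq> S"
    using relators_closed carrier_G by auto
  then have "inv\<^bsub>G\<^esub> h = - h"
    by (simp add: tensor_free_def)
  with inv show ?case
    using assms(3,5) by simp
qed (simp_all add: one_G mult_G assms)

lemma mem_cls: "h \<in> cls g \<longleftrightarrow> h - g \<in> K"
  by (force simp: r_coset_def mult_G)

lemma cls_eq_iff: "cls g = cls h \<longleftrightarrow> g - h \<in> K"
proof
  assume "cls g = cls h"
  then have "g \<in> cls h"
    using K_closed(2) mem_cls[of g g] by simp
  then show "g - h \<in> K"
    by (simp add: mem_cls)
next
  assume gh: "g - h \<in> K"
  have "x - g \<in> K \<longleftrightarrow> x - h \<in> K" for x
    using K_closed(3)[OF _ gh, of "x - g"] K_closed(3)[OF _ K_closed(4)[OF gh], of "x - h"] by auto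
  then show "cls g = cls h"
    by (intro Set.set_eqI) (simp add: mem_cls)
qed

lemma carrier_T: "carrier T = cls ` carrier G"
  by (auto simp: tensor_def Let_def FactGroup_def RCOSETS_def)

lemma add_T: "g \<in> carrier G \<Longrightarrow> h \<in> carrier G \<Longrightarrow> cls g \<oplus>\<^bsub>T\<^esub> cls h = cls (g + h)"
  using normal.rcos_sum[OF comm_group.subgroup_imp_normal[OF comm_group_G subgroup_K], of g h]
  by (simp add: tensor_def Let_def FactGroup_def mult_G)

lemma zero_T: "\<zero>\<^bsub>T\<^esub> = cls 0"
proof -
  have "cls 0 = K"
    by (intro Set.set_eqI) (simp add: mem_cls)
  then show ?thesis
    by (simp add: tensor_def Let_def FactGroup_def)
qed

lemma abelian_group_T: "abelian_group T"
proof (rule abelian_groupI)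
  fix w
  assume "w \<in> carrier T"
  then obtain g where g: "g \<in> carrier G" "w = cls g"
    by (auto simp: carrier_T)
  then have "cls (- g) \<in> carrier T" "cls (- g) \<oplus>\<^bsub>T\<^esub> w = \<zero>\<^bsub>T\<^esub>"
    by (simp_all add: carrier_T G_closed add_T zero_T)
  then show "\<exists>y\<in>carrier T. y \<oplus>\<^bsub>T\<^esub> w = \<zero>\<^bsub>T\<^esub>"
    by blast
qed (auto simp: carrier_T zero_T add_T G_closed add_ac)

lemma lmult_add: "tensor_lmult u (g + h) = tensor_lmult u g + tensor_lmult u h"
  and lmult_diff: "tensor_lmult u (g - h) = tensor_lmult u g - tensor_lmult u h"
  and lmult_minus: "tensor_lmult u (- g) = - tensor_lmult u g"
  and lmult_zero: "tensor_lmult u 0 = 0"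
  and lmult_frag_of: "tensor_lmult u (frag_of (a, m)) = frag_of (u * a, m)"
  by (simp_all add: tensor_lmult_def frag_extend_add frag_extend_diff frag_extend_minus)

lemma lmult_closed: "g \<in> carrier G \<Longrightarrow> tensor_lmult u g \<in> carrier G"
  unfolding tensor_lmult_def carrier_G using keys_frag_extend by fastforce

text \<open>Left multiplication permutes the relators, so it descends to the quotient.\<close>

lemma lmult_K: "k \<in> K \<Longrightarrow> tensor_lmult u k \<in> K"
proof (induction rule: K_induct)
  case (relator g)
  then have "tensor_lmult u g \<in> tensor_relators R ra M"
    unfolding tensor_relators_def
    by (auto simp: lmult_diff lmult_frag_of distrib_left ra_mult[symmetric]; blast)
  then show ?case
    unfolding tensor_kernel_def by (rule generate.incl)
qed (simp_all add: lmult_zero lmult_add lmult_minus K_closed)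

lemma smult_T: "u \<odot>\<^bsub>T\<^esub> cls g = cls (tensor_lmult u g)"
proof -
  have "cls (tensor_lmult u h) = cls (tensor_lmult u g)" if "h \<in> cls g" for h
    using that lmult_K[of "h - g" u] by (simp add: mem_cls cls_eq_iff lmult_diff)
  moreover have "g \<in> cls g"
    by (simp add: mem_cls K_closed)
  ultimately have "(\<Union>h\<in>cls g. cls (tensor_lmult u h)) = cls (tensor_lmult u g)"
    by blast
  then show ?thesis
    by (simp add: tensor_def Let_def)
qed

lemma pure_eq: "pure a m = cls (frag_of (a, m))"
  by (simp add: pure_tensor_def)

lemma pure_closed: "m \<in> carrier M \<Longrightarrow> pure a m \<in> carrier T"
  by (simp add: pure_eq carrier_T frag_of_closed)

lemma relator_cls: "g - h \<in> tensor_relators R ra M \<Longrightarrow> cls g = cls h"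
  unfolding cls_eq_iff unfolding tensor_kernel_def by (rule generate.incl)

lemma pure_add_left:
  assumes "m \<in> carrier M"
  shows "pure (a + b) m = pure a m \<oplus>\<^bsub>T\<^esub> pure b m"
proof -
  have "frag_of (a + b, m) - (frag_of (a, m) + frag_of (b, m)) \<in> tensor_relators R ra M"
    using assms unfolding tensor_relators_def diff_diff_eq[symmetric] by blast
  then show ?thesis
    using assms by (simp only: pure_eq add_T frag_of_closed) (rule relator_cls)
qed

lemma pure_add_right:
  assumes "m \<in> carrier M" "m' \<in> carrier M"
  shows "pure a (m \<oplus>\<^bsub>M\<^esub> m') = pure a m \<oplus>\<^bsub>T\<^esub> pure a m'"
proof -
  have "frag_of (a, m \<oplus>\<^bsub>M\<^esub> m') - (frag_of (a, m) + frag_of (a, m')) \<in> tensor_relators R ra M"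
    using assms unfolding tensor_relators_def diff_diff_eq[symmetric] by blast
  then show ?thesis
    using assms by (simp only: pure_eq add_T frag_of_closed) (rule relator_cls)
qed

lemma pure_balanced:
  assumes "r \<in> R" "m \<in> carrier M"
  shows "pure (ra a r) m = pure a (r \<odot>\<^bsub>M\<^esub> m)"
  unfolding pure_eq by (rule relator_cls) (use assms in \<open>auto simp: tensor_relators_def\<close>)

lemma smult_pure: "u \<odot>\<^bsub>T\<^esub> pure a m = pure (u * a) m"
  by (simp add: pure_eq smult_T lmult_frag_of)

lemma smult_T_closed: "w \<in> carrier T \<Longrightarrow> u \<odot>\<^bsub>T\<^esub> w \<in> carrier T"
  by (auto simp: carrier_T smult_T lmult_closed)

lemma smult_T_add:
  "w \<in> carrier T \<Longrightarrow> w' \<in> carrier T \<Longrightarrow> u \<odot>\<^bsub>T\<^esub> (w \<oplus>\<^bsub>T\<^esub> w') = u \<odot>\<^bsub>T\<^esub> w \<oplus>\<^bsub>T\<^esub> u \<odot>\<^bsub>T\<^esub> w'"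
  by (auto simp: carrier_T smult_T lmult_closed add_T lmult_add)

lemma pure_zero_left: "m \<in> carrier M \<Longrightarrow> pure 0 m = \<zero>\<^bsub>T\<^esub>"
proof -
  assume m: "m \<in> carrier M"
  interpret T: abelian_group T
    by (rule abelian_group_T)
  show ?thesis
    using pure_add_left[OF m, of 0 0] pure_closed[OF m, of 0] by (metis T.add.l_cancel_one' add_0)
qed

lemma pure_minus_left:
  assumes "m \<in> carrier M"
  shows "cls (- frag_of (a, m)) = pure (- a) m"
proof -
  have "pure a m \<oplus>\<^bsub>T\<^esub> pure (- a) m = \<zero>\<^bsub>T\<^esub>"
    using pure_add_left[OF assms, of a "- a"] pure_zero_left[OF assms] by simp
  then have "frag_of (a, m) + frag_of (- a, m) \<in> K"
    using assms by (simp add: pure_eq add_T frag_of_closed zero_T cls_eq_iff)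
  then have "- (frag_of (a, m) + frag_of (- a, m)) \<in> K"
    by (rule K_closed)
  then show ?thesis
    by (simp add: pure_eq cls_eq_iff)
qed

text \<open>Negatives are covered because the negative of a pure tensor is again pure.\<close>

lemma T_induct [consumes 1, case_names zero pure add]:
  assumes "w \<in> carrier T"
    and zero: "P \<zero>\<^bsub>T\<^esub>"
    and pure: "\<And>a m. m \<in> carrier M \<Longrightarrow> P (pure a m)"
    and add: "\<And>w w'. w \<in> carrier T \<Longrightarrow> w' \<in> carrier T \<Longrightarrow> P w \<Longrightarrow> P w' \<Longrightarrow> P (w \<oplus>\<^bsub>T\<^esub> w')"
  shows "P w"
proof -
  obtain c where c: "Poly_Mapping.keys c \<subseteq> S" "w = cls c"
    using assms(1) by (auto simp: carrier_T carrier_G)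
  let ?P = "\<lambda>c. c \<in> carrier G \<and> P (cls c) \<and> P (cls (- c))"
  have step: "P (cls (a - b))" if "?P a" "?P b" for a b
    using add[of "cls a" "cls (- b)"] that by (simp add: carrier_T G_closed add_T)
  have "?P c"
    using c(1)
  proof (induction c rule: frag_induction)
    case zero
    show ?case
      using assms(2) by (simp add: zero_T G_closed)
  next
    case (one x)
    then obtain a m where "x = (a, m)" "m \<in> carrier M"
      by auto
    then show ?case
      using pure[of m a] pure[of m "- a"] by (simp add: frag_of_closed pure_minus_left pure_eq)
  next
    case (diff a b)
    then show ?case
      using step[of a b] step[of b a] by (simp add: G_closed)
  qed
  then show ?thesis
    by (simp add: c(2))
qed

lemma left_module_T: "left_module T"
proof -
  interpret T: abelian_group T
    by (rule abelian_group_T)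
  have zero: "u \<odot>\<^bsub>T\<^esub> \<zero>\<^bsub>T\<^esub> = \<zero>\<^bsub>T\<^esub>" for u
    by (simp add: zero_T smult_T lmult_zero)
  show ?thesis
  proof unfold_locales
    fix w and a b :: 'u
    assume w: "w \<in> carrier T"
    show "(a + b) \<odot>\<^bsub>T\<^esub> w = a \<odot>\<^bsub>T\<^esub> w \<oplus>\<^bsub>T\<^esub> b \<odot>\<^bsub>T\<^esub> w"
      using w
    proof (induction rule: T_induct)
      case (add w w')
      then show ?case
        by (simp add: smult_T_add smult_T_closed T.a_ac)
    qed (simp_all add: zero smult_pure distrib_right pure_add_left)
    show "(a * b) \<odot>\<^bsub>T\<^esub> w = a \<odot>\<^bsub>T\<^esub> (b \<odot>\<^bsub>T\<^esub> w)"
      using w by (induction rule: T_induct) (simp_all add: zero smult_pure mult.assoc smult_T_add smult_T_closed)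
    show "1 \<odot>\<^bsub>T\<^esub> w = w"
      using w by (induction rule: T_induct) (simp_all add: zero smult_pure smult_T_add smult_T_closed)
  qed (simp_all add: smult_T_closed smult_T_add)
qed

lemma tensor_universal:
  fixes g :: "'u \<Rightarrow> 'm \<Rightarrow> 'z::ring_1"
  assumes add_left: "\<And>a b m. m \<in> carrier M \<Longrightarrow> g (a + b) m = g a m + g b m"
    and add_right: "\<And>a m m'. m \<in> carrier M \<Longrightarrow> m' \<in> carrier M \<Longrightarrow> g a (m \<oplus>\<^bsub>M\<^esub> m') = g a m + g a m'"
    and balanced: "\<And>a r m. r \<in> R \<Longrightarrow> m \<in> carrier M \<Longrightarrow> g (ra a r) m = g a (r \<odot>\<^bsub>M\<^esub> m)"
  obtains \<Phi> where "\<And>a m. m \<in> carrier M \<Longrightarrow> \<Phi> (pure a m) = g a m"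
    and "\<And>w w'. w \<in> carrier T \<Longrightarrow> w' \<in> carrier T \<Longrightarrow> \<Phi> (w \<oplus>\<^bsub>T\<^esub> w') = \<Phi> w + \<Phi> w'"
proof -
  interpret L: additive_on_coefficients "\<lambda>(a, m) n. of_int n * g a m"
    by unfold_locales (auto simp: distrib_right)
  define L where "L = lin_ext (\<lambda>(a, m) n. of_int n * g a m)"
  note L = L.lin_ext_add[folded L_def] L.lin_ext_diff[folded L_def]
    L.lin_ext_minus[folded L_def] L.lin_ext_zero[folded L_def]
  have L_frag: "L (frag_of (a, m)) = g a m" for a m
    unfolding L_def by (simp add: L.lin_ext_single)
  have L_K: "L k = 0" if "k \<in> K" for k
    using that
  proof (induction rule: K_induct)
    case (relator c)
    then show ?case
      unfolding tensor_relators_def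
      by (auto simp: L L_frag add_left add_right balanced)
  qed (simp_all add: L)
  \<comment> \<open>The extension L to the free group vanishes on the relators, so any representative of a coset may be used.\<close>
  define \<Phi> where "\<Phi> C = L (SOME c. c \<in> C)" for C
  have \<Phi>: "\<Phi> (cls c) = L c" for c
  proof -
    have "c \<in> cls c"
      by (simp add: mem_cls K_closed)
    then have "(SOME d. d \<in> cls c) \<in> cls c"
      by (rule someI)
    then have "L ((SOME d. d \<in> cls c) - c) = 0"
      by (intro L_K) (simp add: mem_cls)
    then show ?thesis
      by (simp add: \<Phi>_def L)
  qed
  show thesis
  proof
    show "\<Phi> (pure a m) = g a m" for a m
      by (simp add: pure_eq \<Phi> L_frag)
    show "\<Phi> (w \<oplus>\<^bsub>T\<^esub> w') = \<Phi> w + \<Phi> w'" if "w \<in> carrier T" "w' \<in> carrier T" for w w'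
      using that by (auto simp: carrier_T add_T \<Phi> L)
  qed
qed

end

section \<open>Polynomial differential operators\<close>

text \<open>Monomials are multisets of indices, so that the monoid algebra of multisets is the polynomial
  ring in the variables \<open>X\<^sub>n\<close>.\<close>

type_synonym 'a mpoly = "int multiset \<Rightarrow>\<^sub>0 'a"

definition pvar :: "int \<Rightarrow> 'a::field_char_0 mpoly" where
  "pvar n = Poly_Mapping.single {#n#} 1"

definition pconst :: "'a::field_char_0 \<Rightarrow> 'a mpoly" where
  "pconst c = Poly_Mapping.single {#} c"

lemma pconst_simps:
  "pconst 0 = 0" "pconst 1 = 1" "pconst (c + d) = pconst c + pconst d"
  "pconst (c * d) = pconst c * pconst d" "pconst (- c) = - pconst c"
  "pconst (c - d) = pconst c - pconst d" "pconst (numeral k) = numeral k"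
  by (simp_all add: pconst_def single_add mult_single single_diff single_uminus
      flip: zero_multiset_def single_numeral single_one)

lemma pconst_mult_single: "pconst c * Poly_Mapping.single M d = Poly_Mapping.single M (c * d)"
  by (simp add: pconst_def mult_single)

lemma pvar_mult_single: "pvar n * Poly_Mapping.single M d = Poly_Mapping.single (add_mset n M) d"
  by (simp add: pvar_def mult_single)

lemma mpoly_induct [case_names const var add]:
  assumes const: "\<And>c. P (pconst c)"
    and var: "\<And>n p. P p \<Longrightarrow> P (pvar n * p)"
    and add: "\<And>p q. P p \<Longrightarrow> P q \<Longrightarrow> P (p + q)"
  shows "P (p :: 'a::field_char_0 mpoly)"
proof (induction p rule: poly_mapping_single_induct)
  case (single M c)
  show ?case
  proof (induction M)
    case empty
    show ?case
      using const[of c] by (simp add: pconst_def)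
  next
    case (add n M)
    show ?case
      using var[OF add, of n] by (simp add: pvar_mult_single)
  qed
qed (rule add)

text \<open>Coefficientwise descriptions of multiplication and differentiation make the commutation rules
  below identities between coefficients.\<close>

lemma lookup_pvar_mult:
  "Poly_Mapping.lookup (pvar n * p) M = (if n \<in># M then Poly_Mapping.lookup p (M - {#n#}) else 0)"
proof (induction p rule: poly_mapping_single_induct)
  case (single k c)
  have "add_mset n k = M \<longleftrightarrow> n \<in># M \<and> k = M - {#n#}"
    by auto
  then show ?case
    by (simp add: pvar_mult_single lookup_single when_def)
qed (simp add: distrib_left lookup_add)

lift_definition pdiff :: "int \<Rightarrow> 'a::field_char_0 mpoly \<Rightarrow> 'a mpoly" is
  "\<lambda>n p M. of_nat (Suc (count M n)) * p (add_mset n M)"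
proof -
  fix n :: int and p :: "int multiset \<Rightarrow> 'a"
  assume "finite {M. p M \<noteq> 0}"
  then have "finite ((\<lambda>M. M - {#n#}) ` {M. p M \<noteq> 0})"
    by (rule finite_imageI)
  moreover have "{M. of_nat (Suc (count M n)) * p (add_mset n M) \<noteq> 0} \<subseteq> (\<lambda>M. M - {#n#}) ` {M. p M \<noteq> 0}"
  proof
    fix M
    assume "M \<in> {M. of_nat (Suc (count M n)) * p (add_mset n M) \<noteq> 0}"
    then show "M \<in> (\<lambda>M. M - {#n#}) ` {M. p M \<noteq> 0}"
      by (intro image_eqI[of _ _ "add_mset n M"]) auto
  qed
  ultimately show "finite {M. of_nat (Suc (count M n)) * p (add_mset n M) \<noteq> 0}"
    by (rule rev_finite_subset)
qed

lemma pdiff_add: "pdiff n (p + q) = pdiff n p + pdiff n q"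
  by (rule poly_mapping_eqI) (simp add: pdiff.rep_eq lookup_add distrib_left)

lemma pdiff_zero: "pdiff n 0 = 0"
  by (rule poly_mapping_eqI) (simp add: pdiff.rep_eq)

lemma pdiff_diff: "pdiff n (p - q) = pdiff n p - pdiff n q"
  by (rule poly_mapping_eqI) (simp add: pdiff.rep_eq lookup_minus right_diff_distrib)

lemma pdiff_sum: "pdiff n (sum g A) = (\<Sum>i\<in>A. pdiff n (g i))"
  by (induction A rule: infinite_finite_induct) (simp_all add: pdiff_zero pdiff_add)

lemma pdiff_const: "pdiff n (pconst c) = 0"
  by (rule poly_mapping_eqI) (simp add: pdiff.rep_eq pconst_def lookup_single)

lemma pdiff_var: "pdiff a (pvar n * p) = (if a = n then p else 0) + pvar n * pdiff a p"
proof (rule poly_mapping_eqI)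
  fix M
  show "Poly_Mapping.lookup (pdiff a (pvar n * p)) M
      = Poly_Mapping.lookup ((if a = n then p else 0) + pvar n * pdiff a p) M"
  proof (cases "a = n")
    case True
    have "of_nat (Suc (count (M - {#n#}) n)) * Poly_Mapping.lookup p (add_mset n (M - {#n#}))
        = of_nat (count M n) * Poly_Mapping.lookup p M" if "n \<in># M"
      using that by (simp del: of_nat_Suc)
    then show ?thesis
      using True by (auto simp: pdiff.rep_eq lookup_pvar_mult lookup_add distrib_right left_diff_distrib not_in_iff)
  next
    case False
    then show ?thesis
      by (simp add: pdiff.rep_eq lookup_pvar_mult lookup_add)
  qed
qed

lemma lookup_pconst_mult: "Poly_Mapping.lookup (pconst c * p) M = c * Poly_Mapping.lookup p M"
  by (induction p rule: poly_mapping_single_induct)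
    (simp_all add: pconst_mult_single lookup_single when_def distrib_left lookup_add)

lemma pdiff_const_mult: "pdiff n (pconst c * p) = pconst c * pdiff n p"
  by (rule poly_mapping_eqI) (simp add: pdiff.rep_eq lookup_pconst_mult)

lemma pdiff_commute: "pdiff a (pdiff b p) = pdiff b (pdiff a p)"
  by (rule poly_mapping_eqI) (simp add: pdiff.rep_eq add_mset_commute algebra_simps)

lemma finite_pdiff: "finite {n. pdiff n p \<noteq> 0}"
proof (rule finite_subset)
  show "{n. pdiff n p \<noteq> 0} \<subseteq> (\<Union>M\<in>Poly_Mapping.keys p. set_mset M)"
  proof clarify
    fix n
    assume "pdiff n p \<noteq> 0"
    then obtain M where "Poly_Mapping.lookup (pdiff n p) M \<noteq> 0"
      using poly_mapping_eqI[of "pdiff n p" 0] by auto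
    then have "add_mset n M \<in> Poly_Mapping.keys p"
      by (simp add: pdiff.rep_eq in_keys_iff)
    then show "n \<in> (\<Union>M\<in>Poly_Mapping.keys p. set_mset M)"
      by (rule UN_I) simp
  qed
qed simp

text \<open>The operator \<open>\<Sum>\<^sub>a f\<^sub>a \<circ> \<partial>\<^sub>a\<close>. The sum is infinite, but only finitely many \<open>\<partial>\<^sub>a p\<close> are nonzero for a given
  polynomial \<open>p\<close>.\<close>

definition pdiff_sum_op :: "(int \<Rightarrow> 'a::field_char_0 mpoly \<Rightarrow> 'a mpoly) \<Rightarrow> 'a mpoly \<Rightarrow> 'a mpoly" where
  "pdiff_sum_op f p = Sum_any (\<lambda>a. f a (pdiff a p))"

lemma pdiff_sum_op_eq:
  assumes "\<And>a. f a 0 = 0" "finite A" "\<And>a. a \<notin> A \<Longrightarrow> pdiff a p = 0"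
  shows "pdiff_sum_op f p = (\<Sum>a\<in>A. f a (pdiff a p))"
  unfolding pdiff_sum_op_def
proof (rule Sum_any.expand_superset)
  show "{a. f a (pdiff a p) \<noteq> 0} \<subseteq> A"
  proof clarify
    fix a
    assume "f a (pdiff a p) \<noteq> 0"
    then have "pdiff a p \<noteq> 0"
      using assms(1) by metis
    then show "a \<in> A"
      using assms(3) by blast
  qed
qed (rule assms(2))

locale additive_family =
  fixes f :: "int \<Rightarrow> 'a::field_char_0 mpoly \<Rightarrow> 'a mpoly"
  assumes f_add: "f a (p + q) = f a p + f a q"
begin

lemma f_zero: "f a 0 = 0"
  using f_add[of a 0 0] by simp

lemma op_add: "pdiff_sum_op f (p + q) = pdiff_sum_op f p + pdiff_sum_op f q"
proof -
  let ?A = "{n. pdiff n p \<noteq> 0} \<union> {n. pdiff n q \<noteq> 0}"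
  have eq: "pdiff_sum_op f r = (\<Sum>a\<in>?A. f a (pdiff a r))" if "\<And>a. a \<notin> ?A \<Longrightarrow> pdiff a r = 0" for r
    by (rule pdiff_sum_op_eq) (simp_all add: f_zero finite_pdiff that)
  have "pdiff_sum_op f p = (\<Sum>a\<in>?A. f a (pdiff a p))" "pdiff_sum_op f q = (\<Sum>a\<in>?A. f a (pdiff a q))"
    "pdiff_sum_op f (p + q) = (\<Sum>a\<in>?A. f a (pdiff a (p + q)))"
    by (rule eq, simp add: pdiff_add)+
  then show ?thesis
    by (simp add: pdiff_add f_add sum.distrib)
qed

lemma op_const: "pdiff_sum_op f (pconst c) = 0"
  by (simp add: pdiff_sum_op_def pdiff_const f_zero)

lemma op_var: "pdiff_sum_op f (pvar n * p) = f n p + pdiff_sum_op (\<lambda>a q. f a (pvar n * q)) p"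
proof -
  let ?A = "insert n {n. pdiff n p \<noteq> 0}"
  have "pdiff_sum_op f (pvar n * p) = (\<Sum>a\<in>?A. f a (pdiff a (pvar n * p)))"
    by (rule pdiff_sum_op_eq) (auto simp: pdiff_var finite_pdiff f_zero)
  also have "\<dots> = (\<Sum>a\<in>?A. (if a = n then f n p else 0) + f a (pvar n * pdiff a p))"
    by (rule sum.cong) (auto simp: pdiff_var f_add f_zero)
  also have "\<dots> = f n p + (\<Sum>a\<in>?A. f a (pvar n * pdiff a p))"
    by (simp add: sum.distrib finite_pdiff)
  also have "(\<Sum>a\<in>?A. f a (pvar n * pdiff a p)) = pdiff_sum_op (\<lambda>a q. f a (pvar n * q)) p"
    by (rule pdiff_sum_op_eq[symmetric]) (auto simp: finite_pdiff f_zero)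
  finally show ?thesis .
qed

end

text \<open>The derivation with \<open>X\<^sub>n \<mapsto> X\<^sub>k\<^sub>+\<^sub>n\<close>.\<close>

definition shift_op :: "int \<Rightarrow> 'a::field_char_0 mpoly \<Rightarrow> 'a mpoly" where
  "shift_op k = pdiff_sum_op (\<lambda>a q. pvar (k + a) * q)"

interpretation shift: additive_family "\<lambda>a q. pvar (k + a) * q" for k
  by unfold_locales (rule distrib_left)

lemma shift_op_eq:
  "finite A \<Longrightarrow> (\<And>a. a \<notin> A \<Longrightarrow> pdiff a p = 0) \<Longrightarrow> shift_op k p = (\<Sum>a\<in>A. pvar (k + a) * pdiff a p)"
  unfolding shift_op_def by (rule pdiff_sum_op_eq) simp_all

lemma shift_op_add: "shift_op k (p + q) = shift_op k p + shift_op k q"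
  unfolding shift_op_def by (rule shift.op_add)

lemma shift_op_zero: "shift_op k 0 = 0"
  using shift_op_add[of k 0 0] by simp

lemma shift_op_const: "shift_op k (pconst c) = 0"
  unfolding shift_op_def by (rule shift.op_const)

lemma shift_op_var: "shift_op k (pvar n * p) = pvar (k + n) * p + pvar n * shift_op k p"
proof -
  let ?A = "{a. pdiff a p \<noteq> 0}"
  have "pdiff_sum_op (\<lambda>a q. pvar (k + a) * (pvar n * q)) p = (\<Sum>a\<in>?A. pvar (k + a) * (pvar n * pdiff a p))"
    by (rule pdiff_sum_op_eq) (simp_all add: finite_pdiff)
  also have "\<dots> = (\<Sum>a\<in>?A. pvar n * (pvar (k + a) * pdiff a p))"
    by (intro sum.cong refl mult.left_commute)
  also have "\<dots> = pvar n * (\<Sum>a\<in>?A. pvar (k + a) * pdiff a p)"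
    by (rule sum_distrib_left[symmetric])
  also have "(\<Sum>a\<in>?A. pvar (k + a) * pdiff a p) = shift_op k p"
    by (rule shift_op_eq[symmetric]) (simp_all add: finite_pdiff)
  finally have "pdiff_sum_op (\<lambda>a q. pvar (k + a) * (pvar n * q)) p = pvar n * shift_op k p" .
  moreover have "shift_op k (pvar n * p) = pvar (k + n) * p + pdiff_sum_op (\<lambda>a q. pvar (k + a) * (pvar n * q)) p"
    unfolding shift_op_def by (rule shift.op_var)
  ultimately show ?thesis
    by (simp only:)
qed

lemma shift_op_const_mult: "shift_op k (pconst c * p) = pconst c * shift_op k p"
  by (induction p rule: mpoly_induct)
    (simp_all add: shift_op_var shift_op_const shift_op_add distrib_left mult.left_commute[of "pconst c" "pvar _"]
      flip: pconst_simps(4))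

lemma pdiff_shift_op: "pdiff k (shift_op j p) = shift_op j (pdiff k p) + pdiff (k - j) p"
proof -
  let ?A = "insert (k - j) {a. pdiff a p \<noteq> 0}"
  have "pdiff a (pdiff k p) = 0" if "a \<notin> ?A" for a
    using that by (simp add: pdiff_commute[of a k] pdiff_zero)
  then have "shift_op j (pdiff k p) = (\<Sum>a\<in>?A. pvar (j + a) * pdiff k (pdiff a p))"
    by (subst shift_op_eq[of ?A]) (simp_all add: finite_pdiff pdiff_commute[of k])
  moreover have "pdiff k (shift_op j p)
      = (\<Sum>a\<in>?A. (if a = k - j then pdiff (k - j) p else 0) + pvar (j + a) * pdiff k (pdiff a p))"
    by (subst shift_op_eq[of ?A])
      (auto simp: finite_pdiff pdiff_sum pdiff_var intro!: sum.cong)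
  ultimately show ?thesis
    by (simp add: sum.distrib finite_pdiff)
qed

text \<open>The operators by which \<open>h \<otimes> t\<^sup>m\<close> and \<open>e \<otimes> t\<^sup>m\<close> act: \<open>\<lambda> \<delta>\<^sub>m\<^sub>,\<^sub>0 - 2 \<Sum>\<^sub>a X\<^sub>m\<^sub>+\<^sub>a \<partial>\<^sub>a\<close> and
  \<open>\<lambda> \<partial>\<^sub>-\<^sub>m - \<Sum>\<^sub>n\<^sub>,\<^sub>a X\<^sub>m\<^sub>+\<^sub>n\<^sub>+\<^sub>a \<partial>\<^sub>a \<partial>\<^sub>n\<close>. They are determined by the values on constants and by the
  commutators with multiplication by \<open>X\<^sub>n\<close>, which come from
  \<open>[h \<otimes> t\<^sup>m, f \<otimes> t\<^sup>n] = - 2 f \<otimes> t\<^sup>m\<^sup>+\<^sup>n\<close> and \<open>[e \<otimes> t\<^sup>m, f \<otimes> t\<^sup>n] = h \<otimes> t\<^sup>m\<^sup>+\<^sup>n\<close>.\<close>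

definition hop :: "'a::field_char_0 \<Rightarrow> int \<Rightarrow> 'a mpoly \<Rightarrow> 'a mpoly" where
  "hop lam m p = (if m = 0 then pconst lam * p else 0) - 2 * shift_op m p"

definition eop :: "'a::field_char_0 \<Rightarrow> int \<Rightarrow> 'a mpoly \<Rightarrow> 'a mpoly" where
  "eop lam m p = pconst lam * pdiff (- m) p - pdiff_sum_op (\<lambda>n. shift_op (m + n)) p"

interpretation shift_shift: additive_family "\<lambda>n. shift_op (m + n)" for m
  by unfold_locales (rule shift_op_add)

lemma hop_add: "hop lam m (p + q) = hop lam m p + hop lam m q"
  by (simp add: hop_def shift_op_add algebra_simps)

lemma hop_const: "hop lam m (pconst c) = (if m = 0 then pconst (lam * c) else 0)"
  by (simp add: hop_def shift_op_const pconst_simps)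

lemma hop_var: "hop lam m (pvar n * p) = pvar n * hop lam m p - 2 * (pvar (m + n) * p)"
  unfolding hop_def shift_op_var by (simp add: algebra_simps)

lemma hop_const_mult: "hop lam m (pconst c * p) = pconst c * hop lam m p"
  unfolding hop_def shift_op_const_mult by (simp add: algebra_simps)

lemma eop_eq:
  assumes "finite A" "\<And>a. a \<notin> A \<Longrightarrow> pdiff a p = 0"
  shows "eop lam m p = pconst lam * pdiff (- m) p - (\<Sum>n\<in>A. shift_op (m + n) (pdiff n p))"
  unfolding eop_def using assms by (subst pdiff_sum_op_eq[of _ A]) (simp_all add: shift_op_zero)

lemma eop_add: "eop lam m (p + q) = eop lam m p + eop lam m q"
  unfolding eop_def shift_shift.op_add pdiff_add by (simp add: distrib_left)

lemma eop_const: "eop lam m (pconst c) = 0"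
  by (simp add: eop_def shift_shift.op_const pdiff_const)

lemma eop_var: "eop lam m (pvar n * p) = pvar n * eop lam m p + hop lam (m + n) p"
proof -
  let ?A = "{a. pdiff a p \<noteq> 0}"
  have "pdiff_sum_op (\<lambda>a q. shift_op (m + a) (pvar n * q)) p
      = (\<Sum>a\<in>?A. shift_op (m + a) (pvar n * pdiff a p))"
    by (rule pdiff_sum_op_eq) (simp_all add: shift_op_zero finite_pdiff)
  also have "\<dots> = (\<Sum>a\<in>?A. pvar ((m + n) + a) * pdiff a p) + pvar n * (\<Sum>a\<in>?A. shift_op (m + a) (pdiff a p))"
    by (simp add: shift_op_var sum.distrib sum_distrib_left add_ac)
  also have "(\<Sum>a\<in>?A. pvar ((m + n) + a) * pdiff a p) = shift_op (m + n) p"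
    by (rule shift_op_eq[symmetric]) (simp_all add: finite_pdiff)
  also have "(\<Sum>a\<in>?A. shift_op (m + a) (pdiff a p)) = pdiff_sum_op (\<lambda>n. shift_op (m + n)) p"
    by (rule pdiff_sum_op_eq[symmetric]) (simp_all add: shift_op_zero finite_pdiff)
  finally have "pdiff_sum_op (\<lambda>n. shift_op (m + n)) (pvar n * p)
      = 2 * shift_op (m + n) p + pvar n * pdiff_sum_op (\<lambda>n. shift_op (m + n)) p"
    by (simp add: shift_shift.op_var)
  moreover have "- m = n \<longleftrightarrow> m + n = 0"
    by auto
  ultimately show ?thesis
    unfolding eop_def hop_def pdiff_var by (simp add: distrib_left right_diff_distrib mult.left_commute)
qed

lemma eop_const_mult: "eop lam m (pconst c * p) = pconst c * eop lam m p"
  by (induction p rule: mpoly_induct)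
    (simp_all add: eop_var eop_const eop_add hop_const_mult distrib_left
      mult.left_commute[of "pconst c" "pvar _"] flip: pconst_simps(4))

lemma op_linear:
  "eop lam m 0 = 0" "eop lam m (- p) = - eop lam m p" "eop lam m (p - q) = eop lam m p - eop lam m q"
  "eop lam m (2 * p) = 2 * eop lam m p"
  "hop lam m 0 = 0" "hop lam m (- p) = - hop lam m p" "hop lam m (p - q) = hop lam m p - hop lam m q"
  "hop lam m (2 * p) = 2 * hop lam m p"
  using eop_const_mult[of lam m 0 p] eop_const_mult[of lam m "- 1" p] eop_const_mult[of lam m "2" p]
    eop_const_mult[of lam m "- 1" q] eop_add[of lam m p "- q"]
    hop_const_mult[of lam m 0 p] hop_const_mult[of lam m "- 1" p] hop_const_mult[of lam m "2" p]
    hop_const_mult[of lam m "- 1" q] hop_add[of lam m p "- q"]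
  by (simp_all add: pconst_simps)

text \<open>The remaining relations of the loop algebra hold without any computation with derivatives: the
  difference of the two sides vanishes on constants and commutes with multiplication by each \<open>X\<^sub>n\<close>.\<close>

lemma hop_hop: "hop lam m (hop lam k p) = hop lam k (hop lam m p)"
proof (induction p rule: mpoly_induct)
  case (var n p)
  then show ?case
    unfolding hop_var op_linear by (simp add: add_ac)
qed (simp_all add: hop_const hop_add op_linear)

lemma hop_eop: "hop lam m (eop lam k p) = eop lam k (hop lam m p) + 2 * eop lam (m + k) p"
proof (induction p rule: mpoly_induct)
  case (var n p)
  then show ?case
    unfolding hop_var eop_var hop_add eop_add op_linear hop_hop[of lam "k + n"]
    by (simp add: algebra_simps)
qed (simp_all add: hop_const eop_const hop_add eop_add op_linear distrib_left)

lemma eop_eop: "eop lam m (eop lam k p) = eop lam k (eop lam m p)"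
proof (induction p rule: mpoly_induct)
  case (var n p)
  have "hop lam (m + n) (eop lam k p) = eop lam k (hop lam (m + n) p) + 2 * eop lam (m + n + k) p"
    "hop lam (k + n) (eop lam m p) = eop lam m (hop lam (k + n) p) + 2 * eop lam (m + n + k) p"
    using hop_eop[of lam "m + n" k p] hop_eop[of lam "k + n" m p] by (simp_all add: add_ac)
  with var show ?case
    by (simp add: eop_var eop_add)
qed (simp_all add: eop_const eop_add op_linear)

text \<open>The commutator depends on \<open>k - m\<close> only. This is what \<open>eop_kernel_pdiff\<close> exploits.\<close>

lemma pdiff_eop:
  assumes "finite A" "\<And>a. a \<notin> A \<Longrightarrow> pdiff a p = 0"
  shows "pdiff k (eop lam m p) = eop lam m (pdiff k p) - (\<Sum>n\<in>A. pdiff (k - m - n) (pdiff n p))"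
proof -
  have "pdiff a (pdiff k p) = 0" if "a \<notin> A" for a
    using assms(2)[OF that] by (simp add: pdiff_commute[of a k] pdiff_zero)
  then have "eop lam m (pdiff k p)
      = pconst lam * pdiff (- m) (pdiff k p) - (\<Sum>n\<in>A. shift_op (m + n) (pdiff n (pdiff k p)))"
    by (rule eop_eq[OF assms(1)])
  moreover have "pdiff k (eop lam m p) = pconst lam * pdiff (- m) (pdiff k p)
      - (\<Sum>n\<in>A. shift_op (m + n) (pdiff n (pdiff k p)) + pdiff (k - m - n) (pdiff n p))"
    by (simp add: eop_eq[OF assms] pdiff_diff pdiff_const_mult pdiff_sum pdiff_shift_op
        pdiff_commute[of k] diff_diff_eq)
  ultimately show ?thesis
    by (simp add: sum.distrib)
qed

text \<open>Bounds are strict so that differentiation lowers every positive bound by one: constants have degree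
  below \<open>1\<close>, and only the zero polynomial has degree below \<open>0\<close>.\<close>

definition pdeg_less :: "nat \<Rightarrow> 'a::field_char_0 mpoly \<Rightarrow> bool" where
  "pdeg_less d p \<longleftrightarrow> (\<forall>M. d \<le> size M \<longrightarrow> Poly_Mapping.lookup p M = 0)"

lemma pdeg_less_zero: "pdeg_less 0 p \<longleftrightarrow> p = 0"
  by (auto simp: pdeg_less_def intro: poly_mapping_eqI)

lemma pdeg_less_ex: "\<exists>d. pdeg_less d p"
proof
  show "pdeg_less (Suc (\<Sum>M\<in>Poly_Mapping.keys p. size M)) p"
    unfolding pdeg_less_def
  proof (intro allI impI)
    fix M :: "int multiset"
    assume "Suc (\<Sum>M\<in>Poly_Mapping.keys p. size M) \<le> size M"
    then have "M \<notin> Poly_Mapping.keys p"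
      using member_le_sum[of M "Poly_Mapping.keys p" size] by auto
    then show "Poly_Mapping.lookup p M = 0"
      by (simp add: in_keys_iff)
  qed
qed

lemma pdeg_less_pdiff: "pdeg_less (Suc d) p \<Longrightarrow> pdeg_less d (pdiff n p)"
  by (simp add: pdeg_less_def pdiff.rep_eq)

lemma pdeg_less_pvar: "pdeg_less d p \<Longrightarrow> pdeg_less (Suc d) (pvar n * p)"
  by (auto simp: pdeg_less_def lookup_pvar_mult size_Diff_singleton)

lemma pdeg_less_sum: "(\<And>i. i \<in> A \<Longrightarrow> pdeg_less d (g i)) \<Longrightarrow> pdeg_less d (sum g A)"
  by (simp add: pdeg_less_def lookup_sum)

lemma pdeg_less_shift_op:
  assumes "pdeg_less d p"
  shows "pdeg_less d (shift_op k p)"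
proof (cases d)
  case 0
  with assms show ?thesis
    by (simp add: pdeg_less_zero shift_op_zero)
next
  case (Suc d')
  with assms have "pdeg_less d (\<Sum>a | pdiff a p \<noteq> 0. pvar (k + a) * pdiff a p)"
    by (auto intro!: pdeg_less_sum pdeg_less_pvar pdeg_less_pdiff)
  then show ?thesis
    by (subst shift_op_eq[of "{a. pdiff a p \<noteq> 0}"]) (simp_all add: finite_pdiff)
qed

lemma pdeg_less_eop:
  assumes "pdeg_less (Suc d) p"
  shows "pdeg_less d (eop lam m p)"
proof -
  have "pdeg_less d (\<Sum>n | pdiff n p \<noteq> 0. shift_op (m + n) (pdiff n p))"
    by (intro pdeg_less_sum pdeg_less_shift_op pdeg_less_pdiff assms)
  moreover have "pdeg_less d (pdiff (- m) p)"
    by (rule pdeg_less_pdiff[OF assms])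
  ultimately show ?thesis
    by (subst eop_eq[of "{n. pdiff n p \<noteq> 0}"])
      (simp_all add: finite_pdiff pdeg_less_def lookup_minus lookup_pconst_mult)
qed

text \<open>The common kernel of all \<open>e \<otimes> t\<^sup>m\<close> is stable under all \<open>\<partial>\<^sub>k\<close>. It suffices that the commutator of
  \<open>\<partial>\<^sub>k\<close> and \<open>e \<otimes> t\<^sup>m\<close> kills \<open>p\<close>. As it depends on \<open>k - m\<close> only, \<open>k\<close> may be replaced by an index \<open>j\<close> whose variable
  does not occur in \<open>p\<close>; then both terms of the commutator vanish.\<close>

lemma eop_kernel_pdiff:
  assumes "\<And>m. eop lam m p = 0"
  shows "eop lam m (pdiff k p) = 0"
proof -
  let ?A = "{n. pdiff n p \<noteq> 0}"
  have "infinite (- ?A)"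
    using finite_pdiff[of p] by (simp add: Compl_eq_Diff_UNIV)
  then obtain j where "j \<in> - ?A"
    using infinite_imp_nonempty by blast
  then have j: "pdiff j p = 0"
    by simp
  have A: "finite ?A" "\<And>a. a \<notin> ?A \<Longrightarrow> pdiff a p = 0"
    by (simp_all add: finite_pdiff)
  have "(\<Sum>n\<in>?A. pdiff (j - (j - (k - m)) - n) (pdiff n p)) = 0"
    using pdiff_eop[OF A, of j lam "j - (k - m)"] by (simp only: j assms pdiff_zero op_linear) simp
  moreover have "j - (j - (k - m)) = k - m"
    by simp
  ultimately show ?thesis
    using pdiff_eop[OF A, of k lam m] by (simp only: assms pdiff_zero) simp
qed

text \<open>By induction on the degree, the derivatives of \<open>p\<close> are constants. So the second order part of
  \<open>e \<otimes> t\<^sup>m\<close> kills \<open>p\<close>, and what remains is \<open>\<lambda> \<partial>\<^sub>-\<^sub>m p = 0\<close>.\<close>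

lemma eop_kernel:
  assumes "lam \<noteq> 0" "\<And>m. eop lam m p = 0"
  shows "pdiff n p = 0"
proof -
  obtain d where "pdeg_less d p"
    using pdeg_less_ex by blast
  then show ?thesis
    using assms(2)
  proof (induction d arbitrary: p n)
    case 0
    then show ?case
      by (simp add: pdeg_less_zero pdiff_zero)
  next
    case (Suc d)
    have "pdiff a (pdiff b p) = 0" for a b
      using Suc.IH[OF pdeg_less_pdiff[OF Suc.prems(1)]] eop_kernel_pdiff[OF Suc.prems(2)] by blast
    then have "shift_op k (pdiff b p) = 0" for k b
      by (subst shift_op_eq[of "{}"]) simp_all
    then have "eop lam (- n) p = pconst lam * pdiff n p"
      by (subst eop_eq[of "{n. pdiff n p \<noteq> 0}"]) (simp_all add: finite_pdiff)
    then have "pconst lam * pdiff n p = 0"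
      using Suc.prems(2) by simp
    then have "pconst (inverse lam) * (pconst lam * pdiff n p) = 0"
      by simp
    then show ?case
      using assms(1) by (simp add: mult.assoc[symmetric] pconst_simps(2) flip: pconst_simps(4))
  qed
qed

lemma pdiff_zero_imp_const:
  assumes "\<And>n. pdiff n p = 0"
  shows "p = pconst (Poly_Mapping.lookup p {#})"
proof (rule poly_mapping_eqI)
  fix M
  show "Poly_Mapping.lookup p M = Poly_Mapping.lookup (pconst (Poly_Mapping.lookup p {#})) M"
  proof (cases M)
    case (add n N)
    have "Poly_Mapping.lookup (pdiff n p) N = 0"
      by (simp add: assms)
    then have "Poly_Mapping.lookup p (add_mset n N) = 0"
      by (simp add: pdiff.rep_eq del: of_nat_Suc)
    then show ?thesis
      by (simp add: add pconst_def lookup_single)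
  qed (simp add: pconst_def)
qed

lemma eop_reduce_to_const:
  assumes "lam \<noteq> 0" "p \<noteq> 0"
  shows "\<exists>ms c. c \<noteq> 0 \<and> fold (eop lam) ms p = pconst c"
proof -
  obtain d where "pdeg_less d p"
    using pdeg_less_ex by blast
  then show ?thesis
    using assms(2)
  proof (induction d arbitrary: p)
    case 0
    then show ?case
      by (simp add: pdeg_less_zero)
  next
    case (Suc d)
    show ?case
    proof (cases "\<forall>m. eop lam m p = 0")
      case True
      then have p: "p = pconst (Poly_Mapping.lookup p {#})"
        using eop_kernel[OF assms(1)] by (intro pdiff_zero_imp_const) blast
      with Suc.prems(2) have "Poly_Mapping.lookup p {#} \<noteq> 0"
        by (metis pconst_simps(1))
      then show ?thesis
        using p by (intro exI[of _ "[]"] exI[of _ "Poly_Mapping.lookup p {#}"]) simp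
    next
      case False
      then obtain m where "eop lam m p \<noteq> 0"
        by blast
      then obtain ms c where "c \<noteq> 0" "fold (eop lam) ms (eop lam m p) = pconst c"
        using Suc.IH[OF pdeg_less_eop[OF Suc.prems(1)]] by blast
      then show ?thesis
        by (intro exI[of _ "m # ms"]) auto
    qed
  qed
qed

section \<open>The enveloping algebra acts on polynomials\<close>

lemma sl2_bracket_zero: "sl2_bracket x 0 = 0" "sl2_bracket 0 x = 0"
  by (transfer; simp add: vec_eq_iff matrix_matrix_mult_def)+

lemma loop_bracket_elt:
  "loop_bracket (loop_elt x m) (loop_elt y n) = loop_elt (sl2_bracket x y) (m + n)"
  by (cases "x = 0"; cases "y = 0") (simp_all add: loop_bracket_def sl2_bracket_zero)

lemma loop_scale_elt: "loop_scale c (loop_elt x n) = loop_elt (sl2_scale c x) n"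
  by (rule poly_mapping_eqI) (simp add: loop_scale.rep_eq lookup_single when_def sl2_scale_zero)

lemma uea_scalar_add: "uea_scalar (c + d) = uea_scalar c + uea_scalar d"
  by transfer (rule uea_rel_refl, simp add: free_scalar_def single_add)

lemma uea_scalar_mult: "uea_scalar (c * d) = uea_scalar c * uea_scalar d"
  by transfer (rule uea_rel_refl, simp add: free_scalar_def mult_single)

lemma uea_scalar_one: "uea_scalar 1 = 1"
  by transfer (rule uea_rel_refl, simp add: free_scalar_def)

lemma uea_scalar_zero: "uea_scalar 0 = 0"
  using uea_scalar_add[of 0 0] by simp

lemma uea_inc_scale: "uea_inc (loop_scale c x) = uea_scalar c * uea_inc x"
  by transfer (simp add: uea_rel_def uea_ideal.rel_scale)

lemma trace_2: "trace A = A $ 1 $ 1 + A $ 2 $ (2 :: 2)"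
  by (simp add: trace_def sum_2)

lemma sl2_decompose:
  "x = sl2_scale (sl2_mat x $ 1 $ 2) sl2_e + sl2_scale (sl2_mat x $ 1 $ 1) sl2_h
     + sl2_scale (sl2_mat x $ 2 $ 1) sl2_f"
  by transfer (auto simp: vec_eq_iff forall_2 trace_2 eq_neg_iff_add_eq_0 add.commute)

definition sl2_op :: "'a::field_char_0 \<Rightarrow> int \<Rightarrow> 'a sl2 \<Rightarrow> 'a mpoly \<Rightarrow> 'a mpoly" where
  "sl2_op lam n x p = pconst (sl2_mat x $ 1 $ 2) * eop lam n p
     + pconst (sl2_mat x $ 1 $ 1) * hop lam n p + pconst (sl2_mat x $ 2 $ 1) * (pvar n * p)"

lemma sl2_op_basis:
  "sl2_op lam n sl2_e p = eop lam n p" "sl2_op lam n sl2_h p = hop lam n p"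
  "sl2_op lam n sl2_f p = pvar n * p"
  by (simp_all add: sl2_op_def sl2_e.rep_eq sl2_h.rep_eq sl2_f.rep_eq pconst_simps)

lemma sl2_op_add: "sl2_op lam n (x + y) p = sl2_op lam n x p + sl2_op lam n y p"
  by (simp add: sl2_op_def plus_sl2.rep_eq pconst_simps distrib_right)

lemma sl2_op_scale: "sl2_op lam n (sl2_scale c x) p = pconst c * sl2_op lam n x p"
  by (simp add: sl2_op_def sl2_scale.rep_eq pconst_simps distrib_left mult.assoc)

lemma sl2_op_add_right: "sl2_op lam n x (p + q) = sl2_op lam n x p + sl2_op lam n x q"
  by (simp add: sl2_op_def eop_add hop_add distrib_left)

lemma sl2_op_const_mult: "sl2_op lam n x (pconst c * p) = pconst c * sl2_op lam n x p"
  by (simp add: sl2_op_def eop_const_mult hop_const_mult distrib_left mult.left_commute)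

text \<open>The coordinates of a traceless matrix in the basis \<open>e, h, f\<close> are its entries \<open>(1,2)\<close>, \<open>(1,1)\<close> and \<open>(2,1)\<close>.\<close>

lemma sl2_op_bracket:
  "sl2_op lam (m + n) (sl2_bracket x y) p
     = sl2_op lam m x (sl2_op lam n y p) - sl2_op lam n y (sl2_op lam m x p)"
proof -
  let ?A = "sl2_mat x" and ?B = "sl2_mat y"
  have tr: "?A $ 2 $ 2 = - ?A $ 1 $ 1" "?B $ 2 $ 2 = - ?B $ 1 $ 1"
    using sl2_mat[of x] sl2_mat[of y] by (simp_all add: trace_2 eq_neg_iff_add_eq_0 add.commute)
  have br: "sl2_mat (sl2_bracket x y) $ 1 $ 2 = 2 * (?A $ 1 $ 1 * ?B $ 1 $ 2 - ?A $ 1 $ 2 * ?B $ 1 $ 1)"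
    "sl2_mat (sl2_bracket x y) $ 1 $ 1 = ?A $ 1 $ 2 * ?B $ 2 $ 1 - ?A $ 2 $ 1 * ?B $ 1 $ 2"
    "sl2_mat (sl2_bracket x y) $ 2 $ 1 = 2 * (?A $ 2 $ 1 * ?B $ 1 $ 1 - ?A $ 1 $ 1 * ?B $ 2 $ 1)"
    by (simp_all add: sl2_bracket.rep_eq matrix_matrix_mult_def sum_2 tr algebra_simps)
  define E where "E = eop lam (m + n) p"
  define H where "H = hop lam (m + n) p"
  have rel: "eop lam n (eop lam m p) = eop lam m (eop lam n p)"
    "hop lam n (hop lam m p) = hop lam m (hop lam n p)"
    "hop lam m (eop lam n p) = eop lam n (hop lam m p) + 2 * E"
    "hop lam n (eop lam m p) = eop lam m (hop lam n p) + 2 * E"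
    "eop lam m (pvar n * p) = pvar n * eop lam m p + H"
    "eop lam n (pvar m * p) = pvar m * eop lam n p + H"
    "hop lam m (pvar n * p) = pvar n * hop lam m p - 2 * (pvar (m + n) * p)"
    "hop lam n (pvar m * p) = pvar m * hop lam n p - 2 * (pvar (m + n) * p)"
    using hop_eop[of lam m n p] hop_eop[of lam n m p] eop_var[of lam m n p] eop_var[of lam n m p]
      hop_var[of lam m n p] hop_var[of lam n m p]
    by (simp_all add: eop_eop[of lam n] hop_hop[of lam n] E_def H_def add.commute)
  show ?thesis
    unfolding sl2_op_def br eop_add hop_add eop_const_mult hop_const_mult rel
    unfolding E_def[symmetric] H_def[symmetric] pconst_simps
    by (simp add: algebra_simps)
qed

definition loop_op :: "'a::field_char_0 \<Rightarrow> 'a loop \<Rightarrow> 'a mpoly \<Rightarrow> 'a mpoly" where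
  "loop_op lam x p = lin_ext (\<lambda>n y. sl2_op lam n y p) x"

interpretation loop_op: additive_on_coefficients "\<lambda>n y. sl2_op lam n y p" for lam p
  by unfold_locales (rule sl2_op_add)

lemma loop_op_add: "loop_op lam (x + y) p = loop_op lam x p + loop_op lam y p"
  and loop_op_zero: "loop_op lam 0 p = 0"
  and loop_op_elt: "loop_op lam (loop_elt z n) p = sl2_op lam n z p"
  by (simp_all add: loop_op_def loop_op.lin_ext_add loop_op.lin_ext_zero loop_op.lin_ext_single)

lemma loop_op_sum: "loop_op lam (sum g A) p = (\<Sum>i\<in>A. loop_op lam (g i) p)"
  by (induction A rule: infinite_finite_induct) (simp_all add: loop_op_zero loop_op_add)

lemma loop_scale_add: "loop_scale c (x + y) = loop_scale c x + loop_scale c y"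
  by (rule loop.scale_right_distrib)

lemma loop_op_scale: "loop_op lam (loop_scale c x) p = pconst c * loop_op lam x p"
  by (induction x rule: poly_mapping_single_induct)
    (simp_all add: loop_scale_elt loop_op_elt sl2_op_scale loop_scale_add loop_op_add distrib_left)

lemma loop_op_add_right: "loop_op lam x (p + q) = loop_op lam x p + loop_op lam x q"
  by (simp add: loop_op_def lin_ext_def sl2_op_add_right sum.distrib)

lemma loop_op_const_mult: "loop_op lam x (pconst c * p) = pconst c * loop_op lam x p"
  by (simp add: loop_op_def lin_ext_def sl2_op_const_mult sum_distrib_left)

lemma loop_op_bracket:
  "loop_op lam (loop_bracket x y) p = loop_op lam x (loop_op lam y p) - loop_op lam y (loop_op lam x p)"
proof -
  let ?X = "\<lambda>m. sl2_op lam m (Poly_Mapping.lookup x m)" and ?Y = "\<lambda>n. sl2_op lam n (Poly_Mapping.lookup y n)"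
  have X: "loop_op lam x q = (\<Sum>m\<in>Poly_Mapping.keys x. ?X m q)" and Y: "loop_op lam y q = (\<Sum>n\<in>Poly_Mapping.keys y. ?Y n q)" for q
    by (simp_all add: loop_op_def lin_ext_def)
  have zero: "sl2_op lam n z 0 = 0" for n z
    using sl2_op_add_right[of lam n z 0 0] by simp
  have sum: "sl2_op lam n z (sum g A) = (\<Sum>i\<in>A. sl2_op lam n z (g i))" for n z A and g :: "int \<Rightarrow> 'a mpoly"
    by (induction A rule: infinite_finite_induct) (simp_all add: zero sl2_op_add_right)
  have "loop_op lam y (loop_op lam x p)
      = (\<Sum>m\<in>Poly_Mapping.keys x. \<Sum>n\<in>Poly_Mapping.keys y. ?Y n (?X m p))"
    unfolding X Y sum by (rule sum.swap)
  then show ?thesis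
    by (simp add: loop_bracket_def loop_op_sum loop_op_elt sl2_op_bracket sum_subtractf)
      (simp add: X Y sum)
qed

primrec letters :: "'b fword \<Rightarrow> 'b list" where
  "letters (Fword xs) = xs"

lemma letters_plus: "letters (u + w) = letters u @ letters w"
  by (cases u; cases w) simp

lemma letters_zero: "letters 0 = []"
  by (simp add: zero_fword_def)

definition free_op :: "'a::field_char_0 \<Rightarrow> 'a free_alg \<Rightarrow> 'a mpoly \<Rightarrow> 'a mpoly" where
  "free_op lam q p = lin_ext (\<lambda>w c. pconst c * foldr (loop_op lam) (letters w) p) q"

interpretation free_op: additive_on_coefficients "\<lambda>w c. pconst c * foldr (loop_op lam) (letters w) p" for lam p
  by unfold_locales (simp add: pconst_simps distrib_right)

lemma free_op_simps:
  "free_op lam (q + r) p = free_op lam q p + free_op lam r p"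
  "free_op lam (q - r) p = free_op lam q p - free_op lam r p"
  "free_op lam 0 p = 0"
  "free_op lam (Poly_Mapping.single w c) p = pconst c * foldr (loop_op lam) (letters w) p"
  by (simp_all add: free_op_def free_op.lin_ext_add free_op.lin_ext_diff free_op.lin_ext_zero
      free_op.lin_ext_single)

lemma foldr_loop_op:
  "foldr (loop_op lam) xs (p + q) = foldr (loop_op lam) xs p + foldr (loop_op lam) xs q"
  "foldr (loop_op lam) xs (pconst c * p) = pconst c * foldr (loop_op lam) xs p"
  by (induction xs) (simp_all add: loop_op_add_right loop_op_const_mult)

lemma free_op_add_right: "free_op lam q (p + r) = free_op lam q p + free_op lam q r"
  by (simp add: free_op_def lin_ext_def foldr_loop_op distrib_left sum.distrib)

lemma free_op_mult: "free_op lam (q * r) p = free_op lam q (free_op lam r p)"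
proof (induction q rule: poly_mapping_single_induct)
  case (single w c)
  show ?case
  proof (induction r rule: poly_mapping_single_induct)
    case (single w' c')
    show ?case
      by (simp add: mult_single free_op_simps letters_plus foldr_loop_op pconst_simps mult.assoc)
  qed (simp add: distrib_left free_op_simps(1) free_op_add_right)
qed (simp add: distrib_right free_op_simps)

lemma free_op_gen: "free_op lam (free_gen x) p = loop_op lam x p"
  by (simp add: free_gen_def free_op_simps pconst_simps)

lemma free_op_scalar: "free_op lam (free_scalar c) p = pconst c * p"
  by (simp add: free_scalar_def free_op_simps letters_zero)

text \<open>The generators of the ideal act by zero because the operators of the loop algebra depend linearly on
  its elements and respect the bracket.\<close>

lemma free_op_ideal: "q \<in> uea_ideal \<Longrightarrow> free_op lam q p = 0"
proof (induction arbitrary: p rule: uea_ideal.induct)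
  case (mult_left q r)
  have "free_op lam r 0 = 0"
    using free_op_add_right[of lam r 0 0] by simp
  with mult_left show ?case
    by (simp add: free_op_mult)
qed (simp_all add: free_op_simps free_op_mult free_op_gen free_op_scalar loop_op_add loop_op_scale
    loop_op_bracket)

lift_definition uea_op :: "'a::field_char_0 \<Rightarrow> 'a uea \<Rightarrow> 'a mpoly \<Rightarrow> 'a mpoly" is free_op
proof (rule ext)
  fix lam :: 'a and q r :: "'a free_alg" and p
  assume "uea_rel q r"
  then have "free_op lam (q - r) p = 0"
    unfolding uea_rel_def by (rule free_op_ideal)
  then show "free_op lam q p = free_op lam r p"
    by (simp add: free_op_simps)
qed

lemma uea_op_add: "uea_op lam (u + w) p = uea_op lam u p + uea_op lam w p"
  by transfer (rule free_op_simps)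

lemma uea_op_mult: "uea_op lam (u * w) p = uea_op lam u (uea_op lam w p)"
  by transfer (rule free_op_mult)

lemma uea_op_inc: "uea_op lam (uea_inc x) p = loop_op lam x p"
  by transfer (rule free_op_gen)

lemma uea_op_scalar: "uea_op lam (uea_scalar c) p = pconst c * p"
  by transfer (rule free_op_scalar)

lemma uea_op_add_right: "uea_op lam u (p + q) = uea_op lam u p + uea_op lam u q"
  by transfer (rule free_op_add_right)

lemma uea_op_const_mult: "uea_op lam u (pconst c * p) = pconst c * uea_op lam u p"
proof -
  have "uea_op lam (u * uea_scalar c) p = uea_op lam (uea_scalar c * u) p"
    by (simp only: uea_scalar_commute)
  then show ?thesis
    by (simp add: uea_op_mult uea_op_scalar)
qed

lemma pconst_inject: "pconst c = pconst d \<longleftrightarrow> c = d"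
  by (metis pconst_def lookup_single_eq)

lemma loop_op_N_plus: "x \<in> loop_N_plus \<Longrightarrow> loop_op lam x 1 = 0"
  unfolding loop_N_plus_def
proof (induction rule: loop.span_induct_alt)
  case (step c x y)
  then show ?case
    using eop_const[of lam _ 1]
    by (auto simp: loop_op_add loop_op_scale loop_op_elt sl2_op_basis pconst_simps)
qed (rule loop_op_zero)

text \<open>The constants span a copy of the line \<open>F v\<close> inside the polynomials. So the value of the highest
  weight character can be read off from the action on \<open>1\<close>, and is unique.\<close>

lemma hw_char_uea_op: "hw_char lam u c \<Longrightarrow> uea_op lam u 1 = pconst c"
proof (induction rule: hw_char.induct)
  case (mult u c w d)
  then show ?case
    using uea_op_const_mult[of lam u d 1] by (simp add: uea_op_mult pconst_simps mult.commute)
qed (use hop_const[of lam _ 1] in \<open>simp_all add: uea_op_inc uea_op_scalar uea_op_add loop_op_elt sl2_op_basis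
    loop_op_N_plus pconst_simps\<close>)

lemma hw_char_unique: "hw_char (lam :: 'a::field_char_0) u c \<Longrightarrow> hw_char lam u d \<Longrightarrow> c = d"
  using hw_char_uea_op[of lam u c] hw_char_uea_op[of lam u d] by (simp add: pconst_inject)

lemma the_hw_char: "hw_char (lam :: 'a::field_char_0) u c \<Longrightarrow> (THE c. hw_char lam u c) = c"
  using hw_char_unique by (intro the_equality)

lemma hw_char_H: "x \<in> loop_H \<Longrightarrow> \<exists>c. hw_char lam (uea_inc x) c"
  unfolding loop_H_def
proof (induction rule: loop.span_induct_alt)
  case base
  show ?case
    using hw_char.scalar[of lam 0] by (auto simp: uea_inc_zero uea_scalar_zero)
next
  case (step c x y)
  then obtain n d where "x = loop_elt sl2_h n" "hw_char lam (uea_inc y) d"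
    by blast
  moreover have "\<exists>b. hw_char lam (uea_inc (loop_elt sl2_h n)) b"
    by (cases "n = 0") (auto intro: hw_char.H hw_char.H_zero)
  ultimately show ?case
    by (auto simp: uea_inc_add uea_inc_scale intro: hw_char.intros)
qed

lemma hw_char_total: "u \<in> uea_HN \<Longrightarrow> \<exists>c. hw_char lam u c"
  unfolding uea_HN_def
proof (induction rule: uea_subalgebra.induct)
  case (gen u)
  then show ?case
    using hw_char_H hw_char.N_plus by blast
qed (blast intro: hw_char.intros)+

section \<open>The imaginary Verma module\<close>

interpretation verma_tensor: tensor_product uea_HN "(*)" "hw_line lam" for lam :: "'a::field_char_0"
  by unfold_locales (simp_all add: hw_line_def mult.assoc)

interpretation verma: left_module "imaginary_verma lam" for lam :: "'a::field_char_0"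
  unfolding imaginary_verma_def by (rule verma_tensor.left_module_T)

abbreviation verma_act :: "'a::field_char_0 \<Rightarrow> 'a uea \<Rightarrow> 'a verma_carrier \<Rightarrow> 'a verma_carrier" where
  "verma_act lam u w \<equiv> u \<odot>\<^bsub>imaginary_verma lam\<^esub> w"

lemma carrier_hw_line: "b \<in> carrier (hw_line lam)"
  by (simp add: hw_line_def)

lemma hw_line_add: "b \<oplus>\<^bsub>hw_line lam\<^esub> b' = b + b'"
  by (simp add: hw_line_def)

lemma hw_line_smult:
  fixes lam :: "'a::field_char_0"
  shows "hw_char lam r c \<Longrightarrow> r \<odot>\<^bsub>hw_line lam\<^esub> b = c * b"
  using the_hw_char[of lam r c] by (simp add: hw_line_def)

lemma hw_line_smult_scalar:
  fixes lam :: "'a::field_char_0"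
  shows "uea_scalar c \<odot>\<^bsub>hw_line lam\<^esub> b = c * b"
  by (rule hw_line_smult) (rule hw_char.scalar)

lemma verma_vec_closed: "verma_vec (lam :: 'a::field_char_0) \<in> carrier (imaginary_verma lam)"
  unfolding verma_vec_def imaginary_verma_def by (rule verma_tensor.pure_closed) (rule carrier_hw_line)

lemma verma_act_vec: "verma_act lam u (verma_vec lam) = pure_tensor uea_HN (*) (hw_line lam) u 1"
  by (simp add: verma_vec_def imaginary_verma_def verma_tensor.smult_pure)

lemma uea_scalar_in_HN: "uea_scalar c \<in> uea_HN"
  unfolding uea_HN_def by (rule uea_subalgebra.scalar)

text \<open>Elements of \<open>U(\<H> \<oplus> \<N>\<^sup>+)\<close> move through the tensor sign and act on the generator by their character.\<close>

lemma verma_act_HN: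
  assumes "r \<in> uea_HN" "hw_char lam r c"
  shows "verma_act lam r (verma_vec lam) = verma_act lam (uea_scalar c) (verma_vec lam)"
proof -
  have "pure_tensor uea_HN (*) (hw_line lam) (1 * r) 1 = pure_tensor uea_HN (*) (hw_line lam) (1 * uea_scalar c) 1"
    using verma_tensor.pure_balanced[of r 1 lam 1] verma_tensor.pure_balanced[of "uea_scalar c" 1 lam 1] assms
    by (simp add: carrier_hw_line uea_scalar_in_HN hw_line_smult_scalar hw_line_smult[OF assms(2)])
  then show ?thesis
    by (simp add: verma_act_vec)
qed

lemma e_in_HN: "uea_inc (loop_elt sl2_e n) \<in> uea_HN"
  and h_in_HN: "uea_inc (loop_elt sl2_h n) \<in> uea_HN"
  unfolding uea_HN_def loop_H_def loop_N_plus_def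
  by (auto intro!: uea_subalgebra.gen loop.span_base)

lemma e_act_vec: "verma_act lam (uea_inc (loop_elt sl2_e n)) (verma_vec lam) = \<zero>\<^bsub>imaginary_verma lam\<^esub>"
proof -
  have "hw_char lam (uea_inc (loop_elt sl2_e n)) 0"
    by (rule hw_char.N_plus) (simp add: loop_N_plus_def loop.span_base)
  then show ?thesis
    using verma_act_HN[OF e_in_HN, of lam n 0] by (simp add: uea_scalar_zero verma.smult_zero_left verma_vec_closed)
qed

lemma h_act_vec:
  "verma_act lam (uea_inc (loop_elt sl2_h n)) (verma_vec lam)
     = verma_act lam (uea_scalar (if n = 0 then lam else 0)) (verma_vec lam)"
  by (rule verma_act_HN[OF h_in_HN]) (simp add: hw_char.H hw_char.H_zero)

text \<open>The universal property of the tensor product turns the highest weight vector \<open>1\<close> of the polynomial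
  model into an equivariant map from the Verma module.\<close>

lemma verma_to_mpoly:
  obtains \<Phi> :: "'a::field_char_0 verma_carrier \<Rightarrow> 'a mpoly"
  where "\<Phi> (verma_vec lam) = 1"
    and "\<And>w w'. w \<in> carrier (imaginary_verma lam) \<Longrightarrow> w' \<in> carrier (imaginary_verma lam)
      \<Longrightarrow> \<Phi> (w \<oplus>\<^bsub>imaginary_verma lam\<^esub> w') = \<Phi> w + \<Phi> w'"
    and "\<And>u w. w \<in> carrier (imaginary_verma lam) \<Longrightarrow> \<Phi> (verma_act lam u w) = uea_op lam u (\<Phi> w)"
proof -
  let ?g = "\<lambda>u b. uea_op lam u (pconst b)"
  have balanced: "?g (u * r) b = ?g u (r \<odot>\<^bsub>hw_line lam\<^esub> b)" if r: "r \<in> uea_HN" for u r b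
  proof -
    obtain c where c: "hw_char lam r c"
      using hw_char_total[OF r] by blast
    have "uea_op lam r (pconst b * 1) = pconst b * pconst c"
      by (simp only: uea_op_const_mult hw_char_uea_op[OF c])
    then show ?thesis
      by (simp add: uea_op_mult hw_line_smult[OF c] pconst_simps mult.commute)
  qed
  obtain \<Phi> where \<Phi>: "\<And>u b. \<Phi> (pure_tensor uea_HN (*) (hw_line lam) u b) = ?g u b"
    and add: "\<And>w w'. w \<in> carrier (imaginary_verma lam) \<Longrightarrow> w' \<in> carrier (imaginary_verma lam)
      \<Longrightarrow> \<Phi> (w \<oplus>\<^bsub>imaginary_verma lam\<^esub> w') = \<Phi> w + \<Phi> w'"
  proof (rule verma_tensor.tensor_universal[of lam ?g])
    show "?g a (m \<oplus>\<^bsub>hw_line lam\<^esub> m') = ?g a m + ?g a m'" for a m m'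
      by (simp add: hw_line_add pconst_simps uea_op_add_right)
  qed (auto simp: uea_op_add balanced carrier_hw_line imaginary_verma_def)
  show thesis
  proof
    show "\<Phi> (verma_vec lam) = 1"
      using uea_op_scalar[of lam 1 1] by (simp add: verma_vec_def \<Phi> uea_scalar_one pconst_simps)
    fix u w
    assume "w \<in> carrier (imaginary_verma lam)"
    then show "\<Phi> (verma_act lam u w) = uea_op lam u (\<Phi> w)"
      unfolding imaginary_verma_def
    proof (induction rule: verma_tensor.T_induct)
      case zero
      have "\<Phi> \<zero>\<^bsub>imaginary_verma lam\<^esub> = 0"
        using add[of "\<zero>\<^bsub>imaginary_verma lam\<^esub>" "\<zero>\<^bsub>imaginary_verma lam\<^esub>"] by simp
      then show ?case
        using verma.smult_zero_right[of lam u] uea_op_const_mult[of lam u 0 0]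
        by (simp add: imaginary_verma_def pconst_simps)
    next
      case (add w w')
      then show ?case
        using \<open>\<And>w w'. w \<in> carrier (imaginary_verma lam) \<Longrightarrow> w' \<in> carrier (imaginary_verma lam)
            \<Longrightarrow> \<Phi> (w \<oplus>\<^bsub>imaginary_verma lam\<^esub> w') = \<Phi> w + \<Phi> w'\<close>
          verma_tensor.smult_T_closed[of _ lam u]
        by (simp add: imaginary_verma_def verma_tensor.smult_T_add uea_op_add_right)
    qed (simp add: verma_tensor.smult_pure \<Phi> uea_op_mult)
  qed (rule add)
qed

text \<open>Substituting \<open>f \<otimes> t\<^sup>n\<close> for \<open>X\<^sub>n\<close>. The fold over a multiset makes sense because these elements of
  the enveloping algebra commute.\<close>

definition f_monomial :: "int multiset \<Rightarrow> 'a::field_char_0 uea" where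
  "f_monomial M = fold_mset (\<lambda>n u. uea_inc (loop_elt sl2_f n) * u) 1 M"

definition f_poly :: "'a::field_char_0 mpoly \<Rightarrow> 'a uea" where
  "f_poly p = lin_ext (\<lambda>M c. uea_scalar c * f_monomial M) p"

lemma uea_inc_elt_commutator:
  "uea_inc (loop_elt x m) * uea_inc (loop_elt y n)
     = uea_inc (loop_elt y n) * uea_inc (loop_elt x m) + uea_inc (loop_elt (sl2_bracket x y) (m + n))"
  using uea_inc_bracket[of "loop_elt x m" "loop_elt y n"] by (simp add: loop_bracket_elt)

lemma sl2_bracket_self: "sl2_bracket x x = 0"
  by transfer simp

lemma f_monomial_add_mset:
  "f_monomial (add_mset n M) = uea_inc (loop_elt sl2_f n) * (f_monomial M :: 'a::field_char_0 uea)"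
proof -
  interpret comp_fun_commute "\<lambda>n u. uea_inc (loop_elt sl2_f n) * (u :: 'a uea)"
  proof
    fix m n :: int
    have "uea_inc (loop_elt sl2_f m) * uea_inc (loop_elt sl2_f n)
        = uea_inc (loop_elt sl2_f n) * (uea_inc (loop_elt sl2_f m) :: 'a uea)"
      using uea_inc_elt_commutator[of m sl2_f n sl2_f] by (simp add: sl2_bracket_self uea_inc_zero)
    then show "(*) (uea_inc (loop_elt sl2_f m)) \<circ> (*) (uea_inc (loop_elt sl2_f n))
        = (*) (uea_inc (loop_elt sl2_f n)) \<circ> (*) (uea_inc (loop_elt sl2_f m) :: 'a uea)"
      by (simp add: fun_eq_iff mult.assoc[symmetric])
  qed
  show ?thesis
    by (simp add: f_monomial_def)
qed

interpretation f_poly: additive_on_coefficients "\<lambda>M c. uea_scalar c * f_monomial M"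
  by unfold_locales (simp add: uea_scalar_add distrib_right)

lemma f_poly_add: "f_poly (p + q) = f_poly p + f_poly q"
  and f_poly_single: "f_poly (Poly_Mapping.single M c) = uea_scalar c * f_monomial M"
  by (simp_all add: f_poly_def f_poly.lin_ext_add f_poly.lin_ext_single)

lemma f_poly_const: "f_poly (pconst c) = uea_scalar c"
  by (simp add: pconst_def f_poly_single f_monomial_def)

lemma f_poly_var: "f_poly (pvar n * p) = uea_inc (loop_elt sl2_f n) * f_poly p"
proof (induction p rule: poly_mapping_single_induct)
  case (single M c)
  have "uea_scalar c * (uea_inc (loop_elt sl2_f n) * f_monomial M)
      = uea_inc (loop_elt sl2_f n) * (uea_scalar c * f_monomial M)"
    by (simp only: mult.assoc[symmetric] uea_scalar_commute[of c "uea_inc (loop_elt sl2_f n)"])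
  then show ?case
    by (simp add: pvar_mult_single f_poly_single f_monomial_add_mset)
qed (simp add: distrib_left f_poly_add)

lemma f_poly_const_mult: "f_poly (pconst c * p) = uea_scalar c * f_poly p"
  by (induction p rule: poly_mapping_single_induct)
    (simp_all add: pconst_mult_single f_poly_single uea_scalar_mult mult.assoc distrib_left f_poly_add)

definition poly_vec :: "'a::field_char_0 \<Rightarrow> 'a mpoly \<Rightarrow> 'a verma_carrier" where
  "poly_vec lam p = verma_act lam (f_poly p) (verma_vec lam)"

lemma poly_vec_closed: "poly_vec lam p \<in> carrier (imaginary_verma lam)"
  by (simp add: poly_vec_def verma.smult_closed verma_vec_closed)

lemma poly_vec_add: "poly_vec lam (p + q) = poly_vec lam p \<oplus>\<^bsub>imaginary_verma lam\<^esub> poly_vec lam q"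
  by (simp add: poly_vec_def f_poly_add verma.smult_add_left verma_vec_closed)

lemma poly_vec_var: "poly_vec lam (pvar n * p) = verma_act lam (uea_inc (loop_elt sl2_f n)) (poly_vec lam p)"
  by (simp add: poly_vec_def f_poly_var verma.smult_mult verma_vec_closed)

lemma poly_vec_const_mult: "poly_vec lam (pconst c * p) = verma_act lam (uea_scalar c) (poly_vec lam p)"
  by (simp add: poly_vec_def f_poly_const_mult verma.smult_mult verma_vec_closed)

lemma poly_vec_const: "poly_vec lam (pconst c) = verma_act lam (uea_scalar c) (verma_vec lam)"
  by (simp add: poly_vec_def f_poly_const)

lemma poly_vec_one: "poly_vec lam 1 = verma_vec lam"
  using poly_vec_const[of lam 1] by (simp add: pconst_simps uea_scalar_one verma.smult_one verma_vec_closed)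

lemma poly_vec_zero: "poly_vec lam 0 = \<zero>\<^bsub>imaginary_verma lam\<^esub>"
  using poly_vec_const[of lam 0] by (simp add: pconst_simps uea_scalar_zero verma.smult_zero_left verma_vec_closed)

lemma verma_act_scalar_commute:
  "w \<in> carrier (imaginary_verma lam) \<Longrightarrow>
   verma_act lam u (verma_act lam (uea_scalar c) w) = verma_act lam (uea_scalar c) (verma_act lam u w)"
  by (simp only: verma.smult_mult[symmetric] uea_scalar_commute)

text \<open>The operators \<^const>\<open>hop\<close> and \<^const>\<open>eop\<close> obey the commutation rules of \<open>h \<otimes> t\<^sup>m\<close> and \<open>e \<otimes> t\<^sup>m\<close> with
  the \<open>f \<otimes> t\<^sup>n\<close>, so equivariance follows by induction on the polynomial.\<close>

lemma h_poly_vec: "verma_act lam (uea_inc (loop_elt sl2_h m)) (poly_vec lam p) = poly_vec lam (hop lam m p)"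
proof (induction p rule: mpoly_induct)
  case (const c)
  let ?l = "if m = 0 then lam else 0"
  have "verma_act lam (uea_inc (loop_elt sl2_h m)) (poly_vec lam (pconst c))
      = verma_act lam (uea_scalar c) (verma_act lam (uea_inc (loop_elt sl2_h m)) (verma_vec lam))"
    by (simp only: poly_vec_const verma_act_scalar_commute[OF verma_vec_closed, of lam "uea_inc _"])
  also have "\<dots> = verma_act lam (uea_scalar c * uea_scalar ?l) (verma_vec lam)"
    by (simp only: h_act_vec verma.smult_mult[OF verma_vec_closed])
  also have "\<dots> = poly_vec lam (pconst (c * ?l))"
    by (simp only: poly_vec_const uea_scalar_mult)
  also have "pconst (c * ?l) = hop lam m (pconst c)"
    by (simp add: hop_const mult.commute pconst_simps(1))
  finally show ?case .
next
  case (var n p)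
  have "uea_inc (loop_elt (sl2_bracket sl2_h sl2_f) (m + n))
      = uea_scalar (- 2) * (uea_inc (loop_elt sl2_f (m + n)) :: 'a uea)"
    by (simp only: sl2_standard_basis uea_inc_scale[symmetric] loop_scale_elt)
  then have "uea_inc (loop_elt sl2_h m) * uea_inc (loop_elt sl2_f n)
      = uea_inc (loop_elt sl2_f n) * uea_inc (loop_elt sl2_h m)
        + uea_scalar (- 2) * (uea_inc (loop_elt sl2_f (m + n)) :: 'a uea)"
    by (simp only: uea_inc_elt_commutator[of m sl2_h n sl2_f])
  then have "verma_act lam (uea_inc (loop_elt sl2_h m)) (poly_vec lam (pvar n * p))
      = verma_act lam (uea_inc (loop_elt sl2_f n) * uea_inc (loop_elt sl2_h m)
        + uea_scalar (- 2) * uea_inc (loop_elt sl2_f (m + n))) (poly_vec lam p)"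
    by (simp add: poly_vec_var poly_vec_closed flip: verma.smult_mult)
  also have "\<dots> = poly_vec lam (pvar n * hop lam m p + pconst (- 2) * (pvar (m + n) * p))"
    by (simp add: verma.smult_add_left verma.smult_mult poly_vec_closed var poly_vec_add poly_vec_var
        poly_vec_const_mult)
  also have "pvar n * hop lam m p + pconst (- 2) * (pvar (m + n) * p) = hop lam m (pvar n * p)"
    by (simp add: hop_var pconst_simps)
  finally show ?case .
qed (simp_all add: poly_vec_add verma.smult_add_right poly_vec_closed hop_add)

lemma e_poly_vec: "verma_act lam (uea_inc (loop_elt sl2_e m)) (poly_vec lam p) = poly_vec lam (eop lam m p)"
proof (induction p rule: mpoly_induct)
  case (const c)
  show ?case
    by (simp add: poly_vec_const verma_act_scalar_commute[OF verma_vec_closed, of lam "uea_inc _"] e_act_vec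
        eop_const poly_vec_zero verma.smult_zero_right)
next
  case (var n p)
  have "uea_inc (loop_elt sl2_e m) * uea_inc (loop_elt sl2_f n)
      = uea_inc (loop_elt sl2_f n) * uea_inc (loop_elt sl2_e m)
        + (uea_inc (loop_elt sl2_h (m + n)) :: 'a uea)"
    using uea_inc_elt_commutator[of m sl2_e n sl2_f] by (simp add: sl2_standard_basis)
  then have "verma_act lam (uea_inc (loop_elt sl2_e m)) (poly_vec lam (pvar n * p))
      = verma_act lam (uea_inc (loop_elt sl2_f n) * uea_inc (loop_elt sl2_e m)
        + uea_inc (loop_elt sl2_h (m + n))) (poly_vec lam p)"
    by (simp add: poly_vec_var poly_vec_closed flip: verma.smult_mult)
  also have "\<dots> = poly_vec lam (eop lam m (pvar n * p))"
    by (simp add: verma.smult_add_left verma.smult_mult poly_vec_closed var poly_vec_add poly_vec_var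
        h_poly_vec eop_var)
  finally show ?case .
qed (simp_all add: poly_vec_add verma.smult_add_right poly_vec_closed eop_add)

lemma uea_poly_vec: "verma_act lam u (poly_vec lam p) = poly_vec lam (uea_op lam u p)"
proof (induction u arbitrary: p rule: uea_induct)
  case (scalar c)
  show ?case
    by (simp add: uea_op_scalar poly_vec_const_mult)
next
  case (inc x)
  show ?case
    unfolding uea_op_inc
  proof (induction x rule: poly_mapping_single_induct)
    case (single n z)
    let ?A = "sl2_mat z"
    have "loop_elt z n = loop_elt (sl2_scale (?A $ 1 $ 2) sl2_e + sl2_scale (?A $ 1 $ 1) sl2_h
        + sl2_scale (?A $ 2 $ 1) sl2_f) n"
      by (rule arg_cong[OF sl2_decompose])
    also have "\<dots> = loop_scale (?A $ 1 $ 2) (loop_elt sl2_e n) + loop_scale (?A $ 1 $ 1) (loop_elt sl2_h n)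
        + loop_scale (?A $ 2 $ 1) (loop_elt sl2_f n)"
      by (simp add: loop_scale_elt single_add)
    finally have "uea_inc (loop_elt z n) = uea_scalar (?A $ 1 $ 2) * uea_inc (loop_elt sl2_e n)
        + uea_scalar (?A $ 1 $ 1) * uea_inc (loop_elt sl2_h n)
        + uea_scalar (?A $ 2 $ 1) * uea_inc (loop_elt sl2_f n)"
      by (simp add: uea_inc_add uea_inc_scale)
    then show ?case
      by (simp add: verma.smult_add_left verma.smult_mult poly_vec_closed e_poly_vec h_poly_vec loop_op_elt
          sl2_op_def poly_vec_add poly_vec_const_mult poly_vec_var)
  qed (simp add: uea_inc_add verma.smult_add_left poly_vec_closed loop_op_add poly_vec_add)
qed (simp_all add: verma.smult_add_left verma.smult_mult poly_vec_closed uea_op_add uea_op_mult poly_vec_add)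

text \<open>The image of the polynomials contains the generator and is stable under the enveloping algebra.\<close>

lemma poly_vec_surj:
  assumes "w \<in> carrier (imaginary_verma lam)"
  shows "\<exists>p. w = poly_vec lam p"
  using assms unfolding imaginary_verma_def
proof (induction rule: verma_tensor.T_induct)
  case zero
  show ?case
    using poly_vec_zero[of lam] by (metis imaginary_verma_def)
next
  case (pure u b)
  have "pure_tensor uea_HN (*) (hw_line lam) u b = verma_act lam (u * uea_scalar b) (verma_vec lam)"
    using verma_tensor.pure_balanced[of "uea_scalar b" 1 lam u]
    by (simp add: carrier_hw_line uea_scalar_in_HN hw_line_smult_scalar verma_act_vec)
  then show ?case
    using uea_poly_vec[of lam _ 1] by (metis poly_vec_one)
next
  case (add w w')
  then show ?case
    using poly_vec_add[of lam] by (metis imaginary_verma_def)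
qed

lemma fold_eop_by_uea: "\<exists>u. \<forall>p. uea_op lam u p = fold (eop lam) ms p"
proof (induction ms)
  case Nil
  show ?case
    using uea_op_scalar[of lam 1] by (auto simp: pconst_simps)
next
  case (Cons m ms)
  then obtain u where "\<forall>p. uea_op lam u p = fold (eop lam) ms p"
    by blast
  then have "\<forall>p. uea_op lam (u * uea_inc (loop_elt sl2_e m)) p = fold (eop lam) (m # ms) p"
    by (simp add: uea_op_mult uea_op_inc loop_op_elt sl2_op_basis)
  then show ?case ..
qed

text \<open>A nonzero vector comes from a nonzero polynomial, which some element of the enveloping algebra
  sends to \<open>1\<close>; equivariance carries this over.\<close>

lemma verma_simple:
  assumes "lam \<noteq> 0" "w \<in> carrier (imaginary_verma lam)" "w \<noteq> \<zero>\<^bsub>imaginary_verma lam\<^esub>"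
  shows "\<exists>u. verma_act lam u w = verma_vec lam"
proof -
  obtain p where w: "w = poly_vec lam p"
    using poly_vec_surj[OF assms(2)] by blast
  then have "p \<noteq> 0"
    using assms(3) poly_vec_zero by auto
  then obtain ms c where c: "c \<noteq> 0" "fold (eop lam) ms p = pconst c"
    using eop_reduce_to_const[OF assms(1)] by blast
  obtain u where u: "uea_op lam u p = pconst c"
    using fold_eop_by_uea[of lam ms] c(2) by metis
  have "uea_op lam (uea_scalar (inverse c) * u) p = 1"
    using c(1) by (simp add: uea_op_mult uea_op_scalar u pconst_simps(2) flip: pconst_simps(4))
  then have "verma_act lam (uea_scalar (inverse c) * u) w = verma_vec lam"
    by (simp add: w uea_poly_vec poly_vec_one)
  then show ?thesis ..
qed

section \<open>Localized and twisted modules\<close>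

lemma loc_diff: "loc (u - w) = loc u - loc w"
  using loc_hom(2)[of "u - w" w] by simp

lemma loc_zero: "loc 0 = 0"
  using loc_diff[of 0 0] by simp

lemma loc_power: "loc (u ^ n) = loc u ^ n"
  by (induction n) (simp_all add: loc_hom)

lemma f_alpha_inv_commute:
  assumes "loc f_alpha * a = a * loc f_alpha"
  shows "f_alpha_inv * a = a * (f_alpha_inv :: 'a::field uea_loc)"
proof -
  have "f_alpha_inv * a = f_alpha_inv * (a * loc f_alpha) * f_alpha_inv"
    by (simp add: mult.assoc f_alpha_inv)
  also have "\<dots> = (f_alpha_inv * loc f_alpha) * a * f_alpha_inv"
    by (simp only: assms[symmetric] mult.assoc)
  finally show ?thesis
    by (simp add: f_alpha_inv)
qed

lemma loc_scalar_central: "loc (uea_scalar c) * a = a * loc (uea_scalar c)"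
proof -
  obtain u n where a: "a = f_alpha_inv ^ n * loc u"
    using uea_loc_fraction by blast
  have "f_alpha_inv * loc (uea_scalar c) = loc (uea_scalar c) * f_alpha_inv"
    by (rule f_alpha_inv_commute) (simp only: loc_hom(3)[symmetric] uea_scalar_commute)
  then have "f_alpha_inv ^ n * loc (uea_scalar c) = loc (uea_scalar c) * f_alpha_inv ^ n"
    by (rule power_commuting_commutes)
  then have "loc (uea_scalar c) * (f_alpha_inv ^ n * loc u) = f_alpha_inv ^ n * (loc (uea_scalar c) * loc u)"
    by (simp only: mult.assoc[symmetric])
  also have "loc (uea_scalar c) * loc u = loc u * loc (uea_scalar c)"
    by (simp only: loc_hom(3)[symmetric] uea_scalar_commute)
  finally show ?thesis
    by (simp only: a mult.assoc)
qed

lemma ad_loc_f_alpha_nilpotent: "\<exists>n. (ad (loc f_alpha) ^^ n) (a :: 'a::field uea_loc) = 0"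
proof -
  obtain u k where a: "a = f_alpha_inv ^ k * loc u"
    using uea_loc_fraction by blast
  have comm: "loc f_alpha * f_alpha_inv ^ k = f_alpha_inv ^ k * (loc f_alpha :: 'a uea_loc)"
    by (rule power_commuting_commutes[symmetric]) (simp add: f_alpha_inv)
  have "ad (loc f_alpha) (f_alpha_inv ^ k * loc w) = f_alpha_inv ^ k * loc (ad f_alpha w)" for w :: "'a uea"
  proof -
    have "ad (loc f_alpha) (f_alpha_inv ^ k * loc w) = f_alpha_inv ^ k * ad (loc f_alpha) (loc w)"
      by (simp only: ad_def right_diff_distrib mult.assoc[symmetric] comm)
    then show ?thesis
      by (simp add: ad_def loc_diff loc_hom)
  qed
  then have "(ad (loc f_alpha) ^^ n) a = f_alpha_inv ^ k * loc ((ad f_alpha ^^ n) u)" for n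
    by (induction n) (simp_all add: a)
  moreover obtain n where "(ad f_alpha ^^ n) u = 0"
    using ad_f_alpha_nilpotent by blast
  ultimately show ?thesis
    by (metis loc_zero mult_zero_right)
qed

interpretation loc_conj: unipotent_conjugation "loc f_alpha" "f_alpha_inv :: 'a::field_char_0 uea_loc"
  "\<lambda>c. loc (uea_scalar c)"
proof
  fix c :: 'a and a :: "'a uea_loc"
  show "loc (uea_scalar c) * a = a * loc (uea_scalar c)"
    by (rule loc_scalar_central)
qed (simp_all add: f_alpha_inv uea_scalar_add uea_scalar_mult uea_scalar_one loc_hom ad_loc_f_alpha_nilpotent)

lemma Theta_eq_conj_power: "Theta = loc_conj.conj_power"
  by (intro ext) (simp add: Theta_def loc_conj.conj_power_def loc_conj.diff_conj_funpow mult.assoc)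

lemma left_module_Phi:
  assumes "left_module V"
  shows "left_module (Phi z V)"
proof -
  interpret V: left_module V
    by (rule assms)
  have "abelian_group (Phi z V)"
    using V.abelian_group_axioms
    by (simp add: Phi_def abelian_group_def abelian_monoid_def abelian_group_axioms_def)
  then show ?thesis
    by (intro left_module.intro left_module_axioms.intro)
      (simp_all add: Phi_def Theta_eq_conj_power loc_conj.conj_power_add loc_conj.conj_power_mult
        loc_conj.conj_power_fixed V.smult_closed V.smult_add_left V.smult_add_right V.smult_mult V.smult_one)
qed

text \<open>From \<open>f u = u f + ad f (u)\<close> one gets \<open>f\<^sup>-\<^sup>1 u = u f\<^sup>-\<^sup>1 - f\<^sup>-\<^sup>1 ad f (u) f\<^sup>-\<^sup>1\<close>, and \<open>ad f (u)\<close> has a smaller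
  index of nilpotency.\<close>

lemma f_alpha_inv_mult_right_fraction:
  "\<exists>w k. f_alpha_inv * loc u = loc w * (f_alpha_inv :: 'a::field_char_0 uea_loc) ^ k"
proof -
  obtain n where "(ad f_alpha ^^ n) u = 0"
    using ad_f_alpha_nilpotent by blast
  then show ?thesis
  proof (induction n arbitrary: u)
    case 0
    then have "f_alpha_inv * loc u = loc 0 * (f_alpha_inv :: 'a uea_loc) ^ 0"
      by (simp add: loc_zero)
    then show ?case
      by blast
  next
    case (Suc n)
    then have "(ad f_alpha ^^ n) (ad f_alpha u) = 0"
      by (simp add: funpow_swap1)
    then obtain w k where w: "f_alpha_inv * loc (ad f_alpha u) = loc w * (f_alpha_inv :: 'a uea_loc) ^ k"
      using Suc.IH by blast
    have "loc u * f_alpha_inv = f_alpha_inv * (loc f_alpha * loc u) * f_alpha_inv"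
      by (simp add: mult.assoc[symmetric] f_alpha_inv)
    also have "loc f_alpha * loc u = loc u * loc f_alpha + loc (ad f_alpha u)"
      by (simp add: ad_def loc_diff loc_hom)
    also have "f_alpha_inv * (loc u * loc f_alpha + loc (ad f_alpha u)) * f_alpha_inv
        = f_alpha_inv * loc u * (loc f_alpha * f_alpha_inv) + f_alpha_inv * loc (ad f_alpha u) * f_alpha_inv"
      by (simp only: distrib_left distrib_right mult.assoc)
    finally have "f_alpha_inv * loc u = loc u * f_alpha_inv - loc w * f_alpha_inv ^ k * (f_alpha_inv :: 'a uea_loc)"
      by (simp add: w f_alpha_inv)
    also have "loc u * f_alpha_inv = loc u * (loc f_alpha ^ k * f_alpha_inv ^ k) * (f_alpha_inv :: 'a uea_loc)"
      by (simp add: loc_conj.F_power_mult_finv_power)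
    also have "loc u * (loc f_alpha ^ k * f_alpha_inv ^ k) * f_alpha_inv - loc w * f_alpha_inv ^ k * f_alpha_inv
        = loc (u * f_alpha ^ k - w) * (f_alpha_inv :: 'a uea_loc) ^ Suc k"
      by (simp only: loc_diff loc_hom loc_power left_diff_distrib mult.assoc power_Suc2)
    finally show ?case
      by blast
  qed
qed

lemma right_fraction: "\<exists>w k. a = loc w * (f_alpha_inv :: 'a::field_char_0 uea_loc) ^ k"
proof -
  obtain u n where a: "a = f_alpha_inv ^ n * loc u"
    using uea_loc_fraction by blast
  have "\<exists>w k. f_alpha_inv ^ n * loc u = loc w * (f_alpha_inv :: 'a uea_loc) ^ k"
  proof (induction n)
    case 0
    have "f_alpha_inv ^ 0 * loc u = loc u * (f_alpha_inv :: 'a uea_loc) ^ 0"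
      by simp
    then show ?case
      by blast
  next
    case (Suc n)
    then obtain w k where wk: "f_alpha_inv ^ n * loc u = loc w * (f_alpha_inv :: 'a uea_loc) ^ k"
      by blast
    obtain w' k' where "f_alpha_inv * loc w = loc w' * (f_alpha_inv :: 'a uea_loc) ^ k'"
      using f_alpha_inv_mult_right_fraction by blast
    then have "f_alpha_inv ^ Suc n * loc u = loc w' * (f_alpha_inv :: 'a uea_loc) ^ (k' + k)"
      by (simp add: wk mult.assoc power_add) (simp add: mult.assoc[symmetric])
    then show ?case
      by blast
  qed
  then show ?thesis
    by (simp add: a)
qed

locale localized_module = M: left_module M for M :: "('a::field_char_0 uea, 'm) module" (structure)
begin

sublocale tensor_product UNIV "\<lambda>a u. a * loc u" M
  by unfold_locales (simp_all add: M.smult_closed mult.assoc)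

lemma left_module_loc_module: "left_module (loc_module M)"
  unfolding loc_module_def by (rule left_module_T)

sublocale V: left_module "loc_module M"
  by (rule left_module_loc_module)

lemma loc_vec_closed: "m \<in> carrier M \<Longrightarrow> loc_vec M a m \<in> carrier (loc_module M)"
  by (simp add: loc_vec_def loc_module_def pure_closed)

lemma smult_loc_vec: "a \<odot>\<^bsub>loc_module M\<^esub> loc_vec M b m = loc_vec M (a * b) m"
  by (simp add: loc_vec_def loc_module_def smult_pure)

lemma loc_vec_loc: "m \<in> carrier M \<Longrightarrow> loc_vec M (loc u) m = loc_vec M 1 (u \<odot> m)"
  using pure_balanced[of u m 1] by (simp add: loc_vec_def)

lemma loc_vec_add:
  "m \<in> carrier M \<Longrightarrow> m' \<in> carrier M \<Longrightarrow> loc_vec M a (m \<oplus> m') = loc_vec M a m \<oplus>\<^bsub>loc_module M\<^esub> loc_vec M a m'"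
  by (simp add: loc_vec_def loc_module_def pure_add_right)

lemma loc_vec_zero: "loc_vec M a \<zero> = \<zero>\<^bsub>loc_module M\<^esub>"
  using loc_vec_add[of \<zero> \<zero> a] by (intro V.zero_if_idem loc_vec_closed) simp_all

text \<open>Finitely many left fractions have a common denominator.\<close>

lemma clear_denominator:
  assumes "w \<in> carrier (loc_module M)"
  shows "\<exists>k m. m \<in> carrier M \<and> loc (f_alpha ^ k) \<odot>\<^bsub>loc_module M\<^esub> w = loc_vec M 1 m"
  using assms unfolding loc_module_def
proof (induction rule: T_induct)
  case zero
  show ?case
    using V.smult_zero_right[of "loc (f_alpha ^ 0)"] loc_vec_zero[of 1] by (metis M.zero_closed loc_module_def)
next
  case (pure a m)
  obtain u n where "a = f_alpha_inv ^ n * loc u"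
    using uea_loc_fraction by blast
  then have "loc (f_alpha ^ n) * a = loc u"
    by (simp add: loc_power loc_conj.F_power_mult_finv_power mult.assoc[symmetric])
  then have "loc (f_alpha ^ n) \<odot>\<^bsub>loc_module M\<^esub> loc_vec M a m = loc_vec M 1 (u \<odot> m)"
    by (simp add: smult_loc_vec loc_vec_loc pure)
  then show ?case
    using M.smult_closed[OF pure] unfolding loc_module_def loc_vec_def by blast
next
  case (add w w')
  then obtain k m k' m' where m: "m \<in> carrier M" "m' \<in> carrier M"
    and w: "loc (f_alpha ^ k) \<odot>\<^bsub>loc_module M\<^esub> w = loc_vec M 1 m"
      "loc (f_alpha ^ k') \<odot>\<^bsub>loc_module M\<^esub> w' = loc_vec M 1 m'"
    unfolding loc_module_def by blast
  have closed: "w \<in> carrier (loc_module M)" "w' \<in> carrier (loc_module M)"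
    using add.hyps by (simp_all add: loc_module_def)
  have "loc (f_alpha ^ (k' + k)) \<odot>\<^bsub>loc_module M\<^esub> w = loc_vec M 1 (f_alpha ^ k' \<odot> m)"
    using smult_loc_vec[of "loc (f_alpha ^ k')" 1 m]
    by (simp add: power_add loc_hom V.smult_mult closed w loc_vec_loc m)
  moreover have "loc (f_alpha ^ (k + k')) \<odot>\<^bsub>loc_module M\<^esub> w' = loc_vec M 1 (f_alpha ^ k \<odot> m')"
    using smult_loc_vec[of "loc (f_alpha ^ k)" 1 m']
    by (simp add: power_add loc_hom V.smult_mult closed w loc_vec_loc m)
  ultimately have "loc (f_alpha ^ (k + k')) \<odot>\<^bsub>loc_module M\<^esub> (w \<oplus>\<^bsub>loc_module M\<^esub> w')
      = loc_vec M 1 (f_alpha ^ k' \<odot> m \<oplus> f_alpha ^ k \<odot> m')"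
    by (simp add: V.smult_add_right closed loc_vec_add M.smult_closed m add.commute)
  then show ?case
    using m M.smult_closed unfolding loc_module_def by blast
qed

text \<open>A criterion for a vector to survive localization: an additive map \<open>\<mu>\<close> that is invariant under
  \<open>f\<^sub>\<alpha>\<close> extends to the localized module by \<open>f\<^sub>\<alpha>\<^sup>-\<^sup>n u \<otimes> m \<mapsto> \<mu> (u m)\<close>.\<close>

lemma loc_vec_nonzero:
  fixes \<mu> :: "'m \<Rightarrow> 'z::ring_1"
  assumes add: "\<And>m m'. m \<in> carrier M \<Longrightarrow> m' \<in> carrier M \<Longrightarrow> \<mu> (m \<oplus> m') = \<mu> m + \<mu> m'"
    and inv: "\<And>m. m \<in> carrier M \<Longrightarrow> \<mu> (f_alpha \<odot> m) = \<mu> m"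
    and m: "m \<in> carrier M" "\<mu> m \<noteq> 0"
  shows "loc_vec M 1 m \<noteq> \<zero>\<^bsub>loc_module M\<^esub>"
proof
  have inv_power: "\<mu> (f_alpha ^ k \<odot> m) = \<mu> m" if "m \<in> carrier M" for k m
    by (induction k) (simp_all add: M.smult_one M.smult_mult M.smult_closed inv that)
  \<comment> \<open>Any numerator will do: two numerators of a fraction agree up to multiplication by powers of f, which the functional does not see.\<close>
  define num where "num a = (SOME u. \<exists>n. a = ore_frac u n)" for a :: "'a uea_loc"
  have num: "\<mu> (num (ore_frac u n) \<odot> m) = \<mu> (u \<odot> m)" if "m \<in> carrier M" for u n m
  proof -
    have "\<exists>k. ore_frac u n = ore_frac (num (ore_frac u n)) k"
      unfolding num_def by (rule someI[of _ u]) blast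
    then obtain k i j where "f_alpha ^ i * u = f_alpha ^ j * num (ore_frac u n)"
      unfolding ore_frac_eq_iff by blast
    then have "\<mu> ((f_alpha ^ i * u) \<odot> m) = \<mu> ((f_alpha ^ j * num (ore_frac u n)) \<odot> m)"
      by simp
    then show ?thesis
      by (simp add: M.smult_mult M.smult_closed inv_power that)
  qed
  obtain \<Phi> where \<Phi>: "\<And>a m. m \<in> carrier M \<Longrightarrow> \<Phi> (loc_vec M a m) = \<mu> (num a \<odot> m)"
    and \<Phi>_add: "\<And>w w'. w \<in> carrier (loc_module M) \<Longrightarrow> w' \<in> carrier (loc_module M)
      \<Longrightarrow> \<Phi> (w \<oplus>\<^bsub>loc_module M\<^esub> w') = \<Phi> w + \<Phi> w'"
    unfolding loc_vec_def loc_module_def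
  proof (rule tensor_universal[of "\<lambda>a m. \<mu> (num a \<odot> m)"])
    fix a b :: "'a uea_loc" and m
    assume m: "m \<in> carrier M"
    obtain u w n where "a = ore_frac u n" "b = ore_frac w n"
      using ore_frac_common by blast
    then show "\<mu> (num (a + b) \<odot> m) = \<mu> (num a \<odot> m) + \<mu> (num b \<odot> m)"
      by (simp add: ore_frac_add_same num m M.smult_add_left add M.smult_closed)
  next
    fix a :: "'a uea_loc" and r m
    assume m: "m \<in> carrier M"
    obtain u n where a: "a = ore_frac u n"
      using ore_frac_cases by blast
    then have "a * loc r = ore_frac (u * r) n"
      by (simp add: ore_frac_eq loc_hom mult.assoc)
    then show "\<mu> (num (a * loc r) \<odot> m) = \<mu> (num a \<odot> (r \<odot> m))"
      by (simp add: a num m M.smult_closed M.smult_mult)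
  qed (auto simp: M.smult_add_right add M.smult_closed)
  assume "loc_vec M 1 m = \<zero>\<^bsub>loc_module M\<^esub>"
  moreover have "\<Phi> \<zero>\<^bsub>loc_module M\<^esub> = 0"
    using \<Phi>_add[of "\<zero>\<^bsub>loc_module M\<^esub>" "\<zero>\<^bsub>loc_module M\<^esub>"] by simp
  moreover have "\<Phi> (loc_vec M 1 m) = \<mu> m"
    using num[OF m(1), of 1 0] by (simp add: \<Phi> m ore_frac_one[symmetric] M.smult_one)
  ultimately show False
    using m(2) by simp
qed

end

interpretation loc_verma: localized_module "imaginary_verma lam" for lam :: "'a::field_char_0"
  by unfold_locales

text \<open>In the polynomial model \<open>f\<^sub>\<alpha>\<close> is multiplication by \<open>X\<^sub>0\<close>, so the sum of the coefficients, that is,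
  the evaluation of all variables at \<open>1\<close>, is an invariant functional. It has the value \<open>1\<close> at \<open>v\<close>.\<close>

lemma loc_verma_vec_nonzero:
  "loc_vec (imaginary_verma lam) 1 (verma_vec (lam :: 'a::field_char_0)) \<noteq> \<zero>\<^bsub>loc_module (imaginary_verma lam)\<^esub>"
proof -
  obtain \<Phi> :: "'a verma_carrier \<Rightarrow> 'a mpoly" where \<Phi>: "\<Phi> (verma_vec lam) = 1"
    "\<And>w w'. w \<in> carrier (imaginary_verma lam) \<Longrightarrow> w' \<in> carrier (imaginary_verma lam)
      \<Longrightarrow> \<Phi> (w \<oplus>\<^bsub>imaginary_verma lam\<^esub> w') = \<Phi> w + \<Phi> w'"
    "\<And>u w. w \<in> carrier (imaginary_verma lam) \<Longrightarrow> \<Phi> (verma_act lam u w) = uea_op lam u (\<Phi> w)"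
    using verma_to_mpoly by blast
  interpret eps: additive_on_coefficients "\<lambda>(M :: int multiset) (c :: 'a). c"
    by unfold_locales simp
  define eps where "eps p = lin_ext (\<lambda>(M :: int multiset) (c :: 'a). c) p" for p
  have eps_var: "eps (pvar n * p) = eps p" for n p
    unfolding eps_def
    by (induction p rule: poly_mapping_single_induct)
      (simp_all add: pvar_mult_single eps.lin_ext_single distrib_left eps.lin_ext_add)
  have "eps 1 = 1"
    using eps.lin_ext_single[of 0 1] by (simp add: eps_def)
  moreover have "uea_op lam f_alpha p = pvar 0 * p" for p
    by (simp add: f_alpha_def uea_op_inc loop_op_elt sl2_op_basis)
  ultimately show ?thesis
    by (intro loc_verma.loc_vec_nonzero[of lam "\<lambda>w. eps (\<Phi> w)"])
      (simp_all add: \<Phi> verma_vec_closed eps_var, simp add: eps_def eps.lin_ext_add)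
qed

lemma loop_module_restrict:
  fixes V :: "('a::field_char_0 uea_loc, 'm) module"
  assumes "left_module V"
  shows "loop_module V (restrict_scl V) (restrict_act V)"
proof -
  interpret V: left_module V
    by (rule assms)
  show ?thesis
  proof (intro loop_module.intro loop_module_axioms.intro V.abelian_group_axioms)
    fix c :: 'a and x w
    assume w: "w \<in> carrier V"
    have "loc (uea_inc x) * loc (uea_scalar c) = loc (uea_scalar c) * loc (uea_inc x)"
      by (rule loc_scalar_central[symmetric])
    then show "restrict_act V x (restrict_scl V c w) = restrict_scl V c (restrict_act V x w)"
      by (simp only: restrict_scl_def restrict_act_def V.smult_mult[OF w, symmetric])
  next
    fix x y w
    assume "w \<in> carrier V"
    then show "restrict_act V (loop_bracket x y) w
        = restrict_act V x (restrict_act V y w) \<ominus>\<^bsub>V\<^esub> restrict_act V y (restrict_act V x w)"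
      by (simp add: restrict_act_def uea_inc_bracket loc_diff loc_hom V.smult_diff_left V.smult_mult)
  qed (simp_all add: restrict_scl_def restrict_act_def V.smult_closed uea_scalar_one uea_scalar_mult
        uea_scalar_add uea_inc_add uea_inc_scale loc_hom V.smult_one V.smult_mult
        V.smult_add_left V.smult_add_right)
qed

text \<open>A loop submodule is stable under \<open>U\<close>, but a priori not under \<open>U\<^sub>\<alpha>\<close>; this is why denominators matter below.\<close>

lemma loop_submodule_uea_closed:
  fixes V :: "('a::field uea_loc, 'm) module"
  assumes "left_module V" "loop_submodule V (restrict_scl V) (restrict_act V) N" "w \<in> N"
  shows "loc u \<odot>\<^bsub>V\<^esub> w \<in> N"
proof -
  interpret V: left_module V
    by (rule assms)
  have N: "subgroup N (add_monoid V)" "\<And>c w. w \<in> N \<Longrightarrow> restrict_scl V c w \<in> N"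
    "\<And>x w. w \<in> N \<Longrightarrow> restrict_act V x w \<in> N"
    using assms(2) by (simp_all add: loop_submodule_def)
  have closed: "w \<in> carrier V" if "w \<in> N" for w
    using subgroup.mem_carrier[OF N(1) that] by simp
  show ?thesis
    using assms(3)
  proof (induction u arbitrary: w rule: uea_induct)
    case (scalar c)
    then show ?case
      using N(2) by (simp add: restrict_scl_def)
  next
    case (inc x)
    then show ?case
      using N(3) by (simp add: restrict_act_def)
  next
    case (add u u')
    then show ?case
      using subgroup.m_closed[OF N(1), of "loc u \<odot>\<^bsub>V\<^esub> w" "loc u' \<odot>\<^bsub>V\<^esub> w"]
      by (simp add: loc_hom V.smult_add_left closed)
  next
    case (mult u u')
    then show ?case
      by (simp add: loc_hom V.smult_mult closed)
  qed
qed

(* The condition on lam is necessary: for lam = 0 no twisted localization of the module is simple,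
   since evaluating f t^n at a t^n gives a homomorphism onto a proper nonzero quotient. *)
theorem proposition38:
  fixes lam x :: "'a::{alg_closed_field, field_char_0}"
    and c :: "nat \<Rightarrow> 'a \<Rightarrow> 'a"
  assumes "lam \<noteq> 0"
    and "\<And>k l. loc (e_alpha ^ k) \<odot>\<^bsub>twisted_loc x lam\<^esub> twisted_vec lam l =
           restrict_scl (twisted_loc x lam) (c k (x + of_int l)) (twisted_vec lam (l - int k))"
    and "\<And>k l. c k (x + of_int l) \<noteq> 0"
  shows "simple_loop_module (twisted_loc x lam)
           (restrict_scl (twisted_loc x lam)) (restrict_act (twisted_loc x lam))"
proof -
  let ?V = "twisted_loc x lam" and ?L = "loc_module (imaginary_verma lam)"
  let ?t = "\<lambda>l. twisted_vec lam l"
  have twisted: "left_module ?V"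
    unfolding twisted_loc_def by (rule left_module_Phi) (rule loc_verma.left_module_loc_module)
  interpret V: left_module ?V
    by (rule twisted)
  have carrier: "carrier ?V = carrier ?L" and zero: "\<zero>\<^bsub>?V\<^esub> = \<zero>\<^bsub>?L\<^esub>"
    and smult: "a \<odot>\<^bsub>?V\<^esub> w = Theta (- x) a \<odot>\<^bsub>?L\<^esub> w" for a w
    by (simp_all add: twisted_loc_def Phi_def)
  \<comment> \<open>Theta is invertible, so the twisted and the untwisted action have the same orbits.\<close>
  have untwist: "a \<odot>\<^bsub>?L\<^esub> w = Theta x a \<odot>\<^bsub>?V\<^esub> w" for a w
    by (simp add: smult Theta_eq_conj_power loc_conj.conj_power_conj_power loc_conj.conj_power_0)
  have inv_fixed: "f_alpha_inv ^ k \<odot>\<^bsub>?V\<^esub> w = f_alpha_inv ^ k \<odot>\<^bsub>?L\<^esub> w" for k w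
  proof -
    have "loc f_alpha * f_alpha_inv ^ k = f_alpha_inv ^ k * (loc f_alpha :: 'a uea_loc)"
      by (rule power_commuting_commutes[symmetric]) (simp add: f_alpha_inv)
    then show ?thesis
      by (simp add: smult Theta_eq_conj_power loc_conj.conj_power_fixed)
  qed
  have F_fixed: "loc f_alpha ^ k \<odot>\<^bsub>?V\<^esub> w = loc f_alpha ^ k \<odot>\<^bsub>?L\<^esub> w" for k w
    by (simp add: smult Theta_eq_conj_power loc_conj.conj_power_fixed power_commutes)
  let ?v = "loc_vec (imaginary_verma lam) 1 (verma_vec lam)"
  have v: "?v \<in> carrier ?L"
    by (rule loc_verma.loc_vec_closed[OF verma_vec_closed])
  have t_pos: "?t (int j) = loc f_alpha ^ j \<odot>\<^bsub>?L\<^esub> ?v"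
    and t_neg: "?t (- int j) = f_alpha_inv ^ j \<odot>\<^bsub>?L\<^esub> ?v" for j
    by (auto simp: twisted_vec_def f_alpha_powi_def)
  have all: "N = carrier ?V"
    if N: "loop_submodule ?V (restrict_scl ?V) (restrict_act ?V) N" and w: "w \<in> N" "w \<noteq> \<zero>\<^bsub>?V\<^esub>" for N w
  proof -
    have N_carrier: "N \<subseteq> carrier ?V"
      using N subgroup.subset by (fastforce simp: loop_submodule_def)
    have N_uea: "loc u \<odot>\<^bsub>?V\<^esub> w' \<in> N" if "w' \<in> N" for u w'
      using loop_submodule_uea_closed[OF twisted N that] .
    have wL: "w \<in> carrier ?L"
      using w N_carrier carrier by auto
    obtain k m where m: "m \<in> carrier (imaginary_verma lam)"
      and km: "loc (f_alpha ^ k) \<odot>\<^bsub>?L\<^esub> w = loc_vec (imaginary_verma lam) 1 m"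
      using loc_verma.clear_denominator[OF wL] by blast
    have "m \<noteq> \<zero>\<^bsub>imaginary_verma lam\<^esub>"
    proof
      assume "m = \<zero>\<^bsub>imaginary_verma lam\<^esub>"
      then have "(f_alpha_inv ^ k * loc f_alpha ^ k) \<odot>\<^bsub>?L\<^esub> w = \<zero>\<^bsub>?L\<^esub>"
        using km by (simp add: loc_verma.V.smult_mult wL loc_power loc_verma.loc_vec_zero loc_verma.V.smult_zero_right)
      then show False
        using w(2) by (simp add: loc_conj.finv_power_mult_F_power loc_verma.V.smult_one wL zero)
    qed
    then obtain u where "verma_act lam u m = verma_vec lam"
      using verma_simple[OF assms(1) m] by blast
    then have "(loc u * loc (f_alpha ^ k)) \<odot>\<^bsub>?L\<^esub> w = ?v"
      using loc_verma.smult_loc_vec[of lam "loc u" 1 m] loc_verma.loc_vec_loc[OF m, of u]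
      by (simp add: loc_verma.V.smult_mult wL km)
    then obtain b where b: "b \<odot>\<^bsub>?V\<^esub> w = ?v"
      using untwist by metis
    obtain j u' where "b = f_alpha_inv ^ j * loc u'"
      using uea_loc_fraction by blast
    then have "loc u' = loc f_alpha ^ j * b"
      by (simp add: mult.assoc[symmetric] loc_conj.F_power_mult_finv_power)
    then have "loc u' \<odot>\<^bsub>?V\<^esub> w = ?t (int j)"
      using wL by (simp add: V.smult_mult carrier b F_fixed t_pos)
    \<comment> \<open>Multiplying by the denominator of b replaces an element of the localized algebra by one of U.\<close>
    then have j: "?t (int j) \<in> N"
      using N_uea[OF w(1), of u'] by simp
    have t_N: "?t (int j - int k) \<in> N" for k
    proof -
      let ?c = "c k (x + of_int (int j))"
      have t_closed: "?t (int j - int k) \<in> carrier ?V"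
        by (simp add: twisted_vec_def carrier loc_verma.V.smult_closed v)
      have "restrict_scl ?V ?c (?t (int j - int k)) \<in> N"
        using N_uea[OF j, of "e_alpha ^ k"] assms(2)[of k "int j"] by simp
      then have "loc (uea_scalar (inverse ?c)) \<odot>\<^bsub>?V\<^esub> restrict_scl ?V ?c (?t (int j - int k)) \<in> N"
        by (rule N_uea)
      moreover have "inverse ?c * ?c = 1"
        using assms(3)[of k "int j"] by simp
      ultimately show ?thesis
        by (simp only: restrict_scl_def V.smult_mult[OF t_closed, symmetric] loc_hom(3)[symmetric]
            uea_scalar_mult[symmetric] uea_scalar_one loc_hom(1) V.smult_one[OF t_closed])
    qed
    have "w' \<in> N" if w': "w' \<in> carrier ?V" for w'
    proof -
      have w'L: "w' \<in> carrier ?L"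
        using w' carrier by simp
      obtain i m' where m': "m' \<in> carrier (imaginary_verma lam)"
        and im: "loc (f_alpha ^ i) \<odot>\<^bsub>?L\<^esub> w' = loc_vec (imaginary_verma lam) 1 m'"
        using loc_verma.clear_denominator[OF w'L] by blast
      obtain p where "m' = poly_vec lam p"
        using poly_vec_surj[OF m'] by blast
      then have "loc_vec (imaginary_verma lam) 1 m' = loc (f_poly p) \<odot>\<^bsub>?L\<^esub> ?v"
        using loc_verma.smult_loc_vec[of lam "loc (f_poly p)" 1 "verma_vec lam"]
        by (simp add: poly_vec_def loc_verma.loc_vec_loc[OF verma_vec_closed])
      then have "(f_alpha_inv ^ i * loc f_alpha ^ i) \<odot>\<^bsub>?L\<^esub> w' = (f_alpha_inv ^ i * loc (f_poly p)) \<odot>\<^bsub>?L\<^esub> ?v"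
        using im by (simp add: loc_verma.V.smult_mult w'L v loc_power)
      then have "w' = (f_alpha_inv ^ i * loc (f_poly p)) \<odot>\<^bsub>?L\<^esub> ?v"
        by (simp add: loc_conj.finv_power_mult_F_power loc_verma.V.smult_one w'L)
      then obtain a where a: "w' = a \<odot>\<^bsub>?V\<^esub> ?v"
        using untwist by metis
      \<comment> \<open>A right fraction: the denominator only changes the exponent of f, the numerator lies in U.\<close>
      obtain u'' n where "a = loc u'' * f_alpha_inv ^ n"
        using right_fraction by blast
      then have "w' = loc u'' \<odot>\<^bsub>?V\<^esub> ?t (- int n)"
        using v by (simp add: a V.smult_mult carrier inv_fixed t_neg)
      moreover have "?t (- int n) \<in> N"
        using t_N[of "j + n"] by simp
      ultimately show ?thesis
        using N_uea by simp
    qed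
    then show ?thesis
      using N_carrier by blast
  qed
  have nontrivial: "carrier ?V \<noteq> {\<zero>\<^bsub>?V\<^esub>}"
    using v loc_verma_vec_nonzero[of lam] by (auto simp: carrier zero)
  have "N = {\<zero>\<^bsub>?V\<^esub>} \<or> N = carrier ?V" if N: "loop_submodule ?V (restrict_scl ?V) (restrict_act ?V) N" for N
  proof -
    have "\<zero>\<^bsub>?V\<^esub> \<in> N"
      using N subgroup.one_closed[of N "add_monoid ?V"] by (simp add: loop_submodule_def)
    then show ?thesis
      using all[OF N] by blast
  qed
  then show ?thesis
    unfolding simple_loop_module_def using loop_module_restrict[OF twisted] nontrivial by blast
qed

end
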